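(* Consider the stochastic rigid body on $\mathbb R^3$ $$d\boldsymbol\Pi+\boldsymbol\Pi\times\boldsymbol\Omega\,dt+\boldsymbol\Pi\times\boldsymbol\sigma\circ dW_t=0,\qquad \boldsymbol\Omega=\mathbb I^{-1}\boldsymbol\Pi,$$ with $\mathbb I=\mathrm{diag}(I_1,I_1,I_3)$, $I_1,I_3>0$, and $\boldsymbol\sigma=(0,0,\sigma_3)$, $\sigma_3\in\mathbb R$. Then the energy $h(\boldsymbol\Pi)=\tfrac12\boldsymbol\Pi\cdot\mathbb I^{-1}\boldsymbol\Pi$ is conserved for all values of $I_1,I_3,\sigma_3$, and the system is integrable by quadratures: $\Pi_3$ is constant and, with $\gamma:=a\,\Pi_3$ and $a:=\frac{I_1-I_3}{I_1I_3}$, $$\Pi_1(t)=\Pi_1(0)\cos(\gamma t+\sigma_3W_t)-\Pi_2(0)\sin(\gamma t+\sigma_3W_t),$$ $$\Pi_2(t)=\Pi_2(0)\cos(\gamma t+\sigma_3W_t)+\Pi_1(0)\sin(\gamma t+\sigma_3W_t).$$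
   Context: $W_t$ is a standard Wiener process with $W_0=0$; $\circ$ denotes Stratonovich integration; $\times$ is the cross product in $\mathbb R^3$. *)

theory Defs
  imports "HOL-Probability.Probability"
begin

section \<open>Processes on a filtered probability space\<close>

text \<open>
  Processes are indexed by real time, of which only \<open>t \<ge> 0\<close> is meaningful.  The
  library's \<^locale>\<open>filtration\<close> ranges over the whole index type; a filtration given on
  \<open>[0, \<infinity>)\<close> is extended to negative times for instance by \<open>F t = F 0\<close>.  The usual
  conditions (completeness, right-continuity) are not required.
\<close>

definition filtered_prob_space :: "'a measure \<Rightarrow> (real \<Rightarrow> 'a measure) \<Rightarrow> bool" where
  "filtered_prob_space M F \<longleftrightarrow>
     prob_space M \<and> filtration (space M) F \<and> (\<forall>t. subalgebra M (F t))"

definition adapted ::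
    "(real \<Rightarrow> 'a measure) \<Rightarrow> (real \<Rightarrow> 'a \<Rightarrow> 'b::topological_space) \<Rightarrow> bool" where
  "adapted F X \<longleftrightarrow> (\<forall>t\<ge>0. X t \<in> borel_measurable (F t))"

definition continuous_paths ::
    "'a measure \<Rightarrow> (real \<Rightarrow> 'a \<Rightarrow> 'b::topological_space) \<Rightarrow> bool" where
  "continuous_paths M X \<longleftrightarrow> (AE \<omega> in M. continuous_on {0..} (\<lambda>t. X t \<omega>))"

definition wiener_process ::
    "'a measure \<Rightarrow> (real \<Rightarrow> 'a measure) \<Rightarrow> (real \<Rightarrow> 'a \<Rightarrow> real) \<Rightarrow> bool" where
  "wiener_process M F W \<longleftrightarrow>
     adapted F W \<and> continuous_paths M W \<and> (AE \<omega> in M. W 0 \<omega> = 0) \<and>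
     (\<forall>s t. 0 \<le> s \<and> s < t \<longrightarrow>
        distributed M lborel (\<lambda>\<omega>. W t \<omega> - W s \<omega>) (normal_density 0 (sqrt (t - s))) \<and>
        prob_space.indep_set M (sets (F s))
          {(\<lambda>\<omega>. W t \<omega> - W s \<omega>) -` A \<inter> space M | A. A \<in> sets borel})"

section \<open>Continuous semimartingales\<close>

definition martingale ::
    "'a measure \<Rightarrow> (real \<Rightarrow> 'a measure) \<Rightarrow> (real \<Rightarrow> 'a \<Rightarrow> real) \<Rightarrow> bool" where
  "martingale M F X \<longleftrightarrow>
     adapted F X \<and> (\<forall>t\<ge>0. integrable M (X t)) \<and>
     (\<forall>s t. 0 \<le> s \<and> s \<le> t \<longrightarrow> (AE \<omega> in M. real_cond_exp M (F s) (X t) \<omega> = X s \<omega>))"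

text \<open>
  The localizing stopping times may be taken finite: \<open>\<tau> n\<close> can always be replaced
  by \<open>min (\<tau> n) n\<close>.
\<close>

definition continuous_local_martingale ::
    "'a measure \<Rightarrow> (real \<Rightarrow> 'a measure) \<Rightarrow> (real \<Rightarrow> 'a \<Rightarrow> real) \<Rightarrow> bool" where
  "continuous_local_martingale M F X \<longleftrightarrow>
     adapted F X \<and> continuous_paths M X \<and> (AE \<omega> in M. X 0 \<omega> = 0) \<and>
     (\<exists>\<tau> :: nat \<Rightarrow> 'a \<Rightarrow> real.
        (\<forall>n. stopping_time F (\<tau> n) \<and> (\<forall>\<omega>\<in>space M. 0 \<le> \<tau> n \<omega>)) \<and>
        (AE \<omega> in M. incseq (\<lambda>n. \<tau> n \<omega>) \<and> filterlim (\<lambda>n. \<tau> n \<omega>) at_top sequentially) \<and>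
        (\<forall>n. martingale M F (\<lambda>t \<omega>. X (min t (\<tau> n \<omega>)) \<omega>)))"

definition is_partition :: "real \<Rightarrow> nat \<Rightarrow> (nat \<Rightarrow> real) \<Rightarrow> bool" where
  "is_partition t n p \<longleftrightarrow> p 0 = 0 \<and> p n = t \<and> (\<forall>i<n. p i \<le> p (Suc i))"

definition finite_variation :: "(real \<Rightarrow> real) \<Rightarrow> bool" where
  "finite_variation f \<longleftrightarrow>
     (\<forall>t\<ge>0. \<exists>B. \<forall>n p. is_partition t n p \<longrightarrow> (\<Sum>i<n. \<bar>f (p (Suc i)) - f (p i)\<bar>) \<le> B)"

definition continuous_semimartingale ::
    "'a measure \<Rightarrow> (real \<Rightarrow> 'a measure) \<Rightarrow> (real \<Rightarrow> 'a \<Rightarrow> real) \<Rightarrow> bool" where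
  "continuous_semimartingale M F X \<longleftrightarrow>
     adapted F X \<and> continuous_paths M X \<and>
     (\<exists>L V. continuous_local_martingale M F L \<and>
        adapted F V \<and> continuous_paths M V \<and> (AE \<omega> in M. finite_variation (\<lambda>t. V t \<omega>)) \<and>
        (AE \<omega> in M. \<forall>t\<ge>0. X t \<omega> = X 0 \<omega> + L t \<omega> + V t \<omega>))"

section \<open>The Stratonovich integral\<close>

definition stratonovich_sum ::
    "(real \<Rightarrow> 'a \<Rightarrow> real) \<Rightarrow> (real \<Rightarrow> 'a \<Rightarrow> 'b::real_vector) \<Rightarrow> nat \<Rightarrow> (nat \<Rightarrow> real) \<Rightarrow> 'a \<Rightarrow> 'b" where
  "stratonovich_sum W Y n p \<omega> =
     (\<Sum>i<n. (W (p (Suc i)) \<omega> - W (p i) \<omega>) *\<^sub>R ((1/2) *\<^sub>R (Y (p i) \<omega> + Y (p (Suc i)) \<omega>)))"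

text \<open>
  The random variable \<open>J\<close> is (a version of) the integral of \<open>Y\<close> against \<open>\<circ> dW\<close> over
  \<open>[0, t]\<close>: the limit in probability of the symmetric sums as the mesh tends to \<open>0\<close>.
  It is the classical definition of the Stratonovich integral, meant for continuous
  semimartingale integrands.
\<close>

definition has_stratonovich_integral ::
    "'a measure \<Rightarrow> (real \<Rightarrow> 'a \<Rightarrow> real) \<Rightarrow> real \<Rightarrow> (real \<Rightarrow> 'a \<Rightarrow> 'b::euclidean_space)
      \<Rightarrow> ('a \<Rightarrow> 'b) \<Rightarrow> bool" where
  "has_stratonovich_integral M W t Y J \<longleftrightarrow>
     J \<in> borel_measurable M \<and>
     (\<forall>\<epsilon>>0. \<forall>\<eta>>0. \<exists>\<delta>>0. \<forall>n p.
        is_partition t n p \<and> (\<forall>i<n. p (Suc i) - p i < \<delta>) \<longrightarrow>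
        measure M {\<omega> \<in> space M. norm (stratonovich_sum W Y n p \<omega> - J \<omega>) \<ge> \<epsilon>} < \<eta>)"

section \<open>The stochastic rigid body\<close>

definition inertia :: "real \<Rightarrow> real \<Rightarrow> real \<Rightarrow> real^3^3" where
  "inertia I1 I2 I3 = (\<chi> i j. if i = j then (vector [I1, I2, I3] :: real^3) $ i else 0)"

definition angular_velocity :: "real^3^3 \<Rightarrow> real^3 \<Rightarrow> real^3" where
  "angular_velocity II P = matrix_inv II *v P"

definition energy :: "real^3^3 \<Rightarrow> real^3 \<Rightarrow> real" where
  "energy II P = (1/2) * (P \<bullet> (matrix_inv II *v P))"

text \<open>
  Solutions of \<open>dP + P \<times> \<Omega> dt + P \<times> \<sigma> \<circ> dW = 0\<close>, read as an integral equation.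
\<close>

definition rigid_body_solution ::
    "'a measure \<Rightarrow> (real \<Rightarrow> 'a measure) \<Rightarrow> (real \<Rightarrow> 'a \<Rightarrow> real) \<Rightarrow> real^3^3 \<Rightarrow> real^3
      \<Rightarrow> (real \<Rightarrow> 'a \<Rightarrow> real^3) \<Rightarrow> bool" where
  "rigid_body_solution M F W II \<sigma> P \<longleftrightarrow>
     (\<forall>k. continuous_semimartingale M F (\<lambda>t \<omega>. P t \<omega> $ k)) \<and>
     (\<exists>S. \<forall>t\<ge>0.
        has_stratonovich_integral M W t (\<lambda>s \<omega>. cross3 (P s \<omega>) \<sigma>) (S t) \<and>
        (AE \<omega> in M.
           P t \<omega> - P 0 \<omega>
           + integral {0..t} (\<lambda>s. cross3 (P s \<omega>) (angular_velocity II (P s \<omega>)))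
           + S t \<omega> = 0))"

end

theory Submission
  imports Defs
begin

text \<open>
  Write \<open>\<theta>\<^sub>t = \<sigma>\<^sub>3 W\<^sub>t + \<gamma> t\<close>.  Stratonovich calculus obeys the ordinary product rule, so the equations say that
  \<open>(\<Pi>\<^sub>1, \<Pi>\<^sub>2)\<close> turned back by the angle \<open>\<theta>\<^sub>t\<close> is constant.  On a grid the product rule with trapezoidal means is
  an exact identity, and the only probabilistic input needed is associativity: if \<open>S\<close> is the Stratonovich
  integral of \<open>Z\<close>, then replacing the increments of \<open>S\<close> by \<open>Z \<circ> \<Delta>W\<close> inside a trapezoidal sum
  against \<open>U = cos \<theta>\<close> or \<open>sin \<theta>\<close> changes the sum by an amount that vanishes in probability.

  To see this, replace each increment of \<open>S\<close> by symmetric sums over a much finer grid.  The error splits into a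
  left-point (martingale) part, small by the second-moment isometry, and a cross-variation part.  The latter sums
  to nearly zero over long blocks, because symmetric sums on both grids have the same limit, and it has
  bounded total variation because the sums of squared increments of \<open>Z\<close> and \<open>W\<close> are bounded in
  probability; so a weight \<open>U\<close> that hardly varies within a block may be inserted.  For a local
  martingale this last bound comes from a convex function that is quadratic near the origin and
  linear outside, which avoids optional stopping.
\<close>

section \<open>Statements holding up to a set of small probability\<close>

text \<open>The obstacle is the absence of rates. The integral up to each single time is a limit in
  probability, so on a grid with n cells the n replacement errors are small one by one, but nothing
  bounds their sum. Hence three nested grids with \<open>N\<close>, \<open>N*k\<close> and
  \<open>N*k*m\<close> cells, fixed in this order: \<open>N\<close> makes \<open>U\<close> nearly
  constant on a block; \<open>k\<close> makes symmetric sums accurate at the \<open>N+1\<close>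
  block ends; \<open>m\<close>, which may depend on \<open>k\<close>, makes them accurate at all
  coarse grid points. The estimates on coarse cells must therefore be uniform in \<open>m\<close>,
  and this is what the moment bounds provide. Moreover the equation holds at each time only outside
  a null set depending on that time. The work is thus done at the countably many times in
  \<open>rat_times T\<close>, where path conditions are events, and continuity of paths gives all
  remaining times at the end. The angular speed is random, being \<open>a\<close> times the initial
  third component; its measurability with respect to \<open>F 0\<close> keeps the phase
  adapted.\<close>

definition mostly :: "'a measure \<Rightarrow> real \<Rightarrow> ('a \<Rightarrow> bool) \<Rightarrow> bool" where
  "mostly M \<eta> Q \<longleftrightarrow> (\<exists>B\<in>sets M. measure M B \<le> \<eta> \<and> (\<forall>\<omega>\<in>space M - B. Q \<omega>))"

text \<open>\<open>mostly\<close> asks for a measurable exceptional set, not for a measurable event,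
  so a property may be weakened to an arbitrary consequence. This is how pathwise inequalities enter
  probabilistic statements below.\<close>

lemma mostly_mono:
  assumes "mostly M \<eta> Q" "\<eta> \<le> \<eta>'" "\<And>\<omega>. \<omega> \<in> space M \<Longrightarrow> Q \<omega> \<Longrightarrow> R \<omega>"
  shows "mostly M \<eta>' R"
proof -
  obtain B where "B \<in> sets M" "measure M B \<le> \<eta>" "\<forall>\<omega>\<in>space M - B. Q \<omega>"
    using assms(1) unfolding mostly_def by auto
  then show ?thesis
    unfolding mostly_def using assms(2,3) by (intro bexI[of _ B]) auto
qed

text \<open>Tightness of the sequence, with one bound \<open>C\<close> for all indices and not only
  for large ones.\<close>

definition bounded_in_prob :: "'a measure \<Rightarrow> (nat \<Rightarrow> 'a \<Rightarrow> real) \<Rightarrow> bool" where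
  "bounded_in_prob M X \<longleftrightarrow> (\<forall>\<eta>>0. \<exists>C. \<forall>n. mostly M \<eta> (\<lambda>\<omega>. \<bar>X n \<omega>\<bar> \<le> C))"

lemma sets_Collect_Ball_countable:
  assumes "countable I" "\<And>i. i \<in> I \<Longrightarrow> {x\<in>space M. P i x} \<in> sets M"
  shows "{x\<in>space M. \<forall>i\<in>I. P i x} \<in> sets M"
proof (cases "I = {}")
  case False
  then have "{x\<in>space M. \<forall>i\<in>I. P i x} = (\<Inter>i\<in>I. {x\<in>space M. P i x})" by auto
  also have "\<dots> \<in> sets M" using assms False by (intro sets.countable_INT') auto
  finally show ?thesis .
qed simp

context prob_space
begin

lemma mostly_conj:
  assumes "mostly M \<eta>1 Q" "mostly M \<eta>2 R"
  shows "mostly M (\<eta>1 + \<eta>2) (\<lambda>\<omega>. Q \<omega> \<and> R \<omega>)"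
proof -
  obtain B1 where B1: "B1 \<in> sets M" "measure M B1 \<le> \<eta>1" "\<forall>\<omega>\<in>space M - B1. Q \<omega>"
    using assms(1) unfolding mostly_def by auto
  obtain B2 where B2: "B2 \<in> sets M" "measure M B2 \<le> \<eta>2" "\<forall>\<omega>\<in>space M - B2. R \<omega>"
    using assms(2) unfolding mostly_def by auto
  have "measure M (B1 \<union> B2) \<le> \<eta>1 + \<eta>2"
    using measure_Un_le[OF B1(1) B2(1)] B1(2) B2(2) by linarith
  then show ?thesis
    unfolding mostly_def using B1 B2 by (intro bexI[of _ "B1 \<union> B2"]) auto
qed

lemma mostly_AE:
  assumes "AE \<omega> in M. Q \<omega>" and "\<eta> \<ge> 0"
  shows "mostly M \<eta> Q"
proof -
  from assms(1) obtain N where "{\<omega>\<in>space M. \<not> Q \<omega>} \<subseteq> N" "emeasure M N = 0" "N \<in> sets M"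
    by (rule AE_E)
  then show ?thesis
    unfolding mostly_def using assms(2) by (intro bexI[of _ N]) (auto simp: measure_def)
qed

lemma mostly_Ball:
  assumes "finite I" "\<And>i. i \<in> I \<Longrightarrow> mostly M \<eta> (Q i)"
  shows "mostly M (real (card I) * \<eta>) (\<lambda>\<omega>. \<forall>i\<in>I. Q i \<omega>)"
  using assms
proof (induction I rule: finite_induct)
  case empty
  show ?case by (auto intro: mostly_AE)
next
  case (insert i I)
  have "mostly M (\<eta> + real (card I) * \<eta>) (\<lambda>\<omega>. Q i \<omega> \<and> (\<forall>i\<in>I. Q i \<omega>))"
    using insert by (intro mostly_conj) auto
  then show ?case
    by (rule mostly_mono) (use insert in \<open>auto simp: algebra_simps\<close>)
qed

text \<open>The tail events \<open>R k\<close>, on which \<open>Q j\<close> holds for all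
  \<open>j \<ge> k\<close>, increase to a set of full probability, so continuity of the measure from
  below makes one of them nearly full. This turns almost sure path properties into deterministic
  constants.\<close>

lemma mostly_eventually:
  assumes ae: "AE \<omega> in M. \<forall>\<^sub>F k in sequentially. Q k \<omega>"
    and meas: "\<And>k::nat. {\<omega>\<in>space M. Q k \<omega>} \<in> sets M" and "\<eta> > 0"
  shows "\<forall>\<^sub>F k in sequentially. mostly M \<eta> (Q k)"
proof -
  define R where "R k = {\<omega>\<in>space M. \<forall>j\<in>{k..}. Q j \<omega>}" for k
  have Rm: "R k \<in> sets M" for k
    unfolding R_def using meas by (intro sets.sets_Collect_countable_Ball) auto
  have "incseq R" by (auto simp: R_def incseq_def)
  then have lim: "(\<lambda>k. prob (R k)) \<longlonglongrightarrow> prob (\<Union>k. R k)"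
    using Rm by (intro finite_Lim_measure_incseq) auto
  have "AE \<omega> in M. \<omega> \<in> (\<Union>k. R k)"
    using ae by (rule AE_mp) (auto simp: R_def eventually_sequentially)
  then have one: "prob (\<Union>k. R k) = 1"
    using Rm by (subst prob_eq_1) auto
  have "\<forall>\<^sub>F k in sequentially. prob (R k) > 1 - \<eta>"
    using lim one \<open>\<eta> > 0\<close> by (intro order_tendstoD(1)[OF lim]) auto
  then show ?thesis
  proof eventually_elim
    case (elim k)
    have "prob (space M - R k) \<le> \<eta>"
      using elim prob_compl[OF Rm[of k]] by simp
    then show ?case
      unfolding mostly_def using Rm by (intro bexI[of _ "space M - R k"]) (auto simp: R_def)
  qed
qed

lemma mostly_Markov:
  assumes "integrable M X" "\<And>\<omega>. \<omega> \<in> space M \<Longrightarrow> 0 \<le> X \<omega>" "expectation X \<le> \<eta> * C" "C > 0"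
  shows "mostly M \<eta> (\<lambda>\<omega>. X \<omega> \<le> C)"
proof -
  have [measurable]: "X \<in> borel_measurable M" using assms(1) by auto
  have "prob {\<omega>\<in>space M. X \<omega> \<ge> C} \<le> expectation X / C"
    using assms by (intro integral_Markov_inequality_measure[where A="{}"]) auto
  also have "\<dots> \<le> \<eta>" using assms by (simp add: field_simps)
  finally show ?thesis
    unfolding mostly_def by (intro bexI[of _ "{\<omega>\<in>space M. X \<omega> \<ge> C}"]) auto
qed

text \<open>Exceptional sets of measure at most 1/(k+1) intersect in a null set.\<close>

lemma AE_if_mostly:
  assumes "\<And>\<eta>. \<eta> > 0 \<Longrightarrow> mostly M \<eta> Q"
  shows "AE \<omega> in M. Q \<omega>"
proof -
  have "\<forall>k::nat. \<exists>B\<in>sets M. measure M B \<le> inverse (Suc k) \<and> (\<forall>\<omega>\<in>space M - B. Q \<omega>)"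
    using assms unfolding mostly_def by simp
  then obtain B where B: "\<And>k. B k \<in> sets M" "\<And>k. measure M (B k) \<le> inverse (Suc k)"
      "\<And>k \<omega>. \<omega> \<in> space M - B k \<Longrightarrow> Q \<omega>" by metis
  have "measure M (\<Inter>k. B k) \<le> inverse (Suc k)" for k
    using finite_measure_mono[of "\<Inter>k. B k" "B k"] B(1,2)[of k] by (auto intro: order_trans)
  then have "measure M (\<Inter>k. B k) \<le> 0"
    using LIMSEQ_inverse_real_of_nat by (intro LIMSEQ_le_const) auto
  then have "(\<Inter>k. B k) \<in> null_sets M"
    using B(1) by (auto simp: null_sets_def emeasure_eq_measure measure_le_0_iff)
  then show ?thesis by (rule AE_I') (use B(3) in auto)
qed

lemma AE_eq_0_if_mostly_small:
  assumes "\<And>\<epsilon> \<eta>. \<epsilon> > 0 \<Longrightarrow> \<eta> > 0 \<Longrightarrow> mostly M \<eta> (\<lambda>\<omega>. \<bar>X \<omega>\<bar> \<le> \<epsilon>)"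
  shows "AE \<omega> in M. X \<omega> = (0::real)"
proof -
  have "AE \<omega> in M. \<forall>k. \<bar>X \<omega>\<bar> \<le> inverse (real (Suc k))"
    using assms by (subst AE_all_countable) (auto intro!: AE_if_mostly)
  then show ?thesis
  proof eventually_elim
    case (elim \<omega>)
    have "\<bar>X \<omega>\<bar> \<le> 0"
      by (rule LIMSEQ_le_const[OF LIMSEQ_inverse_real_of_nat]) (use elim in auto)
    then show ?case by simp
  qed
qed

lemma bounded_in_prob_dominated:
  assumes X: "bounded_in_prob M X" and Y: "bounded_in_prob M Y" and "c \<ge> 0"
    and Z: "AE \<omega> in M. \<forall>n. \<bar>Z n \<omega>\<bar> \<le> c * (\<bar>X n \<omega>\<bar> + \<bar>Y n \<omega>\<bar>)"
  shows "bounded_in_prob M Z"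
  unfolding bounded_in_prob_def
proof (intro allI impI)
  fix \<eta> :: real assume "\<eta> > 0"
  then have h: "\<eta>/2 > 0" by simp
  obtain C where C: "\<And>n. mostly M (\<eta>/2) (\<lambda>\<omega>. \<bar>X n \<omega>\<bar> \<le> C)"
    using X h unfolding bounded_in_prob_def by blast
  obtain D where D: "\<And>n. mostly M (\<eta>/2) (\<lambda>\<omega>. \<bar>Y n \<omega>\<bar> \<le> D)"
    using Y h unfolding bounded_in_prob_def by blast
  have "mostly M \<eta> (\<lambda>\<omega>. \<bar>Z n \<omega>\<bar> \<le> c * (C + D))" for n
  proof (rule mostly_mono[OF mostly_conj[OF mostly_conj[OF C[of n] D[of n]] mostly_AE[OF Z, of 0]]])
    fix \<omega> assume *: "(\<bar>X n \<omega>\<bar> \<le> C \<and> \<bar>Y n \<omega>\<bar> \<le> D) \<and> (\<forall>n. \<bar>Z n \<omega>\<bar> \<le> c * (\<bar>X n \<omega>\<bar> + \<bar>Y n \<omega>\<bar>))"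
    then have "\<bar>Z n \<omega>\<bar> \<le> c * (\<bar>X n \<omega>\<bar> + \<bar>Y n \<omega>\<bar>)" by blast
    also have "\<dots> \<le> c * (C + D)" using * \<open>c \<ge> 0\<close> by (intro mult_left_mono) auto
    finally show "\<bar>Z n \<omega>\<bar> \<le> c * (C + D)" .
  qed (use \<open>\<eta> > 0\<close> in auto)
  then show "\<exists>C. \<forall>n. mostly M \<eta> (\<lambda>\<omega>. \<bar>Z n \<omega>\<bar> \<le> C)" by blast
qed

end

section \<open>Moments of Wiener increments\<close>

locale filtered_wiener = prob_space M for M :: "'a measure" +
  fixes F :: "real \<Rightarrow> 'a measure" and W :: "real \<Rightarrow> 'a \<Rightarrow> real"
  assumes filtered: "filtered_prob_space M F"
    and wiener: "wiener_process M F W"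
begin

lemma subalgebra_F: "subalgebra M (F t)"
  using filtered by (auto simp: filtered_prob_space_def)

lemma sets_F: "sets (F t) \<subseteq> sets M" and space_F [simp]: "space (F t) = space M"
  using subalgebra_F[of t] by (auto simp: subalgebra_def)

lemma sets_F_mono: "s \<le> t \<Longrightarrow> sets (F s) \<subseteq> sets (F t)"
  using filtered by (auto simp: filtered_prob_space_def filtration_def)

lemma measurable_F_mono: "f \<in> measurable (F s) N \<Longrightarrow> s \<le> t \<Longrightarrow> f \<in> measurable (F t) N"
  by (rule measurable_from_subalg[of _ "F s"]) (auto simp: subalgebra_def sets_F_mono dest: subsetD)

lemma measurable_F_M: "f \<in> measurable (F s) N \<Longrightarrow> f \<in> measurable M N"
  by (rule measurable_from_subalg[OF subalgebra_F])

lemma adapted_F: "adapted F X \<Longrightarrow> 0 \<le> s \<Longrightarrow> s \<le> t \<Longrightarrow> X s \<in> borel_measurable (F t)"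
  by (auto simp: adapted_def intro: measurable_F_mono)

lemma adapted_M: "adapted F X \<Longrightarrow> 0 \<le> s \<Longrightarrow> X s \<in> borel_measurable M"
  by (auto simp: adapted_def intro: measurable_F_M)

lemma adapted_W: "adapted F W" and continuous_W: "continuous_paths M W"
  using wiener by (auto simp: wiener_process_def)

lemma W_even_moment:
  assumes "0 \<le> s" "s < t"
  shows "integrable M (\<lambda>\<omega>. (W t \<omega> - W s \<omega>) ^ (2 * k))"
    and "expectation (\<lambda>\<omega>. (W t \<omega> - W s \<omega>) ^ (2 * k)) = fact (2 * k) / ((2 / (t - s)) ^ k * fact k)"
proof -
  have d: "distributed M lborel (\<lambda>\<omega>. W t \<omega> - W s \<omega>) (normal_density 0 (sqrt (t - s)))"
    using wiener assms by (auto simp: wiener_process_def)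
  have sp: "0 < sqrt (t - s)" using assms by simp
  note m = normal_moment_even[OF sp, of 0 k]
  show "integrable M (\<lambda>\<omega>. (W t \<omega> - W s \<omega>) ^ (2 * k))"
    using distributed_integrable[OF d, of "\<lambda>x. x ^ (2 * k)"] integrable.intros[OF m] by simp
  show "expectation (\<lambda>\<omega>. (W t \<omega> - W s \<omega>) ^ (2 * k)) = fact (2 * k) / ((2 / (t - s)) ^ k * fact k)"
    using distributed_integral[OF d, of "\<lambda>x. x ^ (2 * k)"] has_bochner_integral_integral_eq[OF m] assms
    by simp
qed

lemma W_second_moment:
  assumes "0 \<le> s" "s < t"
  shows "integrable M (\<lambda>\<omega>. (W t \<omega> - W s \<omega>)\<^sup>2)" "expectation (\<lambda>\<omega>. (W t \<omega> - W s \<omega>)\<^sup>2) = t - s"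
  using W_even_moment[OF assms, of 1] by auto

lemma W_fourth_moment:
  assumes "0 \<le> s" "s < t"
  shows "integrable M (\<lambda>\<omega>. (W t \<omega> - W s \<omega>) ^ 4)"
    "expectation (\<lambda>\<omega>. (W t \<omega> - W s \<omega>) ^ 4) = 3 * (t - s)\<^sup>2"
  using W_even_moment[OF assms, of 2] by (auto simp: fact_numeral power2_eq_square)

lemma W_integrable_mean:
  assumes "0 \<le> s" "s < t"
  shows "integrable M (\<lambda>\<omega>. W t \<omega> - W s \<omega>)" "expectation (\<lambda>\<omega>. W t \<omega> - W s \<omega>) = 0"
proof -
  have d: "distributed M lborel (\<lambda>\<omega>. W t \<omega> - W s \<omega>) (normal_density 0 (sqrt (t - s)))"
    using wiener assms by (auto simp: wiener_process_def)
  have sp: "0 < sqrt (t - s)" using assms by simp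
  show "integrable M (\<lambda>\<omega>. W t \<omega> - W s \<omega>)"
    using distributed_integrable[OF d, of "\<lambda>x. x"] integrable_normal_moment[OF sp, of 0 1] by simp
  show "expectation (\<lambda>\<omega>. W t \<omega> - W s \<omega>) = 0"
    using distributed_integral[OF d, of "\<lambda>x. x"] integral_normal_moment_odd[OF sp, of 0 0] by simp
qed

text \<open>Preimages under an \<open>F s\<close>-measurable \<open>X\<close> lie in
  \<open>F s\<close>, so the independence of sets in \<open>wiener_process\<close> becomes
  independence of random variables, for which expectations of products factor.\<close>

lemma indep_W_increment:
  assumes st: "0 \<le> s" "s < t" and X: "X \<in> borel_measurable (F s)"
  shows "indep_var borel X borel (\<lambda>\<omega>. W t \<omega> - W s \<omega>)"
proof -
  let ?D = "\<lambda>\<omega>. W t \<omega> - W s \<omega>"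
  have [measurable]: "?D \<in> borel_measurable M" "X \<in> borel_measurable M"
    using adapted_M[OF adapted_W] st measurable_F_M[OF X] by auto
  have "indep_set (sets (F s)) {?D -` A \<inter> space M | A. A \<in> sets borel}"
    using wiener st by (auto simp: wiener_process_def)
  then have "indep_sets (case_bool (sets (F s)) {?D -` A \<inter> space M | A. A \<in> sets borel}) UNIV"
    by (simp add: indep_set_def)
  then have "indep_sets (\<lambda>i. {case_bool X ?D i -` A \<inter> space M | A. A \<in> sets (case_bool borel borel i)}) UNIV"
    by (rule indep_sets_mono_sets)
       (use measurable_sets[OF X] in \<open>auto split: bool.splits\<close>)
  then show ?thesis
    unfolding indep_var_def indep_vars_def2 by (auto split: bool.splits)
qed

text \<open>The isometry in the form of an inequality, by induction on the number of steps: the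
  mixed term has mean zero and each new square contributes at most \<open>K\<^sup>2\<close> times
  the time step. The measurability and nonnegativity conjuncts feed the induction.\<close>

lemma ito_sum:
  fixes s :: "nat \<Rightarrow> real" and c :: "nat \<Rightarrow> 'a \<Rightarrow> real"
  assumes s: "0 \<le> s 0" "\<And>j. j < n \<Longrightarrow> s j < s (Suc j)"
    and c: "\<And>j. j < n \<Longrightarrow> c j \<in> borel_measurable (F (s j))"
    and K: "\<And>j \<omega>. j < n \<Longrightarrow> \<omega> \<in> space M \<Longrightarrow> \<bar>c j \<omega>\<bar> \<le> K"
  shows "(\<lambda>\<omega>. \<Sum>j<n. c j \<omega> * (W (s (Suc j)) \<omega> - W (s j) \<omega>)) \<in> borel_measurable (F (s n))
    \<and> integrable M (\<lambda>\<omega>. (\<Sum>j<n. c j \<omega> * (W (s (Suc j)) \<omega> - W (s j) \<omega>))\<^sup>2)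
    \<and> expectation (\<lambda>\<omega>. (\<Sum>j<n. c j \<omega> * (W (s (Suc j)) \<omega> - W (s j) \<omega>))\<^sup>2) \<le> K\<^sup>2 * (s n - s 0)
    \<and> 0 \<le> s n"
  using assms
proof (induction n)
  case 0
  then show ?case by simp
next
  case (Suc n)
  define X where "X \<omega> = (\<Sum>j<n. c j \<omega> * (W (s (Suc j)) \<omega> - W (s j) \<omega>))" for \<omega>
  define D where "D \<omega> = W (s (Suc n)) \<omega> - W (s n) \<omega>" for \<omega>
  have IH: "X \<in> borel_measurable (F (s n))" "integrable M (\<lambda>\<omega>. (X \<omega>)\<^sup>2)"
     "expectation (\<lambda>\<omega>. (X \<omega>)\<^sup>2) \<le> K\<^sup>2 * (s n - s 0)" "0 \<le> s n"
    unfolding X_def using Suc by auto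
  have lt: "s n < s (Suc n)" and cn: "c n \<in> borel_measurable (F (s n))"
    and Kn: "\<And>\<omega>. \<omega> \<in> space M \<Longrightarrow> \<bar>c n \<omega>\<bar> \<le> K" using Suc.prems by auto
  have [measurable]: "D \<in> borel_measurable M" "X \<in> borel_measurable M" "c n \<in> borel_measurable M"
    unfolding D_def using adapted_M[OF adapted_W] IH(4) lt measurable_F_M[OF IH(1)] measurable_F_M[OF cn]
    by auto
  have Xi: "integrable M X"
    by (rule square_integrable_imp_integrable) (use IH in auto)
  have Xci: "integrable M (\<lambda>\<omega>. X \<omega> * c n \<omega>)"
  proof (rule Bochner_Integration.integrable_bound[where f="\<lambda>\<omega>. K * X \<omega>"])
    show "AE \<omega> in M. norm (X \<omega> * c n \<omega>) \<le> norm (K * X \<omega>)"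
    proof (rule AE_I2)
      fix \<omega> assume "\<omega> \<in> space M"
      then have "\<bar>c n \<omega>\<bar> * \<bar>X \<omega>\<bar> \<le> \<bar>K\<bar> * \<bar>X \<omega>\<bar>"
        using Kn by (intro mult_right_mono) fastforce+
      then show "norm (X \<omega> * c n \<omega>) \<le> norm (K * X \<omega>)"
        by (simp add: abs_mult mult.commute)
    qed
  qed (use Xi in auto)
  have D: "integrable M D" "expectation D = 0" "integrable M (\<lambda>\<omega>. (D \<omega>)\<^sup>2)"
      "expectation (\<lambda>\<omega>. (D \<omega>)\<^sup>2) = s (Suc n) - s n"
    unfolding D_def using W_integrable_mean[OF IH(4) lt] W_second_moment[OF IH(4) lt] by auto
  \<comment> \<open>The earlier sum and the new coefficient form one
    \<open>F (s n)\<close>-measurable factor, so the mixed term is a product of two independent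
    variables, one of which has mean zero.\<close>
  have ind: "indep_var borel (\<lambda>\<omega>. X \<omega> * c n \<omega>) borel D"
    unfolding D_def by (rule indep_W_increment[OF IH(4) lt]) (use IH(1) cn in measurable)
  have XcD: "integrable M (\<lambda>\<omega>. X \<omega> * c n \<omega> * D \<omega>)" "expectation (\<lambda>\<omega>. X \<omega> * c n \<omega> * D \<omega>) = 0"
    using indep_var_integrable[OF ind Xci D(1)] indep_var_lebesgue_integral[OF ind Xci D(1)] D(2)
    by auto
  have bound: "(c n \<omega> * D \<omega>)\<^sup>2 \<le> K\<^sup>2 * (D \<omega>)\<^sup>2" if "\<omega> \<in> space M" for \<omega>
    using Kn[OF that] by (auto simp: power_mult_distrib abs_le_square_iff[symmetric] intro!: mult_right_mono)
  have cD: "integrable M (\<lambda>\<omega>. (c n \<omega> * D \<omega>)\<^sup>2)"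
  proof (rule Bochner_Integration.integrable_bound[where f="\<lambda>\<omega>. K\<^sup>2 * (D \<omega>)\<^sup>2"])
    show "AE \<omega> in M. norm ((c n \<omega> * D \<omega>)\<^sup>2) \<le> norm (K\<^sup>2 * (D \<omega>)\<^sup>2)"
      using bound by (intro AE_I2) auto
  qed (use D in auto)
  have "expectation (\<lambda>\<omega>. (c n \<omega> * D \<omega>)\<^sup>2) \<le> expectation (\<lambda>\<omega>. K\<^sup>2 * (D \<omega>)\<^sup>2)"
    by (intro integral_mono cD) (use D bound in auto)
  then have cDE: "expectation (\<lambda>\<omega>. (c n \<omega> * D \<omega>)\<^sup>2) \<le> K\<^sup>2 * (s (Suc n) - s n)"
    using D by simp
  have sum: "(\<Sum>j<Suc n. c j \<omega> * (W (s (Suc j)) \<omega> - W (s j) \<omega>)) = X \<omega> + c n \<omega> * D \<omega>" for \<omega>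
    by (simp add: X_def D_def)
  have sq: "(X \<omega> + c n \<omega> * D \<omega>)\<^sup>2 = (X \<omega>)\<^sup>2 + 2 * (X \<omega> * c n \<omega> * D \<omega>) + (c n \<omega> * D \<omega>)\<^sup>2" for \<omega>
    by (simp add: power2_eq_square algebra_simps)
  have ex: "expectation (\<lambda>\<omega>. (X \<omega>)\<^sup>2 + 2 * (X \<omega> * c n \<omega> * D \<omega>) + (c n \<omega> * D \<omega>)\<^sup>2)
      = expectation (\<lambda>\<omega>. (X \<omega>)\<^sup>2) + expectation (\<lambda>\<omega>. (c n \<omega> * D \<omega>)\<^sup>2)"
    using IH(2) XcD cD by simp
  have m: "(\<lambda>\<omega>. X \<omega> + c n \<omega> * D \<omega>) \<in> borel_measurable (F (s (Suc n)))"
    unfolding D_def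
    using measurable_F_mono[OF IH(1)] measurable_F_mono[OF cn] lt IH(4)
      adapted_F[OF adapted_W, of "s n" "s (Suc n)"] adapted_F[OF adapted_W, of "s (Suc n)" "s (Suc n)"]
    by (intro borel_measurable_add borel_measurable_times borel_measurable_diff) auto
  have "integrable M (\<lambda>\<omega>. (X \<omega>)\<^sup>2 + 2 * (X \<omega> * c n \<omega> * D \<omega>) + (c n \<omega> * D \<omega>)\<^sup>2)"
    using IH(2) XcD cD by auto
  moreover have "expectation (\<lambda>\<omega>. (X \<omega>)\<^sup>2) + expectation (\<lambda>\<omega>. (c n \<omega> * D \<omega>)\<^sup>2) \<le> K\<^sup>2 * (s (Suc n) - s 0)"
    using IH(3) cDE by (simp add: algebra_simps)
  ultimately show ?case
    unfolding sum sq ex using m IH(4) lt unfolding sq by auto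
qed

end

section \<open>Left-point sums on refined grids\<close>

text \<open>Rational fractions of \<open>T\<close> rather than rational times: even for irrational
  \<open>T\<close> the set contains \<open>T\<close> and every uniform grid point. It is countable,
  so conditions quantified over it are events, and dense in the interval.\<close>

definition rat_times :: "real \<Rightarrow> real set" where
  "rat_times T = (\<lambda>q. T * q) ` (\<rat> \<inter> {0..1})"

definition grid :: "real \<Rightarrow> nat \<Rightarrow> nat \<Rightarrow> real" where
  "grid T n i = T * (real i / real n)"

lemma countable_rat_times: "countable (rat_times T)"
  unfolding rat_times_def by (intro countable_image countable_Int1 countable_rat)

lemma rat_times_subset: "T \<ge> 0 \<Longrightarrow> rat_times T \<subseteq> {0..T}"
  by (auto simp: rat_times_def mult_left_le)

lemma grid_in_times: "i \<le> n \<Longrightarrow> grid T n i \<in> rat_times T"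
  unfolding rat_times_def grid_def by (intro image_eqI[OF refl]) (auto simp: divide_le_eq_1)

lemma grid_nonneg: "T \<ge> 0 \<Longrightarrow> 0 \<le> grid T n i"
  by (simp add: grid_def)

lemma grid_0 [simp]: "grid T n 0 = 0"
  by (simp add: grid_def)

lemma grid_top: "n > 0 \<Longrightarrow> grid T n n = T"
  by (simp add: grid_def)

lemma grid_Suc_diff: "grid T n (Suc i) - grid T n i = T / real n"
  by (simp add: grid_def add_divide_distrib algebra_simps)

lemma grid_refine: "m > 0 \<Longrightarrow> grid T (n * m) (i * m) = grid T n i"
  by (simp add: grid_def)

lemma grid_mono: "T \<ge> 0 \<Longrightarrow> i \<le> j \<Longrightarrow> grid T n i \<le> grid T n j"
  unfolding grid_def by (intro mult_left_mono divide_right_mono) auto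

lemma grid_strict_mono: "T > 0 \<Longrightarrow> n > 0 \<Longrightarrow> i < j \<Longrightarrow> grid T n i < grid T n j"
  unfolding grid_def by (intro mult_strict_left_mono divide_strict_right_mono) auto

lemma grid_block_distance:
  assumes "m > 0" "T \<ge> 0" "j \<in> {i*m..i*m+m}"
  shows "\<bar>grid T (n*m) j - grid T n i\<bar> \<le> T / real n"
proof -
  have "grid T (n*m) j \<ge> grid T (n*m) (i*m)" "grid T (n*m) j \<le> grid T (n*m) (Suc i*m)"
    using assms by (intro grid_mono; auto)+
  then show ?thesis
    unfolding grid_refine[OF assms(1)] using grid_Suc_diff[of T n i] by linarith
qed

text \<open>\<open>ito_sum\<close> wants coefficients bounded everywhere, while increments of
  \<open>Z\<close> are small only outside an exceptional set. Truncation gives the bound without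
  losing adaptedness, and changes nothing off that set. It is also half the derivative of
  \<open>huber\<close>.\<close>

definition clip :: "real \<Rightarrow> real \<Rightarrow> real" where
  "clip K x = max (- K) (min K x)"

lemma abs_clip_le: "K \<ge> 0 \<Longrightarrow> \<bar>clip K x\<bar> \<le> K"
  by (auto simp: clip_def)

lemma clip_eq: "\<bar>x\<bar> \<le> K \<Longrightarrow> clip K x = x"
  by (auto simp: clip_def)

lemma clip_measurable [measurable]: "clip K \<in> borel_measurable borel"
  unfolding clip_def by measurable

text \<open>On coarse cell \<open>i\<close>, the left-point sum over the fine grid minus the single
  left-point term of the coarse grid.\<close>

definition ito_defect ::
    "real \<Rightarrow> (real \<Rightarrow> 'a \<Rightarrow> real) \<Rightarrow> (real \<Rightarrow> 'a \<Rightarrow> real) \<Rightarrow> nat \<Rightarrow> nat \<Rightarrow> nat \<Rightarrow> 'a \<Rightarrow> real" where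
  "ito_defect T W Z n m i \<omega> = (\<Sum>j=i*m..<i*m+m.
     (Z (grid T (n*m) j) \<omega> - Z (grid T n i) \<omega>) * (W (grid T (n*m) (Suc j)) \<omega> - W (grid T (n*m) j) \<omega>))"

context filtered_wiener
begin

text \<open>Almost every path is uniformly continuous on the compact interval, so the moduli 1/(k+1)
  work eventually along each path; \<open>mostly_eventually\<close> picks a nonrandom one.\<close>

lemma mostly_equicontinuous:
  assumes X: "adapted F X" "continuous_paths M X" and "T \<ge> 0" "\<epsilon> > 0" "\<eta> > 0"
  shows "\<exists>\<delta>>0. mostly M \<eta> (\<lambda>\<omega>. \<forall>s\<in>rat_times T. \<forall>t\<in>rat_times T. \<bar>s - t\<bar> \<le> \<delta> \<longrightarrow> \<bar>X s \<omega> - X t \<omega>\<bar> \<le> (\<epsilon>::real))"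
proof -
  define Q where "Q k \<omega> \<longleftrightarrow> (\<forall>s\<in>rat_times T. \<forall>t\<in>rat_times T.
    \<bar>s - t\<bar> \<le> inverse (real (Suc k)) \<longrightarrow> \<bar>X s \<omega> - X t \<omega>\<bar> \<le> \<epsilon>)" for k \<omega>
  have Xm[measurable]: "X s \<in> borel_measurable M" if "s \<in> rat_times T" for s
    using adapted_M[OF X(1)] rat_times_subset[OF \<open>T \<ge> 0\<close>] that by auto
  have "\<forall>\<^sub>F k in sequentially. mostly M \<eta> (Q k)"
  proof (rule mostly_eventually)
    show "AE \<omega> in M. \<forall>\<^sub>F k in sequentially. Q k \<omega>"
      using X(2) unfolding continuous_paths_def
    proof eventually_elim
      case (elim \<omega>)
      then have "uniformly_continuous_on {0..T} (\<lambda>t. X t \<omega>)"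
        by (intro compact_uniformly_continuous) (auto intro: continuous_on_subset)
      then obtain d where d: "d > 0"
        "\<And>s t. s \<in> {0..T} \<Longrightarrow> t \<in> {0..T} \<Longrightarrow> dist s t < d \<Longrightarrow> dist (X s \<omega>) (X t \<omega>) < \<epsilon>"
        unfolding uniformly_continuous_on_def using \<open>\<epsilon> > 0\<close> by metis
      have "\<forall>\<^sub>F k in sequentially. inverse (real (Suc k)) < d"
        using order_tendstoD(2)[OF LIMSEQ_inverse_real_of_nat d(1)] .
      then show ?case
      proof eventually_elim
        case (elim k)
        then show ?case
          unfolding Q_def using d(2)[unfolded dist_real_def] rat_times_subset[OF \<open>T \<ge> 0\<close>]
          by (meson le_less_trans less_imp_le subsetD)
      qed
    qed
    show "{\<omega> \<in> space M. Q k \<omega>} \<in> sets M" for k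
      unfolding Q_def by (intro sets_Collect_Ball_countable countable_rat_times sets.sets_Collect_imp) auto
  qed fact
  then obtain k where "mostly M \<eta> (Q k)"
    by (auto simp: eventually_sequentially)
  then show ?thesis
    unfolding Q_def by (intro exI[of _ "inverse (real (Suc k))"]) auto
qed

lemma mostly_bounded:
  assumes X: "adapted F X" "continuous_paths M X" and "T \<ge> 0" "\<eta> > 0"
  shows "\<exists>C. mostly M \<eta> (\<lambda>\<omega>. \<forall>s\<in>rat_times T. \<bar>X s \<omega>\<bar> \<le> (C::real))"
proof -
  define Q where "Q k \<omega> \<longleftrightarrow> (\<forall>s\<in>rat_times T. \<bar>X s \<omega>\<bar> \<le> real k)" for k \<omega>
  have Xm[measurable]: "X s \<in> borel_measurable M" if "s \<in> rat_times T" for s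
    using adapted_M[OF X(1)] rat_times_subset[OF \<open>T \<ge> 0\<close>] that by auto
  have "\<forall>\<^sub>F k in sequentially. mostly M \<eta> (Q k)"
  proof (rule mostly_eventually)
    show "AE \<omega> in M. \<forall>\<^sub>F k in sequentially. Q k \<omega>"
      using X(2) unfolding continuous_paths_def
    proof eventually_elim
      case (elim \<omega>)
      then have "bounded ((\<lambda>t. X t \<omega>) ` {0..T})"
        by (intro compact_imp_bounded compact_continuous_image) (auto intro: continuous_on_subset)
      then obtain C where C: "\<And>t. t \<in> {0..T} \<Longrightarrow> \<bar>X t \<omega>\<bar> \<le> C"
        unfolding bounded_iff by (metis image_eqI real_norm_def)
      have "\<forall>\<^sub>F k in sequentially. C \<le> real k"
        using filterlim_real_sequentially unfolding filterlim_at_top by blast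
      then show ?case
        by eventually_elim (use C rat_times_subset[OF \<open>T \<ge> 0\<close>] in \<open>force simp: Q_def\<close>)
    qed
    show "{\<omega> \<in> space M. Q k \<omega>} \<in> sets M" for k
      unfolding Q_def by (intro sets_Collect_Ball_countable countable_rat_times) auto
  qed fact
  then obtain k where "mostly M \<eta> (Q k)"
    by (auto simp: eventually_sequentially)
  then show ?thesis
    unfolding Q_def by auto
qed

text \<open>All fine points of a cell lie within \<open>T / real n\<close> of its left end, so the
  oscillation bound makes the truncation inactive.\<close>

lemma ito_defect_eq_clipped:
  assumes osc: "\<And>s t. s \<in> rat_times T \<Longrightarrow> t \<in> rat_times T \<Longrightarrow> \<bar>s - t\<bar> \<le> \<delta> \<Longrightarrow> \<bar>Z s \<omega> - Z t \<omega>\<bar> \<le> e"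
    and "T \<ge> 0" "m > 0" "T / real n \<le> \<delta>" "i < n"
  shows "ito_defect T W Z n m i \<omega> = (\<Sum>j=i*m..<i*m+m.
     clip e (Z (grid T (n*m) j) \<omega> - Z (grid T n i) \<omega>) * (W (grid T (n*m) (Suc j)) \<omega> - W (grid T (n*m) j) \<omega>))"
  unfolding ito_defect_def
proof (intro sum.cong refl arg_cong2[where f="(*)"])
  fix j assume j: "j \<in> {i*m..<i*m+m}"
  have "Suc i * m \<le> n * m" using \<open>i < n\<close> by (intro mult_right_mono) auto
  then have "j \<le> n * m" using j by auto
  then show "Z (grid T (n*m) j) \<omega> - Z (grid T n i) \<omega> = clip e (Z (grid T (n*m) j) \<omega> - Z (grid T n i) \<omega>)"
    using grid_block_distance[of m T j i n] assms j
    by (intro clip_eq[symmetric] osc grid_in_times) auto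
qed

text \<open>The coefficients are at most the oscillation \<open>e\<close> of \<open>Z\<close> over a
  coarse cell, so the second moment is at most \<open>e\<^sup>2 * T\<close> however large
  \<open>m\<close> is; hence \<open>\<delta>\<close> is uniform in \<open>m\<close>. Allowing
  \<open>n' \<le> n\<close> covers partial sums up to block ends.\<close>

lemma mostly_ito_defect_sum:
  assumes U: "adapted F U" "\<And>t \<omega>. \<bar>U t \<omega>\<bar> \<le> 1"
    and Z: "adapted F Z" "continuous_paths M Z" and "T > 0" "\<epsilon> > 0" "\<eta> > 0"
  shows "\<exists>\<delta>>0. \<forall>n m n'. m > 0 \<longrightarrow> n > 0 \<longrightarrow> T / real n \<le> \<delta> \<longrightarrow> n' \<le> n \<longrightarrow>
    mostly M \<eta> (\<lambda>\<omega>. \<bar>\<Sum>i<n'. U (grid T n i) \<omega> * ito_defect T W Z n m i \<omega>\<bar> \<le> \<epsilon>)"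
proof -
  \<comment> \<open>Chosen so that the second-moment bound divided by
    \<open>\<epsilon>\<^sup>2\<close> is \<open>\<eta>/2\<close>; the other half of
    \<open>\<eta>\<close> pays for the oscillation event.\<close>
  define e where "e = sqrt (\<eta> / 2 * \<epsilon>\<^sup>2 / T)"
  have e: "e > 0" "e\<^sup>2 * T = \<eta> / 2 * \<epsilon>\<^sup>2"
    using assms by (auto simp: e_def)
  obtain \<delta> where \<delta>: "\<delta> > 0" "mostly M (\<eta>/2) (\<lambda>\<omega>. \<forall>s\<in>rat_times T. \<forall>t\<in>rat_times T. \<bar>s - t\<bar> \<le> \<delta> \<longrightarrow> \<bar>Z s \<omega> - Z t \<omega>\<bar> \<le> e)"
    using mostly_equicontinuous[OF Z, of T e "\<eta>/2"] assms e by auto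
  show ?thesis
  proof (intro exI[of _ \<delta>] conjI \<delta> allI impI)
    fix n m n' :: nat assume mn: "m > 0" "n > 0" "T / real n \<le> \<delta>" "n' \<le> n"
    define s where "s = grid T (n*m)"
    \<comment> \<open>The double sum over cells and their fine points is flattened to one index;
      \<open>j div m\<close> recovers the coarse cell of the fine point \<open>j\<close>.\<close>
    define c where "c j \<omega> = U (grid T n (j div m)) \<omega> * clip e (Z (s j) \<omega> - Z (grid T n (j div m)) \<omega>)" for j \<omega>
    define X where "X \<omega> = (\<Sum>j<n'*m. c j \<omega> * (W (s (Suc j)) \<omega> - W (s j) \<omega>))" for \<omega>
    \<comment> \<open>The coarse point precedes the fine one, so the coefficient of each increment
      is known when that increment starts.\<close>
    have le: "grid T n (j div m) \<le> s j" for j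
      using grid_mono[of T "j div m * m" j "n*m"] \<open>T > 0\<close> mn(1) unfolding s_def grid_refine[OF mn(1)] by auto
    have cm: "c j \<in> borel_measurable (F (s j))" for j
    proof -
      have [measurable]: "U (grid T n (j div m)) \<in> borel_measurable (F (s j))"
        "Z (grid T n (j div m)) \<in> borel_measurable (F (s j))" "Z (s j) \<in> borel_measurable (F (s j))"
        using adapted_F[OF U(1) _ le] adapted_F[OF Z(1) _ le] adapted_F[OF Z(1), of "s j" "s j"] \<open>T > 0\<close>
        by (auto simp: grid_nonneg s_def)
      show ?thesis unfolding c_def by measurable
    qed
    have cb: "\<bar>c j \<omega>\<bar> \<le> e" for j \<omega>
      using mult_mono[OF U(2)[of "grid T n (j div m)" \<omega>] abs_clip_le[of e]] e(1)
      unfolding c_def abs_mult by fastforce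
    have "integrable M (\<lambda>\<omega>. (X \<omega>)\<^sup>2) \<and> expectation (\<lambda>\<omega>. (X \<omega>)\<^sup>2) \<le> e\<^sup>2 * (s (n'*m) - s 0)"
      unfolding X_def using ito_sum[of s "n'*m" c e] cm cb mn \<open>T > 0\<close> grid_strict_mono[of T "n*m"]
      by (auto simp: s_def)
    moreover have "s (n'*m) - s 0 \<le> T"
      using grid_mono[of T n' n n] grid_top[of n T] mn \<open>T > 0\<close> by (simp add: s_def grid_refine)
    then have "e\<^sup>2 * (s (n'*m) - s 0) \<le> \<eta>/2 * \<epsilon>\<^sup>2"
      unfolding e(2)[symmetric] by (intro mult_left_mono) auto
    ultimately have "mostly M (\<eta>/2) (\<lambda>\<omega>. (X \<omega>)\<^sup>2 \<le> \<epsilon>\<^sup>2)"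
      using assms by (intro mostly_Markov) auto
    from mostly_conj[OF this \<delta>(2)]
    show "mostly M \<eta> (\<lambda>\<omega>. \<bar>\<Sum>i<n'. U (grid T n i) \<omega> * ito_defect T W Z n m i \<omega>\<bar> \<le> \<epsilon>)"
    proof (rule mostly_mono)
      fix \<omega> assume *: "(X \<omega>)\<^sup>2 \<le> \<epsilon>\<^sup>2 \<and> (\<forall>s\<in>rat_times T. \<forall>t\<in>rat_times T. \<bar>s - t\<bar> \<le> \<delta> \<longrightarrow> \<bar>Z s \<omega> - Z t \<omega>\<bar> \<le> e)"
      have "(\<Sum>i<n'. U (grid T n i) \<omega> * ito_defect T W Z n m i \<omega>) =
        (\<Sum>i<n'. \<Sum>j=i*m..<i*m+m. c j \<omega> * (W (s (Suc j)) \<omega> - W (s j) \<omega>))"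
      proof (intro sum.cong refl)
        fix i assume "i \<in> {..<n'}"
        then have "i < n" using mn by auto
        have d: "ito_defect T W Z n m i \<omega> = (\<Sum>j=i*m..<i*m+m. clip e (Z (s j) \<omega> - Z (grid T n i) \<omega>)
           * (W (s (Suc j)) \<omega> - W (s j) \<omega>))"
          unfolding s_def by (rule ito_defect_eq_clipped) (use * mn \<open>T > 0\<close> \<open>i < n\<close> in auto)
        show "U (grid T n i) \<omega> * ito_defect T W Z n m i \<omega> = (\<Sum>j=i*m..<i*m+m. c j \<omega> * (W (s (Suc j)) \<omega> - W (s j) \<omega>))"
          unfolding d sum_distrib_left
        proof (intro sum.cong refl)
          fix j assume "j \<in> {i*m..<i*m+m}"
          then have "j div m = i" using mn(1) by (intro div_nat_eqI) (auto simp: mult.commute)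
          then show "U (grid T n i) \<omega> * (clip e (Z (s j) \<omega> - Z (grid T n i) \<omega>) * (W (s (Suc j)) \<omega> - W (s j) \<omega>))
            = c j \<omega> * (W (s (Suc j)) \<omega> - W (s j) \<omega>)"
            by (simp add: c_def)
        qed
      qed
      also have "\<dots> = X \<omega>" unfolding X_def by (rule sum.nat_group)
      finally show "\<bar>\<Sum>i<n'. U (grid T n i) \<omega> * ito_defect T W Z n m i \<omega>\<bar> \<le> \<epsilon>"
        using * \<open>\<epsilon> > 0\<close> abs_le_square_iff[of "X \<omega>" \<epsilon>] by simp
    qed simp
  qed
qed

text \<open>Each cell has second moment at most \<open>e\<^sup>2 * (T / n)\<close>, again uniformly
  in \<open>m\<close>, and the \<open>n\<close> cells add up to
  \<open>e\<^sup>2 * T\<close>.\<close>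

lemma mostly_ito_defect_squares:
  assumes Z: "adapted F Z" "continuous_paths M Z" and "T > 0" "\<epsilon> > 0" "\<eta> > 0"
  shows "\<exists>\<delta>>0. \<forall>n m. m > 0 \<longrightarrow> n > 0 \<longrightarrow> T / real n \<le> \<delta> \<longrightarrow>
    mostly M \<eta> (\<lambda>\<omega>. (\<Sum>i<n. (ito_defect T W Z n m i \<omega>)\<^sup>2) \<le> \<epsilon>)"
proof -
  define e where "e = sqrt (\<eta> / 2 * \<epsilon> / T)"
  have e: "e > 0" "e\<^sup>2 * T = \<eta> / 2 * \<epsilon>"
    using assms by (auto simp: e_def)
  obtain \<delta> where \<delta>: "\<delta> > 0" "mostly M (\<eta>/2) (\<lambda>\<omega>. \<forall>s\<in>rat_times T. \<forall>t\<in>rat_times T. \<bar>s - t\<bar> \<le> \<delta> \<longrightarrow> \<bar>Z s \<omega> - Z t \<omega>\<bar> \<le> e)"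
    using mostly_equicontinuous[OF Z, of T e "\<eta>/2"] assms e by auto
  show ?thesis
  proof (intro exI[of _ \<delta>] conjI \<delta> allI impI)
    fix n m :: nat assume mn: "m > 0" "n > 0" "T / real n \<le> \<delta>"
    define X where "X i \<omega> = (\<Sum>j=i*m..<i*m+m. clip e (Z (grid T (n*m) j) \<omega> - Z (grid T n i) \<omega>)
       * (W (grid T (n*m) (Suc j)) \<omega> - W (grid T (n*m) j) \<omega>))" for i \<omega>
    have X: "integrable M (\<lambda>\<omega>. (X i \<omega>)\<^sup>2) \<and> expectation (\<lambda>\<omega>. (X i \<omega>)\<^sup>2) \<le> e\<^sup>2 * (T / n)" for i
    proof -
      define s where "s j = grid T (n*m) (i*m+j)" for j
      define c where "c j \<omega> = clip e (Z (s j) \<omega> - Z (s 0) \<omega>)" for j \<omega>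
      have s: "0 \<le> s 0" "s 0 \<le> s j" "s j < s (Suc j)" "s 0 = grid T n i" "s m = grid T n (Suc i)" for j
        unfolding s_def
        using grid_nonneg[of T] \<open>T > 0\<close> mn grid_refine[OF mn(1), of T n i] grid_refine[OF mn(1), of T n "Suc i"]
          grid_mono[of T "i*m" "i*m+j" "n*m"] grid_strict_mono[of T "n*m" "i*m+j" "i*m+Suc j"]
        by (auto simp: add.commute)
      have cm: "c j \<in> borel_measurable (F (s j))" for j
      proof -
        have [measurable]: "Z (s 0) \<in> borel_measurable (F (s j))" "Z (s j) \<in> borel_measurable (F (s j))"
          using adapted_F[OF Z(1) s(1,2)] adapted_F[OF Z(1), of "s j" "s j"] s(1) s(2)[of j] by auto
        show ?thesis unfolding c_def by measurable
      qed
      have "X i \<omega> = (\<Sum>j<m. c j \<omega> * (W (s (Suc j)) \<omega> - W (s j) \<omega>))" for \<omega>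
        unfolding X_def c_def s(4)
        using sum.shift_bounds_nat_ivl[of "\<lambda>j. clip e (Z (grid T (n*m) j) \<omega> - Z (grid T n i) \<omega>)
       * (W (grid T (n*m) (Suc j)) \<omega> - W (grid T (n*m) j) \<omega>)" 0 "i*m" m]
        by (simp add: s_def atLeast0LessThan add.commute)
      then show ?thesis
        using ito_sum[of s m c e] s cm abs_clip_le[of e] e(1) grid_Suc_diff[of T n i] by (simp add: c_def)
    qed
    have "expectation (\<lambda>\<omega>. \<Sum>i<n. (X i \<omega>)\<^sup>2) = (\<Sum>i<n. expectation (\<lambda>\<omega>. (X i \<omega>)\<^sup>2))"
      using X by (intro Bochner_Integration.integral_sum) auto
    also have "\<dots> \<le> (\<Sum>i<n. e\<^sup>2 * (T / n))" using X by (intro sum_mono) auto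
    also have "\<dots> = \<eta>/2 * \<epsilon>" using mn e by simp
    finally have "mostly M (\<eta>/2) (\<lambda>\<omega>. (\<Sum>i<n. (X i \<omega>)\<^sup>2) \<le> \<epsilon>)"
      using X assms by (intro mostly_Markov) (auto intro: sum_nonneg)
    from mostly_conj[OF this \<delta>(2)]
    show "mostly M \<eta> (\<lambda>\<omega>. (\<Sum>i<n. (ito_defect T W Z n m i \<omega>)\<^sup>2) \<le> \<epsilon>)"
    proof (rule mostly_mono)
      fix \<omega> assume *: "(\<Sum>i<n. (X i \<omega>)\<^sup>2) \<le> \<epsilon> \<and> (\<forall>s\<in>rat_times T. \<forall>t\<in>rat_times T. \<bar>s - t\<bar> \<le> \<delta> \<longrightarrow> \<bar>Z s \<omega> - Z t \<omega>\<bar> \<le> e)"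
      have "ito_defect T W Z n m i \<omega> = X i \<omega>" if "i < n" for i
        unfolding X_def by (rule ito_defect_eq_clipped) (use * mn \<open>T > 0\<close> that in auto)
      then show "(\<Sum>i<n. (ito_defect T W Z n m i \<omega>)\<^sup>2) \<le> \<epsilon>" using * by simp
    qed simp
  qed
qed

end

section \<open>Sums of squared increments\<close>

definition sq_var :: "real \<Rightarrow> (real \<Rightarrow> 'a \<Rightarrow> real) \<Rightarrow> nat \<Rightarrow> 'a \<Rightarrow> real" where
  "sq_var T X n \<omega> = (\<Sum>i<n. (X (grid T n (Suc i)) \<omega> - X (grid T n i) \<omega>)\<^sup>2)"

lemma sq_var_nonneg: "0 \<le> sq_var T X n \<omega>"
  unfolding sq_var_def by (intro sum_nonneg) auto

text \<open>Twice the Huber loss: for \<open>K \<ge> 0\<close> it is the square of x on [-K, K] and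
  2K|x| - K^2 outside.\<close>

definition huber :: "real \<Rightarrow> real \<Rightarrow> real" where
  "huber K x = 2 * clip K x * x - (clip K x)\<^sup>2"

lemma huber_eq: "\<bar>x\<bar> \<le> K \<Longrightarrow> huber K x = x\<^sup>2"
  by (simp add: huber_def clip_eq power2_eq_square)

text \<open>Since \<open>huber K y\<close> is y^2 minus the squared distance from y to
  \<open>clip K y\<close>, and the tangent line at x has at y the value y^2 minus the squared
  distance from y to \<open>clip K x\<close>, convexity says that \<open>clip K y\<close> is the
  point of [-K, K] nearest to y.\<close>

lemma huber_tangent:
  assumes "K \<ge> 0"
  shows "huber K x + 2 * clip K x * (y - x) \<le> huber K y"
proof -
  have "(y - clip K y)\<^sup>2 \<le> (y - clip K x)\<^sup>2"
    unfolding abs_le_square_iff[symmetric] using assms by (auto simp: clip_def)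
  then show ?thesis by (simp add: huber_def power2_eq_square algebra_simps)
qed

lemma huber_nonneg: "K \<ge> 0 \<Longrightarrow> 0 \<le> huber K x"
  using huber_tangent[of K 0 x] by (simp add: huber_def clip_def)

text \<open>Linear growth matters because \<open>martingale\<close> provides only a first
  moment.\<close>

lemma huber_le: "K \<ge> 0 \<Longrightarrow> huber K x \<le> 2 * K * \<bar>x\<bar>"
proof -
  assume "K \<ge> 0"
  then have "clip K x * x \<le> K * \<bar>x\<bar>"
    using mult_right_mono[OF abs_clip_le[of K x], of "\<bar>x\<bar>"] abs_ge_self[of "clip K x * x"]
    by (simp add: abs_mult)
  then show ?thesis unfolding huber_def using zero_le_power2[of "clip K x"] by linarith
qed

lemma huber_measurable [measurable]: "huber K \<in> borel_measurable borel"
  unfolding huber_def by measurable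

context filtered_wiener
begin

lemma bounded_in_prob_sq_var_W:
  assumes "T > 0"
  shows "bounded_in_prob M (sq_var T W)"
  unfolding bounded_in_prob_def
proof (intro allI impI exI[of _ "T / _"])
  fix \<eta> :: real and n assume "\<eta> > 0"
  have m: "integrable M (\<lambda>\<omega>. (W (grid T n (Suc i)) \<omega> - W (grid T n i) \<omega>)\<^sup>2)"
    "expectation (\<lambda>\<omega>. (W (grid T n (Suc i)) \<omega> - W (grid T n i) \<omega>)\<^sup>2) = T / n" if "i < n" for i
    using W_second_moment[OF grid_nonneg grid_strict_mono, of T n i "Suc i"] assms that
    by (auto simp: grid_Suc_diff)
  have "expectation (sq_var T W n) = (\<Sum>i<n. T / n)"
    unfolding sq_var_def using m by (subst Bochner_Integration.integral_sum) auto
  also have "\<dots> \<le> T" using assms by simp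
  finally have "mostly M \<eta> (\<lambda>\<omega>. sq_var T W n \<omega> \<le> T / \<eta>)"
    using assms \<open>\<eta> > 0\<close> m sq_var_nonneg[of T W n]
    by (intro mostly_Markov) (auto simp: sq_var_def[abs_def])
  then show "mostly M \<eta> (\<lambda>\<omega>. \<bar>sq_var T W n \<omega>\<bar> \<le> T / \<eta>)"
    using sq_var_nonneg[of T W n] by simp
qed

text \<open>A bound for all cells at once takes fourth moments. By Cauchy-Schwarz the squared cell
  sum is at most m times the sum of fourth powers; summed over the cells its mean is 3 T^2 / n,
  which vanishes as n grows, uniformly in \<open>m\<close>.\<close>

lemma mostly_W_block_squares:
  assumes "T > 0" "\<epsilon> > 0" "\<eta> > 0"
  shows "\<exists>\<delta>>0. \<forall>n m. m > 0 \<longrightarrow> n > 0 \<longrightarrow> T / real n \<le> \<delta> \<longrightarrow>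
    mostly M \<eta> (\<lambda>\<omega>. \<forall>i<n. (\<Sum>j=i*m..<i*m+m. (W (grid T (n*m) (Suc j)) \<omega> - W (grid T (n*m) j) \<omega>)\<^sup>2) \<le> \<epsilon>)"
\<comment> \<open>This witness makes the mean \<open>3 * T * (T / n)\<close> at most
  \<open>\<eta> * \<epsilon>\<^sup>2\<close>, as Markov's inequality at level
  \<open>\<epsilon>\<^sup>2\<close> requires.\<close>
proof (intro exI[of _ "\<eta> * \<epsilon>\<^sup>2 / (3 * T)"] conjI allI impI)
  fix n m :: nat assume mn: "m > 0" "n > 0" "T / real n \<le> \<eta> * \<epsilon>\<^sup>2 / (3 * T)"
  define d where "d j \<omega> = W (grid T (n*m) (Suc j)) \<omega> - W (grid T (n*m) j) \<omega>" for j \<omega>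
  define X where "X \<omega> = (\<Sum>i<n. real m * (\<Sum>j=i*m..<i*m+m. (d j \<omega>) ^ 4))" for \<omega>
  have m4: "integrable M (\<lambda>\<omega>. (d j \<omega>) ^ 4)" "expectation (\<lambda>\<omega>. (d j \<omega>) ^ 4) = 3 * (T / (n * m))\<^sup>2" for j
    unfolding d_def
    using W_fourth_moment[OF grid_nonneg grid_strict_mono, of T "n*m" j "Suc j"] assms mn
    by (auto simp: grid_Suc_diff)
  have Xi: "integrable M X" unfolding X_def using m4 by auto
  have "expectation X = (\<Sum>i<n. real m * (\<Sum>j=i*m..<i*m+m. 3 * (T / (n * m))\<^sup>2))"
    unfolding X_def using m4 by simp
  also have "\<dots> = 3 * T * (T / n)" using mn by (simp add: field_simps power2_eq_square)
  also have "\<dots> \<le> \<eta> * \<epsilon>\<^sup>2" using mn(3) assms by (simp add: field_simps)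
  finally have "mostly M \<eta> (\<lambda>\<omega>. X \<omega> \<le> \<epsilon>\<^sup>2)"
  proof (intro mostly_Markov Xi)
    show "0 \<le> X \<omega>" for \<omega>
      unfolding X_def by (intro sum_nonneg mult_nonneg_nonneg) auto
  qed (use assms in auto)
  then show "mostly M \<eta> (\<lambda>\<omega>. \<forall>i<n. (\<Sum>j=i*m..<i*m+m. (W (grid T (n*m) (Suc j)) \<omega> - W (grid T (n*m) j) \<omega>)\<^sup>2) \<le> \<epsilon>)"
  proof (rule mostly_mono, safe)
    fix \<omega> i assume *: "X \<omega> \<le> \<epsilon>\<^sup>2" "i < n"
    have "(\<Sum>j=i*m..<i*m+m. 1 * (d j \<omega>)\<^sup>2)\<^sup>2 \<le> (\<Sum>j=i*m..<i*m+m. 1\<^sup>2) * (\<Sum>j=i*m..<i*m+m. ((d j \<omega>)\<^sup>2)\<^sup>2)"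
      by (rule Cauchy_Schwarz_ineq_sum)
    also have "\<dots> = real m * (\<Sum>j=i*m..<i*m+m. (d j \<omega>) ^ 4)" by simp
    also have "\<dots> \<le> X \<omega>"
      unfolding X_def using \<open>i < n\<close> by (intro member_le_sum) (auto intro!: sum_nonneg mult_nonneg_nonneg)
    finally have "(\<Sum>j=i*m..<i*m+m. (d j \<omega>)\<^sup>2)\<^sup>2 \<le> \<epsilon>\<^sup>2" using * by simp
    then show "(\<Sum>j=i*m..<i*m+m. (W (grid T (n*m) (Suc j)) \<omega> - W (grid T (n*m) j) \<omega>)\<^sup>2) \<le> \<epsilon>"
      unfolding d_def using \<open>\<epsilon> > 0\<close> by (meson less_imp_le power2_le_imp_le)
  qed
qed (use assms in auto)

section \<open>Squared increments of martingales and semimartingales\<close>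

lemma martingale_orthogonal:
  assumes X: "martingale M F X" and st: "0 \<le> s" "s \<le> t"
    and H: "H \<in> borel_measurable (F s)" "\<And>\<omega>. \<bar>H \<omega>\<bar> \<le> K"
  shows "integrable M (\<lambda>\<omega>. H \<omega> * (X t \<omega> - X s \<omega>))" "expectation (\<lambda>\<omega>. H \<omega> * (X t \<omega> - X s \<omega>)) = 0"
proof -
  interpret C: finite_measure_subalgebra M "F s"
    by unfold_locales (rule subalgebra_F)
  have Xi: "integrable M (X s)" "integrable M (X t)" using X st by (auto simp: martingale_def)
  have [measurable]: "H \<in> borel_measurable M" using measurable_F_M[OF H(1)] .
  have i: "integrable M (\<lambda>\<omega>. H \<omega> * Y \<omega>)" if "integrable M Y" for Y
  proof (rule Bochner_Integration.integrable_bound[where f="\<lambda>\<omega>. K * Y \<omega>"])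
    show "AE \<omega> in M. norm (H \<omega> * Y \<omega>) \<le> norm (K * Y \<omega>)"
    proof (rule AE_I2)
      fix \<omega>
      have "\<bar>H \<omega>\<bar> * \<bar>Y \<omega>\<bar> \<le> \<bar>K\<bar> * \<bar>Y \<omega>\<bar>"
        using H(2)[of \<omega>] by (intro mult_right_mono) auto
      then show "norm (H \<omega> * Y \<omega>) \<le> norm (K * Y \<omega>)" by (simp add: abs_mult)
    qed
  qed (use that in auto)
  have "expectation (\<lambda>\<omega>. H \<omega> * X t \<omega>) = expectation (\<lambda>\<omega>. H \<omega> * real_cond_exp M (F s) (X t) \<omega>)"
    using Xi by (intro C.real_cond_exp_intg(2)[symmetric] i H) auto
  also have "\<dots> = expectation (\<lambda>\<omega>. H \<omega> * X s \<omega>)"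
  proof (intro integral_cong_AE)
    have "AE \<omega> in M. real_cond_exp M (F s) (X t) \<omega> = X s \<omega>"
      using X st unfolding martingale_def by blast
    then show "AE \<omega> in M. H \<omega> * real_cond_exp M (F s) (X t) \<omega> = H \<omega> * X s \<omega>"
      by eventually_elim simp
  qed (use Xi in auto)
  finally have "expectation (\<lambda>\<omega>. H \<omega> * X t \<omega>) = expectation (\<lambda>\<omega>. H \<omega> * X s \<omega>)" .
  then show "integrable M (\<lambda>\<omega>. H \<omega> * (X t \<omega> - X s \<omega>))" "expectation (\<lambda>\<omega>. H \<omega> * (X t \<omega> - X s \<omega>)) = 0"
    using i[OF Xi(1)] i[OF Xi(2)] by (auto simp: right_diff_distrib)
qed

text \<open>The gap between \<open>huber\<close> and its tangent is nonnegative; its mean telescopes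
  over the grid because the linear term is orthogonal to the past. While the path stays in [-K, K]
  the gap is exactly the squared increment. The implication inside \<open>mostly\<close> replaces
  stopping at the exit from that interval.\<close>

lemma martingale_sq_var:
  assumes X: "martingale M F X" and "T > 0" "K \<ge> 0" "\<eta> > 0"
  shows "\<exists>C. \<forall>n. mostly M \<eta> (\<lambda>\<omega>. (\<forall>s\<in>rat_times T. \<bar>X s \<omega>\<bar> \<le> K) \<longrightarrow> sq_var T X n \<omega> \<le> C)"
proof -
  define A where "A = 2 * K * expectation (\<lambda>\<omega>. \<bar>X T \<omega>\<bar>)"
  have A: "A \<ge> 0" unfolding A_def using \<open>K \<ge> 0\<close> by simp
  show ?thesis
  \<comment> \<open>The summand 1 keeps the level positive when \<open>A = 0\<close>, as
    \<open>mostly_Markov\<close> demands.\<close>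
  proof (intro exI[of _ "(A + 1) / \<eta>"] allI)
    fix n
    show "mostly M \<eta> (\<lambda>\<omega>. (\<forall>s\<in>rat_times T. \<bar>X s \<omega>\<bar> \<le> K) \<longrightarrow> sq_var T X n \<omega> \<le> (A + 1) / \<eta>)"
    proof (cases "n = 0")
      case True
      then show ?thesis using A assms by (auto intro!: mostly_AE simp: sq_var_def)
    next
      case False
      define Y where "Y i = X (grid T n i)" for i
      have ad: "adapted F X" using X by (simp add: martingale_def)
      have gn: "0 \<le> grid T n i" for i using grid_nonneg \<open>T > 0\<close> by simp
      have Yi [simp]: "integrable M (Y i)" for i
        unfolding Y_def using X gn by (auto simp: martingale_def)
      have Ym [measurable]: "Y i \<in> borel_measurable M" for i using Yi by blast
      have hi: "integrable M (\<lambda>\<omega>. huber K (Y i \<omega>))" for i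
        by (rule Bochner_Integration.integrable_bound[where f="\<lambda>\<omega>. 2 * K * \<bar>Y i \<omega>\<bar>"])
           (use huber_nonneg huber_le \<open>K \<ge> 0\<close> in \<open>auto simp: abs_mult\<close>)
      have orth: "integrable M (\<lambda>\<omega>. clip K (Y i \<omega>) * (Y (Suc i) \<omega> - Y i \<omega>))"
        "expectation (\<lambda>\<omega>. clip K (Y i \<omega>) * (Y (Suc i) \<omega> - Y i \<omega>)) = 0" for i
      proof -
        have [measurable]: "Y i \<in> borel_measurable (F (grid T n i))"
          unfolding Y_def by (rule adapted_F[OF ad gn]) simp
        have c: "(\<lambda>\<omega>. clip K (Y i \<omega>)) \<in> borel_measurable (F (grid T n i))" by measurable
        show "integrable M (\<lambda>\<omega>. clip K (Y i \<omega>) * (Y (Suc i) \<omega> - Y i \<omega>))"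
          "expectation (\<lambda>\<omega>. clip K (Y i \<omega>) * (Y (Suc i) \<omega> - Y i \<omega>)) = 0"
          unfolding Y_def
          using martingale_orthogonal[OF X gn[of i] grid_mono[of T i "Suc i" n] c abs_clip_le[OF \<open>K \<ge> 0\<close>]] \<open>T > 0\<close>
          by (auto simp: Y_def)
      qed
      \<comment> \<open>The tangent gap over one grid step.\<close>
      define G where "G i \<omega> = huber K (Y (Suc i) \<omega>) - huber K (Y i \<omega>)
          - 2 * (clip K (Y i \<omega>) * (Y (Suc i) \<omega> - Y i \<omega>))" for i \<omega>
      have Gi: "integrable M (G i)" for i
        unfolding G_def using hi orth by auto
      have GE: "expectation (G i) = expectation (\<lambda>\<omega>. huber K (Y (Suc i) \<omega>)) - expectation (\<lambda>\<omega>. huber K (Y i \<omega>))" for i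
        unfolding G_def using hi orth by simp
      have G0: "0 \<le> G i \<omega>" for i \<omega>
        using huber_tangent[OF \<open>K \<ge> 0\<close>, of "Y i \<omega>" "Y (Suc i) \<omega>"] by (simp add: G_def)
      have "expectation (\<lambda>\<omega>. \<Sum>i<n. G i \<omega>)
          = (\<Sum>i<n. expectation (\<lambda>\<omega>. huber K (Y (Suc i) \<omega>)) - expectation (\<lambda>\<omega>. huber K (Y i \<omega>)))"
        using Gi by (simp add: GE)
      also have "\<dots> = expectation (\<lambda>\<omega>. huber K (Y n \<omega>)) - expectation (\<lambda>\<omega>. huber K (Y 0 \<omega>))"
        by (rule sum_lessThan_telescope)
      also have "\<dots> \<le> expectation (\<lambda>\<omega>. huber K (Y n \<omega>))"
        using huber_nonneg[OF \<open>K \<ge> 0\<close>] by simp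
      also have "\<dots> \<le> expectation (\<lambda>\<omega>. 2 * K * \<bar>Y n \<omega>\<bar>)"
        using huber_le[OF \<open>K \<ge> 0\<close>] by (intro integral_mono hi) auto
      also have "\<dots> = A" unfolding A_def Y_def using False by (simp add: grid_top)
      finally have "mostly M \<eta> (\<lambda>\<omega>. (\<Sum>i<n. G i \<omega>) \<le> (A + 1) / \<eta>)"
        using A \<open>\<eta> > 0\<close> Gi G0 by (intro mostly_Markov) (auto intro: sum_nonneg)
      moreover have "sq_var T X n \<omega> \<le> (A + 1) / \<eta>"
        if *: "(\<Sum>i<n. G i \<omega>) \<le> (A + 1) / \<eta>" "\<forall>s\<in>rat_times T. \<bar>X s \<omega>\<bar> \<le> K" for \<omega>
      proof -
        have "\<bar>Y i \<omega>\<bar> \<le> K" if "i \<le> n" for i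
          unfolding Y_def using * that by (auto intro: grid_in_times)
        then have "(Y (Suc i) \<omega> - Y i \<omega>)\<^sup>2 = G i \<omega>" if "i < n" for i
          using that by (simp add: G_def huber_eq clip_eq power2_eq_square algebra_simps)
        then have "sq_var T X n \<omega> = (\<Sum>i<n. G i \<omega>)"
          unfolding sq_var_def Y_def[symmetric] by (intro sum.cong) (auto simp: Y_def)
        then show "sq_var T X n \<omega> \<le> (A + 1) / \<eta>" using * by simp
      qed
      ultimately show ?thesis
        by (auto elim!: mostly_mono)
    qed
  qed
qed

text \<open>With probability close to 1 some fixed \<open>\<tau> k\<close> exceeds \<open>T\<close>
  and the path is bounded by \<open>K0\<close>; there the stopped martingale agrees with
  \<open>L\<close> on the whole grid, so its bound transfers.\<close>

lemma local_martingale_sq_var: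
  assumes L: "continuous_local_martingale M F L" and "T > 0"
  shows "bounded_in_prob M (sq_var T L)"
  unfolding bounded_in_prob_def
proof (intro allI impI)
  fix \<eta> :: real assume "\<eta> > 0"
  have ad: "adapted F L" and ct: "continuous_paths M L"
    using L by (auto simp: continuous_local_martingale_def)
  obtain \<tau> where st: "\<And>n. stopping_time F (\<tau> n)"
    and tau: "AE \<omega> in M. incseq (\<lambda>n. \<tau> n \<omega>) \<and> filterlim (\<lambda>n. \<tau> n \<omega>) at_top sequentially"
    and mart: "\<And>n::nat. martingale M F (\<lambda>t \<omega>. L (min t (\<tau> n \<omega>)) \<omega>)"
    using L unfolding continuous_local_martingale_def by blast
  obtain K0 where K0: "mostly M (\<eta>/3) (\<lambda>\<omega>. \<forall>s\<in>rat_times T. \<bar>L s \<omega>\<bar> \<le> K0)"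
    using mostly_bounded[OF ad ct, of T "\<eta>/3"] \<open>T > 0\<close> \<open>\<eta> > 0\<close> by auto
  have "\<forall>\<^sub>F k in sequentially. mostly M (\<eta>/3) (\<lambda>\<omega>. \<not> \<tau> k \<omega> \<le> T)"
  proof (rule mostly_eventually)
    show "AE \<omega> in M. \<forall>\<^sub>F k in sequentially. \<not> \<tau> k \<omega> \<le> T"
      using tau by eventually_elim (auto simp: filterlim_at_top_dense not_le)
    have "{\<omega> \<in> space M. \<tau> k \<omega> \<le> T} \<in> sets M" for k
      using st[of k] sets_F[of T] unfolding stopping_time_def pred_def by auto
    then show "{\<omega> \<in> space M. \<not> \<tau> k \<omega> \<le> T} \<in> sets M" for k
      by (intro sets.sets_Collect_neg)
  qed (use \<open>\<eta> > 0\<close> in auto)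
  then obtain k where k: "mostly M (\<eta>/3) (\<lambda>\<omega>. \<not> \<tau> k \<omega> \<le> T)"
    by (auto simp: eventually_sequentially)
  obtain C where C: "\<And>n. mostly M (\<eta>/3) (\<lambda>\<omega>. (\<forall>s\<in>rat_times T. \<bar>L (min s (\<tau> k \<omega>)) \<omega>\<bar> \<le> max 0 K0)
      \<longrightarrow> sq_var T (\<lambda>t \<omega>. L (min t (\<tau> k \<omega>)) \<omega>) n \<omega> \<le> C)"
    using martingale_sq_var[OF mart[of k] \<open>T > 0\<close>, of "max 0 K0" "\<eta>/3"] \<open>\<eta> > 0\<close> by auto
  have "mostly M \<eta> (\<lambda>\<omega>. \<bar>sq_var T L n \<omega>\<bar> \<le> C)" for n
    using mostly_conj[OF mostly_conj[OF C[of n] k] K0]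
  proof (rule mostly_mono)
    fix \<omega> assume *: "(((\<forall>s\<in>rat_times T. \<bar>L (min s (\<tau> k \<omega>)) \<omega>\<bar> \<le> max 0 K0)
      \<longrightarrow> sq_var T (\<lambda>t \<omega>. L (min t (\<tau> k \<omega>)) \<omega>) n \<omega> \<le> C) \<and> \<not> \<tau> k \<omega> \<le> T) \<and> (\<forall>s\<in>rat_times T. \<bar>L s \<omega>\<bar> \<le> K0)"
    have min: "min s (\<tau> k \<omega>) = s" if "s \<in> rat_times T" for s
      using * rat_times_subset[of T] that \<open>T > 0\<close> by fastforce
    have "sq_var T (\<lambda>t \<omega>. L (min t (\<tau> k \<omega>)) \<omega>) n \<omega> = sq_var T L n \<omega>"
      unfolding sq_var_def by (intro sum.cong refl) (simp add: min grid_in_times)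
    moreover have "\<forall>s\<in>rat_times T. \<bar>L (min s (\<tau> k \<omega>)) \<omega>\<bar> \<le> max 0 K0"
      using * min by fastforce
    ultimately show "\<bar>sq_var T L n \<omega>\<bar> \<le> C"
      using * sq_var_nonneg[of T L n \<omega>] by simp
  qed simp
  then show "\<exists>C. \<forall>n. mostly M \<eta> (\<lambda>\<omega>. \<bar>sq_var T L n \<omega>\<bar> \<le> C)" by blast
qed

text \<open>A sum of squares is at most the square of the sum of absolute values, hence bounded
  along each path by the squared variation.\<close>

lemma finite_variation_sq_var:
  assumes V: "adapted F V" "AE \<omega> in M. finite_variation (\<lambda>t. V t \<omega>)" and "T > 0"
  shows "bounded_in_prob M (sq_var T V)"
  unfolding bounded_in_prob_def
proof (intro allI impI)
  fix \<eta> :: real assume "\<eta> > 0"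
  have [measurable]: "V (grid T n i) \<in> borel_measurable M" for n i
    using adapted_M[OF V(1)] grid_nonneg \<open>T > 0\<close> by simp
  \<comment> \<open>The event is phrased through the countably many \<open>sq_var\<close> values:
    the variation bound comes from an existential for each path separately and carries no
    measurability.\<close>
  have "\<forall>\<^sub>F k in sequentially. mostly M \<eta> (\<lambda>\<omega>. \<forall>n. sq_var T V n \<omega> \<le> (real k)\<^sup>2)"
  proof (rule mostly_eventually)
    show "AE \<omega> in M. \<forall>\<^sub>F k in sequentially. \<forall>n. sq_var T V n \<omega> \<le> (real k)\<^sup>2"
      using V(2)
    proof eventually_elim
      case (elim \<omega>)
      then obtain B where B: "\<And>n p. is_partition T n p \<Longrightarrow> (\<Sum>i<n. \<bar>V (p (Suc i)) \<omega> - V (p i) \<omega>\<bar>) \<le> B"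
        unfolding finite_variation_def using \<open>T > 0\<close> by (meson less_imp_le)
      have sq: "sq_var T V n \<omega> \<le> (max 0 B)\<^sup>2" for n
      proof (cases "n = 0")
        case False
        have "sq_var T V n \<omega> = (\<Sum>i<n. \<bar>V (grid T n (Suc i)) \<omega> - V (grid T n i) \<omega>\<bar>\<^sup>2)"
          by (simp add: sq_var_def)
        also have "\<dots> \<le> (\<Sum>i<n. \<bar>V (grid T n (Suc i)) \<omega> - V (grid T n i) \<omega>\<bar>)\<^sup>2"
          using L2_set_le_sum[of "{..<n}" "\<lambda>i. \<bar>V (grid T n (Suc i)) \<omega> - V (grid T n i) \<omega>\<bar>"]
          unfolding L2_set_def by (intro sqrt_le_D) simp
        also have "\<dots> \<le> (max 0 B)\<^sup>2"
          using B[of n "grid T n"] False \<open>T > 0\<close> grid_mono[of T _ _ n]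
          by (intro power_mono sum_nonneg) (auto simp: is_partition_def grid_top max_def)
        finally show ?thesis .
      qed (simp add: sq_var_def)
      have "\<forall>\<^sub>F k in sequentially. max 0 B \<le> real k"
        using filterlim_real_sequentially unfolding filterlim_at_top by blast
      then show ?case
      proof (eventually_elim, intro allI)
        fix k n assume "max 0 B \<le> real k"
        then have "(max 0 B)\<^sup>2 \<le> (real k)\<^sup>2" by (intro power_mono) auto
        then show "sq_var T V n \<omega> \<le> (real k)\<^sup>2"
          using sq order_trans by blast
      qed
    qed
  qed (use \<open>\<eta> > 0\<close> in \<open>auto simp: sq_var_def\<close>)
  then obtain k where "mostly M \<eta> (\<lambda>\<omega>. \<forall>n. sq_var T V n \<omega> \<le> (real k)\<^sup>2)"
    by (auto simp: eventually_sequentially)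
  then show "\<exists>C. \<forall>n. mostly M \<eta> (\<lambda>\<omega>. \<bar>sq_var T V n \<omega>\<bar> \<le> C)"
    by (intro exI[of _ "(real k)\<^sup>2"] allI) (auto elim!: mostly_mono simp: sq_var_nonneg)
qed

lemma semimartingale_sq_var:
  assumes X: "continuous_semimartingale M F X" and "T > 0"
  shows "bounded_in_prob M (sq_var T X)"
proof -
  obtain L V where LV: "continuous_local_martingale M F L" "adapted F V"
      "AE \<omega> in M. finite_variation (\<lambda>t. V t \<omega>)" "AE \<omega> in M. \<forall>t\<ge>0. X t \<omega> = X 0 \<omega> + L t \<omega> + V t \<omega>"
    using X unfolding continuous_semimartingale_def by blast
  have "AE \<omega> in M. \<forall>n. \<bar>sq_var T X n \<omega>\<bar> \<le> 2 * (\<bar>sq_var T L n \<omega>\<bar> + \<bar>sq_var T V n \<omega>\<bar>)"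
    using LV(4)
  proof eventually_elim
    case (elim \<omega>)
    have "sq_var T X n \<omega> \<le> 2 * (sq_var T L n \<omega> + sq_var T V n \<omega>)" for n
      unfolding sq_var_def sum.distrib[symmetric] sum_distrib_left
    proof (intro sum_mono)
      fix i
      have "X (grid T n (Suc i)) \<omega> - X (grid T n i) \<omega> = (L (grid T n (Suc i)) \<omega> - L (grid T n i) \<omega>)
          + (V (grid T n (Suc i)) \<omega> - V (grid T n i) \<omega>)" (is "?x = ?l + ?v")
        using elim[rule_format, of "grid T n i"] elim[rule_format, of "grid T n (Suc i)"]
          grid_nonneg[of T n] \<open>T > 0\<close> by fastforce
      moreover have "(?l + ?v)\<^sup>2 \<le> 2 * (?l\<^sup>2 + ?v\<^sup>2)"
        using zero_le_power2[of "?l - ?v"] by (simp add: power2_eq_square algebra_simps)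
      ultimately show "?x\<^sup>2 \<le> 2 * (?l\<^sup>2 + ?v\<^sup>2)" by simp
    qed
    then show ?case by (simp add: sq_var_nonneg)
  qed
  then show ?thesis
    by (intro bounded_in_prob_dominated[OF local_martingale_sq_var[OF LV(1) \<open>T > 0\<close>]
          finite_variation_sq_var[OF LV(2,3) \<open>T > 0\<close>], of 2]) auto
qed

end

section \<open>Associativity of the Stratonovich integral\<close>

definition strat_term ::
    "real \<Rightarrow> (real \<Rightarrow> 'a \<Rightarrow> real) \<Rightarrow> (real \<Rightarrow> 'a \<Rightarrow> real) \<Rightarrow> nat \<Rightarrow> nat \<Rightarrow> 'a \<Rightarrow> real" where
  "strat_term T W Z n i \<omega> = (W (grid T n (Suc i)) \<omega> - W (grid T n i) \<omega>) *
     ((Z (grid T n i) \<omega> + Z (grid T n (Suc i)) \<omega>) / 2)"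

lemma is_partition_nonneg:
  assumes "is_partition t n p" "i \<le> n"
  shows "0 \<le> p i"
  using assms(2)
proof (induction i)
  case (Suc i)
  then show ?case using assms(1) order_trans[of 0 "p i" "p (Suc i)"] by (simp add: is_partition_def)
qed (use assms(1) in \<open>simp add: is_partition_def\<close>)

text \<open>A symmetric term is the left-point term plus half the product of the two increments, on
  either grid. Subtracting coarse from fine leaves the left-point defect plus half the difference of
  the discrete covariations.\<close>

lemma midpoint_minus_left_point:
  fixes z w :: "nat \<Rightarrow> real"
  assumes "a \<le> b"
  shows "(\<Sum>j=a..<b. (w (Suc j) - w j) * ((z j + z (Suc j)) / 2)) - (w b - w a) * ((z a + z b) / 2)
      - (\<Sum>j=a..<b. (z j - z a) * (w (Suc j) - w j))
    = ((\<Sum>j=a..<b. (z (Suc j) - z j) * (w (Suc j) - w j)) - (z b - z a) * (w b - w a)) / 2"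
proof -
  have tel: "(\<Sum>j=a..<b. w (Suc j) - w j) = w b - w a"
    using assms by (rule sum_Suc_diff')
  have "(\<Sum>j=a..<b. (w (Suc j) - w j) * ((z j + z (Suc j)) / 2)) - (\<Sum>j=a..<b. (z j - z a) * (w (Suc j) - w j))
      - (\<Sum>j=a..<b. (z (Suc j) - z j) * (w (Suc j) - w j)) / 2
     = (\<Sum>j=a..<b. z a * (w (Suc j) - w j))"
    unfolding sum_divide_distrib sum_subtractf[symmetric]
    by (intro sum.cong refl) (simp add: field_simps)
  also have "\<dots> = z a * (w b - w a)" by (simp add: tel sum_distrib_left[symmetric])
  finally show ?thesis by (simp add: field_simps)
qed

text \<open>The deterministic core: \<open>N\<close> blocks of \<open>k\<close> cells, weights
  \<open>u\<close>, left-point defects \<open>p\<close>, cross-variation defects \<open>q\<close>.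
  The weight is frozen at the block start against \<open>q\<close>, at a cost of
  \<open>e * C\<close> by total variation. In the final bound, one \<open>e\<close> comes from
  \<open>p\<close>, one from the block sums of \<open>q\<close>, and the square root from
  Cauchy-Schwarz against the increments of \<open>u\<close>.\<close>

lemma weighted_increment_bound:
  fixes u p q :: "nat \<Rightarrow> real"
  assumes p: "\<bar>\<Sum>i<N*k. u i * p i\<bar> \<le> e" "(\<Sum>i<N*k. (p i)\<^sup>2) \<le> e"
    and u: "(\<Sum>i<N*k. (u (Suc i) - u i)\<^sup>2) \<le> C" "\<And>B. B < N \<Longrightarrow> \<bar>u (B*k)\<bar> \<le> 1"
      "\<And>B i. B < N \<Longrightarrow> i \<in> {B*k..<B*k+k} \<Longrightarrow> \<bar>u i - u (B*k)\<bar> \<le> e"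
    and q: "(\<Sum>i<N*k. \<bar>q i\<bar>) \<le> C" "(\<Sum>i<N*k. (q i)\<^sup>2) \<le> C * e"
      "(\<Sum>B<N. \<bar>\<Sum>i=B*k..<B*k+k. q i\<bar>) \<le> e"
    and "e \<ge> 0" "C \<ge> 0"
  shows "\<bar>\<Sum>i<N*k. (u i + u (Suc i)) / 2 * (p i + q i)\<bar> \<le> (2 + C) * e + sqrt (C * (2 + 2 * C) * e) / 2"
proof -
  \<comment> \<open>The trapezoidal weight is the left value plus half an increment. Only the left
    value is known at the start of the cell, as the second-moment bound behind the first hypothesis
    on \<open>p\<close> requires.\<close>
  have split: "(\<Sum>i<N*k. (u i + u (Suc i)) / 2 * (p i + q i)) = (\<Sum>i<N*k. u i * p i) + (\<Sum>i<N*k. u i * q i)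
      + (\<Sum>i<N*k. (u (Suc i) - u i) * (p i + q i)) / 2"
    unfolding sum_divide_distrib sum.distrib[symmetric] by (intro sum.cong refl) (simp add: field_simps)
  have "(\<Sum>i<N*k. u i * q i) = (\<Sum>B<N. \<Sum>i=B*k..<B*k+k. u i * q i)"
    by (rule sum.nat_group[symmetric])
  also have "\<dots> = (\<Sum>B<N. u (B*k) * (\<Sum>i=B*k..<B*k+k. q i)) + (\<Sum>B<N. \<Sum>i=B*k..<B*k+k. (u i - u (B*k)) * q i)"
    unfolding sum.distrib[symmetric] sum_distrib_left by (intro sum.cong refl) (simp add: algebra_simps)
  finally have uq: "(\<Sum>i<N*k. u i * q i) = \<dots>" .
  have "\<bar>\<Sum>B<N. u (B*k) * (\<Sum>i=B*k..<B*k+k. q i)\<bar> \<le> (\<Sum>B<N. \<bar>\<Sum>i=B*k..<B*k+k. q i\<bar>)"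
  proof (intro order_trans[OF sum_abs] sum_mono)
    fix B assume "B \<in> {..<N}"
    then show "\<bar>u (B*k) * (\<Sum>i=B*k..<B*k+k. q i)\<bar> \<le> \<bar>\<Sum>i=B*k..<B*k+k. q i\<bar>"
      using u(2)[of B] by (auto simp: abs_mult intro!: mult_left_le_one_le)
  qed
  then have 1: "\<bar>\<Sum>B<N. u (B*k) * (\<Sum>i=B*k..<B*k+k. q i)\<bar> \<le> e" using q(3) by linarith
  have "\<bar>\<Sum>B<N. \<Sum>i=B*k..<B*k+k. (u i - u (B*k)) * q i\<bar> \<le> (\<Sum>B<N. \<Sum>i=B*k..<B*k+k. e * \<bar>q i\<bar>)"
  proof (intro order_trans[OF sum_abs] sum_mono)
    fix B i assume "B \<in> {..<N}" "i \<in> {B*k..<B*k+k}"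
    then show "\<bar>(u i - u (B*k)) * q i\<bar> \<le> e * \<bar>q i\<bar>"
      using u(3)[of B i] by (auto simp: abs_mult intro!: mult_right_mono)
  qed
  also have "\<dots> = e * (\<Sum>i<N*k. \<bar>q i\<bar>)"
    by (simp add: sum.nat_group sum_distrib_left)
  also have "\<dots> \<le> e * C" using q(1) \<open>e \<ge> 0\<close> by (rule mult_left_mono)
  finally have 2: "\<bar>\<Sum>B<N. \<Sum>i=B*k..<B*k+k. (u i - u (B*k)) * q i\<bar> \<le> e * C" .
  have "(\<Sum>i<N*k. (u (Suc i) - u i) * (p i + q i))\<^sup>2 \<le> (\<Sum>i<N*k. (u (Suc i) - u i)\<^sup>2) * (\<Sum>i<N*k. (p i + q i)\<^sup>2)"
    by (rule Cauchy_Schwarz_ineq_sum)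
  also have "\<dots> \<le> C * (\<Sum>i<N*k. 2 * (p i)\<^sup>2 + 2 * (q i)\<^sup>2)"
  proof (intro mult_mono u(1) \<open>C \<ge> 0\<close> sum_mono sum_nonneg)
    fix i show "(p i + q i)\<^sup>2 \<le> 2 * (p i)\<^sup>2 + 2 * (q i)\<^sup>2"
      using zero_le_power2[of "p i - q i"] by (simp add: power2_eq_square algebra_simps)
  qed auto
  also have "\<dots> \<le> C * (2 * e + 2 * (C * e))"
    using p(2) q(2) \<open>C \<ge> 0\<close> by (intro mult_left_mono) (auto simp: sum.distrib sum_distrib_left[symmetric])
  finally have "(\<Sum>i<N*k. (u (Suc i) - u i) * (p i + q i))\<^sup>2 \<le> C * (2 + 2 * C) * e"
    by (simp add: algebra_simps)
  then have 3: "\<bar>\<Sum>i<N*k. (u (Suc i) - u i) * (p i + q i)\<bar> \<le> sqrt (C * (2 + 2 * C) * e)"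
    using real_le_rsqrt by (simp add: real_le_rsqrt)
  show ?thesis
    unfolding split uq using p(1) 1 2 3 by (simp add: algebra_simps)
qed

text \<open>The first bound uses |ab| \<le> (a^2 + b^2)/2, the second Cauchy-Schwarz inside each
  cell. Cell by cell only the squares of \<open>w\<close> have to be small; for \<open>z\<close> the
  total suffices.\<close>

lemma cross_variation_bounds:
  fixes z w :: "nat \<Rightarrow> real" and n m :: nat
  defines "q \<equiv> \<lambda>i. ((\<Sum>j=i*m..<i*m+m. (z (Suc j) - z j) * (w (Suc j) - w j))
      - (z (i*m+m) - z (i*m)) * (w (i*m+m) - w (i*m))) / 2"
  assumes z: "(\<Sum>j<n*m. (z (Suc j) - z j)\<^sup>2) \<le> C" "(\<Sum>i<n. (z (i*m+m) - z (i*m))\<^sup>2) \<le> C"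
    and w: "(\<Sum>j<n*m. (w (Suc j) - w j)\<^sup>2) \<le> C" "(\<Sum>i<n. (w (i*m+m) - w (i*m))\<^sup>2) \<le> C"
    and small: "\<And>i. i < n \<Longrightarrow> (\<Sum>j=i*m..<i*m+m. (w (Suc j) - w j)\<^sup>2) \<le> e"
      "\<And>i. i < n \<Longrightarrow> (w (i*m+m) - w (i*m))\<^sup>2 \<le> e"
    and "e \<ge> 0"
  shows "(\<Sum>i<n. \<bar>q i\<bar>) \<le> C" "(\<Sum>i<n. (q i)\<^sup>2) \<le> C * e"
proof -
  have ab: "\<bar>a * b\<bar> \<le> (a\<^sup>2 + b\<^sup>2) / 2" for a b :: real
    using zero_le_power2[of "a - b"] zero_le_power2[of "a + b"] by (simp add: abs_if power2_eq_square algebra_simps)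
  define a where "a i = (\<Sum>j=i*m..<i*m+m. (z (Suc j) - z j) * (w (Suc j) - w j))" for i
  define b where "b i = (z (i*m+m) - z (i*m)) * (w (i*m+m) - w (i*m))" for i
  have q: "q i = (a i - b i) / 2" for i by (simp add: q_def a_def b_def)
  have "(\<Sum>i<n. \<bar>a i\<bar>) \<le> (\<Sum>i<n. \<Sum>j=i*m..<i*m+m. ((z (Suc j) - z j)\<^sup>2 + (w (Suc j) - w j)\<^sup>2) / 2)"
    unfolding a_def by (intro sum_mono order_trans[OF sum_abs] ab)
  also have "\<dots> = (\<Sum>j<n*m. ((z (Suc j) - z j)\<^sup>2 + (w (Suc j) - w j)\<^sup>2) / 2)"
    by (rule sum.nat_group)
  also have "\<dots> \<le> C" using z(1) w(1) by (simp add: sum_divide_distrib[symmetric] sum.distrib)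
  finally have A: "(\<Sum>i<n. \<bar>a i\<bar>) \<le> C" .
  have "(\<Sum>i<n. \<bar>b i\<bar>) \<le> (\<Sum>i<n. ((z (i*m+m) - z (i*m))\<^sup>2 + (w (i*m+m) - w (i*m))\<^sup>2) / 2)"
    unfolding b_def by (intro sum_mono ab)
  also have "\<dots> \<le> C" using z(2) w(2) by (simp add: sum_divide_distrib[symmetric] sum.distrib)
  finally have B: "(\<Sum>i<n. \<bar>b i\<bar>) \<le> C" .
  have "(\<Sum>i<n. \<bar>q i\<bar>) \<le> (\<Sum>i<n. (\<bar>a i\<bar> + \<bar>b i\<bar>) / 2)"
    unfolding q by (intro sum_mono) auto
  also have "\<dots> \<le> C" using A B by (simp add: sum_divide_distrib[symmetric] sum.distrib)
  finally show "(\<Sum>i<n. \<bar>q i\<bar>) \<le> C" .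
  have "(\<Sum>i<n. (a i)\<^sup>2) \<le> (\<Sum>i<n. (\<Sum>j=i*m..<i*m+m. (z (Suc j) - z j)\<^sup>2) * e)"
  proof (intro sum_mono)
    fix i assume i: "i \<in> {..<n}"
    have "(a i)\<^sup>2 \<le> (\<Sum>j=i*m..<i*m+m. (z (Suc j) - z j)\<^sup>2) * (\<Sum>j=i*m..<i*m+m. (w (Suc j) - w j)\<^sup>2)"
      unfolding a_def by (rule Cauchy_Schwarz_ineq_sum)
    also have "\<dots> \<le> (\<Sum>j=i*m..<i*m+m. (z (Suc j) - z j)\<^sup>2) * e"
      using small(1) i by (intro mult_left_mono sum_nonneg) auto
    finally show "(a i)\<^sup>2 \<le> (\<Sum>j=i*m..<i*m+m. (z (Suc j) - z j)\<^sup>2) * e" .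
  qed
  also have "\<dots> = (\<Sum>j<n*m. (z (Suc j) - z j)\<^sup>2) * e"
    by (simp add: sum_distrib_right[symmetric] sum.nat_group)
  also have "\<dots> \<le> C * e" using z(1) \<open>e \<ge> 0\<close> by (rule mult_right_mono)
  finally have A: "(\<Sum>i<n. (a i)\<^sup>2) \<le> C * e" .
  have "(\<Sum>i<n. (b i)\<^sup>2) \<le> (\<Sum>i<n. (z (i*m+m) - z (i*m))\<^sup>2 * e)"
    unfolding b_def power_mult_distrib using small(2) by (intro sum_mono mult_left_mono) auto
  also have "\<dots> \<le> C * e"
    unfolding sum_distrib_right[symmetric] using z(2) \<open>e \<ge> 0\<close> by (rule mult_right_mono)
  finally have B: "(\<Sum>i<n. (b i)\<^sup>2) \<le> C * e" .
  have "(\<Sum>i<n. (q i)\<^sup>2) \<le> (\<Sum>i<n. ((a i)\<^sup>2 + (b i)\<^sup>2) / 2)"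
  proof (intro sum_mono)
    fix i show "(q i)\<^sup>2 \<le> ((a i)\<^sup>2 + (b i)\<^sup>2) / 2"
      unfolding q using zero_le_power2[of "a i + b i"] by (simp add: power2_eq_square field_simps)
  qed
  also have "\<dots> \<le> C * e" using A B by (simp add: sum_divide_distrib[symmetric] sum.distrib)
  finally show "(\<Sum>i<n. (q i)\<^sup>2) \<le> C * e" .
qed

section \<open>Convergence of symmetric sums along grids\<close>

context filtered_wiener
begin

lemma stratonovich_sum_measurable:
  fixes Y :: "real \<Rightarrow> 'a \<Rightarrow> 'b::euclidean_space"
  assumes Y: "adapted F Y" and p: "is_partition t n p"
  shows "stratonovich_sum W Y n p \<in> borel_measurable M"
  unfolding stratonovich_sum_def[abs_def]
  using adapted_M[OF Y] adapted_M[OF adapted_W] is_partition_nonneg[OF p]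
  by (intro borel_measurable_sum borel_measurable_scaleR borel_measurable_diff borel_measurable_add borel_measurable_const) auto

text \<open>\<open>measure\<close> gives a nonmeasurable set the default value 0, so the inequality
  in the definition is informative only once the symmetric sum is known to be measurable;
  adaptedness of \<open>Y\<close> supplies this.\<close>

lemma stratonovich_integral_mostly:
  fixes Y :: "real \<Rightarrow> 'a \<Rightarrow> real"
  assumes J: "has_stratonovich_integral M W t Y J" and Y: "adapted F Y" and "\<epsilon> > 0" "\<eta> > 0"
  shows "\<exists>\<delta>>0. \<forall>n p. is_partition t n p \<longrightarrow> (\<forall>i<n. p (Suc i) - p i < \<delta>) \<longrightarrow>
    mostly M \<eta> (\<lambda>\<omega>. \<bar>stratonovich_sum W Y n p \<omega> - J \<omega>\<bar> \<le> \<epsilon>)"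
proof -
  have "\<exists>\<delta>>0. \<forall>n p. is_partition t n p \<and> (\<forall>i<n. p (Suc i) - p i < \<delta>) \<longrightarrow>
      measure M {\<omega> \<in> space M. norm (stratonovich_sum W Y n p \<omega> - J \<omega>) \<ge> \<epsilon>} < \<eta>"
    using J \<open>\<epsilon> > 0\<close> \<open>\<eta> > 0\<close> by (simp add: has_stratonovich_integral_def)
  then obtain \<delta> where \<delta>: "\<delta> > 0" "\<And>n p. is_partition t n p \<Longrightarrow> (\<forall>i<n. p (Suc i) - p i < \<delta>) \<Longrightarrow>
      measure M {\<omega> \<in> space M. norm (stratonovich_sum W Y n p \<omega> - J \<omega>) \<ge> \<epsilon>} < \<eta>"
    by auto
  show ?thesis
  proof (intro exI[of _ \<delta>] conjI \<delta>(1) allI impI)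
    fix n p assume p: "is_partition t n p" "\<forall>i<n. p (Suc i) - p i < \<delta>"
    have [measurable]: "J \<in> borel_measurable M" "stratonovich_sum W Y n p \<in> borel_measurable M"
      using J stratonovich_sum_measurable[OF Y p(1)] by (auto simp: has_stratonovich_integral_def)
    show "mostly M \<eta> (\<lambda>\<omega>. \<bar>stratonovich_sum W Y n p \<omega> - J \<omega>\<bar> \<le> \<epsilon>)"
      unfolding mostly_def
      by (intro bexI[of _ "{\<omega> \<in> space M. norm (stratonovich_sum W Y n p \<omega> - J \<omega>) \<ge> \<epsilon>}"])
         (use \<delta>(2)[OF p] in auto)
  qed
qed

text \<open>The first \<open>B*k\<close> cells of the grid with \<open>N*k\<close> cells partition
  the interval up to the B-th block end. With \<open>N\<close> fixed there are finitely many end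
  points, so a common mesh bound exists and each gets the share
  \<open>\<eta> / (N + 1)\<close>.\<close>

lemma stratonovich_grid_mostly:
  assumes S: "\<And>t. t \<in> {0..T} \<Longrightarrow> has_stratonovich_integral M W t Z (S t)" and Z: "adapted F Z"
    and "T > 0" "N > 0" "\<epsilon> > 0" "\<eta> > 0"
  shows "\<exists>\<delta>>0. \<forall>k>0. T / real (N * k) \<le> \<delta> \<longrightarrow>
    mostly M \<eta> (\<lambda>\<omega>. \<forall>B\<le>N. \<bar>(\<Sum>j<B*k. strat_term T W Z (N*k) j \<omega>) - S (grid T N B) \<omega>\<bar> \<le> \<epsilon>)"
proof -
  have "grid T N B \<in> {0..T}" if "B \<le> N" for B
    using grid_in_times[OF that] rat_times_subset[of T] \<open>T > 0\<close> by (meson less_imp_le subsetD)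
  then have "\<exists>\<delta>>0. \<forall>n p. is_partition (grid T N B) n p \<longrightarrow> (\<forall>i<n. p (Suc i) - p i < \<delta>) \<longrightarrow>
    mostly M (\<eta> / (N + 1)) (\<lambda>\<omega>. \<bar>stratonovich_sum W Z n p \<omega> - S (grid T N B) \<omega>\<bar> \<le> \<epsilon>)"
    if "B \<in> {..N}" for B
    using that \<open>\<epsilon> > 0\<close> \<open>\<eta> > 0\<close> by (intro stratonovich_integral_mostly S Z) auto
  then have "\<exists>d. \<forall>B\<in>{..N}. d B > 0 \<and> (\<forall>n p. is_partition (grid T N B) n p \<longrightarrow>
    (\<forall>i<n. p (Suc i) - p i < d B) \<longrightarrow>
    mostly M (\<eta> / (N + 1)) (\<lambda>\<omega>. \<bar>stratonovich_sum W Z n p \<omega> - S (grid T N B) \<omega>\<bar> \<le> \<epsilon>))"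
    by (intro bchoice) blast
  then obtain d where d': "\<forall>B\<in>{..N}. d B > 0 \<and> (\<forall>n p. is_partition (grid T N B) n p \<longrightarrow>
    (\<forall>i<n. p (Suc i) - p i < d B) \<longrightarrow>
    mostly M (\<eta> / (N + 1)) (\<lambda>\<omega>. \<bar>stratonovich_sum W Z n p \<omega> - S (grid T N B) \<omega>\<bar> \<le> \<epsilon>))" ..
  have d: "d B > 0" "\<And>n p. is_partition (grid T N B) n p \<Longrightarrow> (\<forall>i<n. p (Suc i) - p i < d B) \<Longrightarrow>
      mostly M (\<eta> / (N + 1)) (\<lambda>\<omega>. \<bar>stratonovich_sum W Z n p \<omega> - S (grid T N B) \<omega>\<bar> \<le> \<epsilon>)"
    if "B \<le> N" for B
    using d'[rule_format, of B] that by blast+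
  \<comment> \<open>Halving makes the non-strict mesh condition of the statement imply the strict
    one of the definition.\<close>
  define \<delta> where "\<delta> = Min (d ` {..N}) / 2"
  have \<delta>: "\<delta> > 0" "\<And>B. B \<le> N \<Longrightarrow> \<delta> < d B"
  proof -
    have pos: "Min (d ` {..N}) > 0" using d(1) by (subst Min_gr_iff) auto
    then show "\<delta> > 0" by (simp add: \<delta>_def)
    fix B assume "B \<le> N"
    then have "Min (d ` {..N}) \<le> d B" by (intro Min_le) auto
    then show "\<delta> < d B" using pos unfolding \<delta>_def by linarith
  qed
  show ?thesis
  proof (intro exI[of _ \<delta>] conjI \<delta>(1) allI impI)
    fix k :: nat assume k: "k > 0" "T / real (N * k) \<le> \<delta>"
    have "mostly M (\<eta> / (N + 1)) (\<lambda>\<omega>. \<bar>(\<Sum>j<B*k. strat_term T W Z (N*k) j \<omega>) - S (grid T N B) \<omega>\<bar> \<le> \<epsilon>)"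
      if "B \<in> {..N}" for B
    proof -
      have "is_partition (grid T N B) (B*k) (grid T (N*k))"
        unfolding is_partition_def using grid_refine[OF k(1), of T N B] grid_mono[of T _ _ "N*k"] \<open>T > 0\<close> by auto
      moreover have "\<forall>i<B*k. grid T (N*k) (Suc i) - grid T (N*k) i < d B"
        unfolding grid_Suc_diff using \<delta>(2)[of B] k that by auto
      ultimately have "mostly M (\<eta> / (N + 1)) (\<lambda>\<omega>. \<bar>stratonovich_sum W Z (B*k) (grid T (N*k)) \<omega> - S (grid T N B) \<omega>\<bar> \<le> \<epsilon>)"
        using d(2)[of B] that by auto
      then show ?thesis by (simp add: stratonovich_sum_def strat_term_def)
    qed
    then have "mostly M (real (card {..N}) * (\<eta> / (N + 1))) (\<lambda>\<omega>. \<forall>B\<in>{..N}.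
        \<bar>(\<Sum>j<B*k. strat_term T W Z (N*k) j \<omega>) - S (grid T N B) \<omega>\<bar> \<le> \<epsilon>)"
      by (intro mostly_Ball) auto
    then show "mostly M \<eta> (\<lambda>\<omega>. \<forall>B\<le>N. \<bar>(\<Sum>j<B*k. strat_term T W Z (N*k) j \<omega>) - S (grid T N B) \<omega>\<bar> \<le> \<epsilon>)"
      by (rule mostly_mono) (auto simp: add.commute)
  qed
qed

end

lemma sum_block_eq: "(\<Sum>j=a..<a+m. f j) = (\<Sum>j<a+m. f j) - (\<Sum>j<a. f j :: real)" for a m :: nat
  using sum_diff_nat_ivl[of 0 a "a+m" f] by (simp add: atLeast0LessThan)

context filtered_wiener
begin

text \<open>The pathwise estimate. Symmetric sums on the coarse and the fine grid are both close to
  \<open>S\<close> at the block ends, so \<open>S\<close> cancels in their difference and the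
  cross-variation defects nearly cancel over each block.\<close>

lemma strat_defect_bound:
  assumes grids: "T > 0" "N > 0" "k > 0" "m > 0"
    and sq: "sq_var T Z (N*k) \<omega> \<le> C" "sq_var T Z (N*k*m) \<omega> \<le> C" "sq_var T W (N*k) \<omega> \<le> C"
      "sq_var T W (N*k*m) \<omega> \<le> C" "sq_var T U (N*k) \<omega> \<le> C"
    and ito: "\<bar>\<Sum>i<N*k. U (grid T (N*k) i) \<omega> * ito_defect T W Z (N*k) m i \<omega>\<bar> \<le> e"
      "(\<Sum>i<N*k. (ito_defect T W Z (N*k) m i \<omega>)\<^sup>2) \<le> e"
      "\<And>B. B \<le> N \<Longrightarrow> \<bar>\<Sum>i<B*k. ito_defect T W Z (N*k) m i \<omega>\<bar> \<le> e / (6 * N)"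
    and wsq: "\<And>i. i < N*k \<Longrightarrow> (\<Sum>j=i*m..<i*m+m. (W (grid T (N*k*m) (Suc j)) \<omega> - W (grid T (N*k*m) j) \<omega>)\<^sup>2) \<le> e"
      "\<And>i. i < N*k \<Longrightarrow> (W (grid T (N*k) (Suc i)) \<omega> - W (grid T (N*k) i) \<omega>)\<^sup>2 \<le> e"
    and osc: "\<And>s t. s \<in> rat_times T \<Longrightarrow> t \<in> rat_times T \<Longrightarrow> \<bar>s - t\<bar> \<le> T / N \<Longrightarrow> \<bar>U s \<omega> - U t \<omega>\<bar> \<le> e"
    and U1: "\<And>t. \<bar>U t \<omega>\<bar> \<le> 1"
    and st: "\<And>B. B \<le> N \<Longrightarrow> \<bar>(\<Sum>j<B*(k*m). strat_term T W Z (N*(k*m)) j \<omega>) - S (grid T N B) \<omega>\<bar> \<le> e / (6 * N)"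
      "\<And>B. B \<le> N \<Longrightarrow> \<bar>(\<Sum>j<B*k. strat_term T W Z (N*k) j \<omega>) - S (grid T N B) \<omega>\<bar> \<le> e / (6 * N)"
    and e: "e \<ge> 0" "C \<ge> 0"
  shows "\<bar>\<Sum>i<N*k. (U (grid T (N*k) i) \<omega> + U (grid T (N*k) (Suc i)) \<omega>) / 2 *
      ((\<Sum>j=i*m..<i*m+m. strat_term T W Z (N*k*m) j \<omega>) - strat_term T W Z (N*k) i \<omega>)\<bar>
    \<le> (2 + C) * e + sqrt (C * (2 + 2 * C) * e) / 2"
proof -
  define z where "z j = Z (grid T (N*k*m) j) \<omega>" for j
  define w where "w j = W (grid T (N*k*m) j) \<omega>" for j
  define u where "u i = U (grid T (N*k) i) \<omega>" for i
  define p where "p i = ito_defect T W Z (N*k) m i \<omega>" for i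
  define q where "q i = ((\<Sum>j=i*m..<i*m+m. (z (Suc j) - z j) * (w (Suc j) - w j))
      - (z (i*m+m) - z (i*m)) * (w (i*m+m) - w (i*m))) / 2" for i
  have ref: "grid T (N*k*m) (i*m) = grid T (N*k) i" "grid T (N*k*m) (i*m+m) = grid T (N*k) (Suc i)" for i
    using grid_refine[OF \<open>m > 0\<close>, of T "N*k" i] grid_refine[OF \<open>m > 0\<close>, of T "N*k" "Suc i"]
    by (auto simp: add.commute)
  have zi: "z (i*m) = Z (grid T (N*k) i) \<omega>" "z (i*m+m) = Z (grid T (N*k) (Suc i)) \<omega>"
    "w (i*m) = W (grid T (N*k) i) \<omega>" "w (i*m+m) = W (grid T (N*k) (Suc i)) \<omega>" for i
    unfolding z_def w_def ref by simp_all
  have r: "(\<Sum>j=i*m..<i*m+m. strat_term T W Z (N*k*m) j \<omega>) - strat_term T W Z (N*k) i \<omega> = p i + q i" for i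
    using midpoint_minus_left_point[of "i*m" "i*m+m" w z]
    unfolding q_def p_def ito_defect_def strat_term_def zi(2,4)[symmetric]
    unfolding zi(1,3)[symmetric] z_def[symmetric] w_def[symmetric] by linarith
  have q: "(\<Sum>i<N*k. \<bar>q i\<bar>) \<le> C" "(\<Sum>i<N*k. (q i)\<^sup>2) \<le> C * e"
    unfolding q_def
    using sq wsq e by (intro cross_variation_bounds; simp add: zi; simp add: sq_var_def z_def w_def)+
  \<comment> \<open>Three errors of \<open>e / (6 * N)\<close> give a prefix bound of half of
    \<open>e / N\<close>; a block is a difference of two prefixes, and \<open>N\<close> blocks add
    up to \<open>e\<close>.\<close>
  have pre: "\<bar>\<Sum>i<B*k. q i\<bar> \<le> 3 * (e / (6 * N))" if "B \<le> N" for B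
  proof -
    have "(\<Sum>i<B*k. q i) = (\<Sum>i<B*k. \<Sum>j=i*m..<i*m+m. strat_term T W Z (N*k*m) j \<omega>)
        - (\<Sum>i<B*k. strat_term T W Z (N*k) i \<omega>) - (\<Sum>i<B*k. p i)"
      unfolding sum_subtractf[symmetric] r by simp
    also have "(\<Sum>i<B*k. \<Sum>j=i*m..<i*m+m. strat_term T W Z (N*k*m) j \<omega>) = (\<Sum>j<B*(k*m). strat_term T W Z (N*(k*m)) j \<omega>)"
      by (simp add: sum.nat_group mult.assoc)
    finally show ?thesis
      using st(1)[OF that] st(2)[OF that] ito(3)[OF that] unfolding p_def by linarith
  qed
  have "\<bar>\<Sum>i=B*k..<B*k+k. q i\<bar> \<le> e / N" if "B < N" for B
    using pre[of B] pre[of "Suc B"] that unfolding sum_block_eq by (simp add: add.commute)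
  then have "(\<Sum>B<N. \<bar>\<Sum>i=B*k..<B*k+k. q i\<bar>) \<le> (\<Sum>B<N. e / N)"
    by (intro sum_mono) auto
  then have qb: "(\<Sum>B<N. \<bar>\<Sum>i=B*k..<B*k+k. q i\<bar>) \<le> e" using \<open>N > 0\<close> by simp
  have uo: "\<bar>u i - u (B*k)\<bar> \<le> e" if "B < N" "i \<in> {B*k..<B*k+k}" for B i
  proof -
    have "Suc B * k \<le> N * k" using that by (intro mult_right_mono) auto
    then have "i \<le> N * k" "B * k \<le> N * k" using that by auto
    then show ?thesis
      unfolding u_def using grid_block_distance[of k T i B N] that grids
      by (intro osc grid_in_times) (auto simp: grid_refine)
  qed
  have "\<bar>\<Sum>i<N*k. (u i + u (Suc i)) / 2 * (p i + q i)\<bar> \<le> (2 + C) * e + sqrt (C * (2 + 2 * C) * e) / 2"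
    by (rule weighted_increment_bound) (use ito sq U1 uo q qb e in \<open>auto simp: u_def p_def sq_var_def\<close>)
  then show ?thesis unfolding r u_def .
qed

text \<open>The nested quantifiers say that \<open>k\<close> has to be large depending on
  \<open>N\<close>. The finest level \<open>m\<close> appears only inside the proof, where it stands
  in for the increments of \<open>S\<close>.\<close>

lemma stratonovich_associative:
  assumes U: "adapted F U" "continuous_paths M U" "\<And>t \<omega>. \<bar>U t \<omega>\<bar> \<le> 1" "bounded_in_prob M (sq_var T U)"
    and Z: "adapted F Z" "continuous_paths M Z" "bounded_in_prob M (sq_var T Z)"
    and S: "\<And>t. t \<in> {0..T} \<Longrightarrow> has_stratonovich_integral M W t Z (S t)"
    and "T > 0" "\<epsilon> > 0" "\<eta> > 0"
  shows "\<forall>\<^sub>F N in sequentially. \<forall>\<^sub>F k in sequentially. mostly M \<eta> (\<lambda>\<omega>.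
    \<bar>\<Sum>i<N*k. (U (grid T (N*k) i) \<omega> + U (grid T (N*k) (Suc i)) \<omega>) / 2 *
      (S (grid T (N*k) (Suc i)) \<omega> - S (grid T (N*k) i) \<omega> - strat_term T W Z (N*k) i \<omega>)\<bar> \<le> \<epsilon>)"
proof -
  \<comment> \<open>Fourteen exceptional events are collected in \<open>E\<close> below.\<close>
  define h where "h = \<eta> / 14"
  have h: "h > 0" using \<open>\<eta> > 0\<close> by (simp add: h_def)
  obtain CU CZ CW where C: "\<And>n. mostly M h (\<lambda>\<omega>. \<bar>sq_var T U n \<omega>\<bar> \<le> CU)"
    "\<And>n. mostly M h (\<lambda>\<omega>. \<bar>sq_var T Z n \<omega>\<bar> \<le> CZ)" "\<And>n. mostly M h (\<lambda>\<omega>. \<bar>sq_var T W n \<omega>\<bar> \<le> CW)"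
    using U(4) Z(3) bounded_in_prob_sq_var_W[OF \<open>T > 0\<close>] h unfolding bounded_in_prob_def by meson
  define C where "C = max 0 (max CU (max CZ CW))"
  have CC: "mostly M h (\<lambda>\<omega>. sq_var T U n \<omega> \<le> C)" "mostly M h (\<lambda>\<omega>. sq_var T Z n \<omega> \<le> C)"
    "mostly M h (\<lambda>\<omega>. sq_var T W n \<omega> \<le> C)" for n
    by (rule mostly_mono[OF C(1)[of n]], auto simp: C_def)
       (rule mostly_mono[OF C(2)[of n]], auto simp: C_def,
        rule mostly_mono[OF C(3)[of n]], auto simp: C_def)
  have C0: "C \<ge> 0" by (simp add: C_def)
  \<comment> \<open>With \<open>C\<close> fixed, the pathwise error vanishes with \<open>e\<close>.
    Half of \<open>\<epsilon>\<close> is reserved for it, the other half for replacing increments of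
    \<open>S\<close> by sums over the finest grid.\<close>
  have "((\<lambda>e. (2 + C) * e + sqrt (C * (2 + 2 * C) * e) / 2) \<longlongrightarrow> (2 + C) * 0 + sqrt (C * (2 + 2 * C) * 0) / 2) (at_right 0)"
    by (intro tendsto_intros) auto
  then have "\<forall>\<^sub>F e in at_right 0. (2 + C) * e + sqrt (C * (2 + 2 * C) * e) / 2 < \<epsilon> / 2"
    using \<open>\<epsilon> > 0\<close> by (intro order_tendstoD) auto
  then obtain b where b: "b > 0" "\<And>e. 0 < e \<Longrightarrow> e < b \<Longrightarrow> (2 + C) * e + sqrt (C * (2 + 2 * C) * e) / 2 < \<epsilon> / 2"
    unfolding eventually_at_right_field by auto
  define e where "e = b / 2"
  have e: "e > 0" "(2 + C) * e + sqrt (C * (2 + 2 * C) * e) / 2 < \<epsilon> / 2"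
    using b(1) b(2)[of e] by (auto simp: e_def)
  have ev: "\<forall>\<^sub>F n in sequentially. T / real n \<le> \<delta>" if "\<delta> > 0" for \<delta>
    by (rule eventually_mono[OF order_tendstoD(2)[OF lim_const_over_n that, of T]]) simp
  have evk: "\<forall>\<^sub>F k in sequentially. T / real (N * k) \<le> \<delta>" if "\<delta> > 0" for \<delta> and N :: nat
    by (rule eventually_mono[OF order_tendstoD(2)[OF lim_const_over_n that, of "T / real N"]]) simp
  obtain dU where dU: "dU > 0" "mostly M h (\<lambda>\<omega>. \<forall>s\<in>rat_times T. \<forall>t\<in>rat_times T. \<bar>s - t\<bar> \<le> dU \<longrightarrow> \<bar>U s \<omega> - U t \<omega>\<bar> \<le> e)"
    using mostly_equicontinuous[OF U(1,2), of T e h] \<open>T > 0\<close> e(1) h by auto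
  have "\<forall>\<^sub>F N in sequentially. N > 0 \<and> T / real N \<le> dU"
    using ev[OF dU(1)] eventually_gt_at_top[of 0] by eventually_elim auto
  then show ?thesis
  proof eventually_elim
    case (elim N)
    then have N: "N > 0" "T / real N \<le> dU" by auto
    have e': "e / (6 * real N) > 0" "h / (real N + 1) > 0" using e h N by auto
    obtain d1 where d1: "d1 > 0" "\<And>n m n'. m > 0 \<Longrightarrow> n > 0 \<Longrightarrow> T / real n \<le> d1 \<Longrightarrow> n' \<le> n \<Longrightarrow>
        mostly M h (\<lambda>\<omega>. \<bar>\<Sum>i<n'. U (grid T n i) \<omega> * ito_defect T W Z n m i \<omega>\<bar> \<le> e)"
      using mostly_ito_defect_sum[OF U(1,3) Z(1,2) \<open>T > 0\<close> e(1) h] by blast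
    \<comment> \<open>The constant weight 1 yields the unweighted prefixes of the left-point
      defects, needed at each block end.\<close>
    have one: "adapted F (\<lambda>t \<omega>. 1::real)" by (simp add: adapted_def)
    obtain d2 where d2: "d2 > 0" "\<And>n m n'. m > 0 \<Longrightarrow> n > 0 \<Longrightarrow> T / real n \<le> d2 \<Longrightarrow> n' \<le> n \<Longrightarrow>
        mostly M (h / (real N + 1)) (\<lambda>\<omega>. \<bar>\<Sum>i<n'. ito_defect T W Z n m i \<omega>\<bar> \<le> e / (6 * real N))"
      using mostly_ito_defect_sum[OF one _ Z(1,2) \<open>T > 0\<close> e'] unfolding mult_1 by auto
    obtain d3 where d3: "d3 > 0" "\<And>n m. m > 0 \<Longrightarrow> n > 0 \<Longrightarrow> T / real n \<le> d3 \<Longrightarrow>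
        mostly M h (\<lambda>\<omega>. (\<Sum>i<n. (ito_defect T W Z n m i \<omega>)\<^sup>2) \<le> e)"
      using mostly_ito_defect_squares[OF Z(1,2) \<open>T > 0\<close> e(1) h] by blast
    obtain d4 where d4: "d4 > 0" "\<And>n m. m > 0 \<Longrightarrow> n > 0 \<Longrightarrow> T / real n \<le> d4 \<Longrightarrow>
        mostly M h (\<lambda>\<omega>. \<forall>i<n. (\<Sum>j=i*m..<i*m+m. (W (grid T (n*m) (Suc j)) \<omega> - W (grid T (n*m) j) \<omega>)\<^sup>2) \<le> e)"
      using mostly_W_block_squares[OF \<open>T > 0\<close> e(1) h] by blast
    obtain d5 where d5: "d5 > 0" "\<And>k. k > 0 \<Longrightarrow> T / real (N * k) \<le> d5 \<Longrightarrow>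
        mostly M h (\<lambda>\<omega>. \<forall>B\<le>N. \<bar>(\<Sum>j<B*k. strat_term T W Z (N*k) j \<omega>) - S (grid T N B) \<omega>\<bar> \<le> e / (6 * real N))"
      using stratonovich_grid_mostly[OF S Z(1) \<open>T > 0\<close> N(1) e'(1) h] by blast
    define d where "d = Min {d1, d2, d3, d4, d5}"
    have "d > 0" using d1(1) d2(1) d3(1) d4(1) d5(1) by (simp add: d_def)
    from eventually_conj[OF evk[OF this, of N] eventually_gt_at_top[of 0]] show ?case
    proof eventually_elim
      case (elim k)
      then have k: "k > 0" "T / real (N*k) \<le> d1" "T / real (N*k) \<le> d2" "T / real (N*k) \<le> d3"
          "T / real (N*k) \<le> d4" "T / real (N*k) \<le> d5"
        by (auto simp: d_def)
      have n: "N * k > 0" using N k by simp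
      \<comment> \<open>Each increment of \<open>S\<close> takes two approximated values, and there
        are \<open>N*k\<close> increments, so the total replacement error is
        \<open>\<epsilon> / 2\<close>.\<close>
      have "\<epsilon> / (4 * real (N*k)) > 0" using \<open>\<epsilon> > 0\<close> n by (intro divide_pos_pos) linarith+
      then obtain d6 where d6: "d6 > 0" "\<And>m. m > 0 \<Longrightarrow> T / real (N * k * m) \<le> d6 \<Longrightarrow>
        mostly M h (\<lambda>\<omega>. \<forall>B\<le>N*k. \<bar>(\<Sum>j<B*m. strat_term T W Z (N*k*m) j \<omega>) - S (grid T (N*k) B) \<omega>\<bar> \<le> \<epsilon> / (4 * real (N*k)))"
        using stratonovich_grid_mostly[OF S Z(1) \<open>T > 0\<close> n _ h] by blast
      \<comment> \<open>The finest grid must be accurate at all coarse points (\<open>d6\<close>)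
        and also, to the sharper block tolerance, at the block ends (\<open>d5\<close>, which
        depends on \<open>N\<close> only).\<close>
      obtain m where m: "m > 0" "T / real (N * k * m) \<le> d6" "T / real (N * k * m) \<le> d5"
        using eventually_conj[OF evk[OF d6(1), of "N*k"] eventually_conj[OF evk[OF d5(1), of "N*k"] eventually_gt_at_top[of 0]]]
        unfolding eventually_sequentially by auto
      have pre: "mostly M h (\<lambda>\<omega>. \<forall>B\<in>{..N}. \<bar>\<Sum>i<B*k. ito_defect T W Z (N*k) m i \<omega>\<bar> \<le> e / (6 * real N))"
      proof -
        have each: "mostly M (h / (real N + 1)) (\<lambda>\<omega>. \<bar>\<Sum>i<B*k. ito_defect T W Z (N*k) m i \<omega>\<bar> \<le> e / (6 * real N))"
          if "B \<in> {..N}" for B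
          using that by (intro d2(2) m n k) auto
        show ?thesis
          by (rule mostly_mono[OF mostly_Ball[OF finite_atMost each]]) (auto simp: add.commute)
      qed
      \<comment> \<open>The case of one fine step per cell turns the block bound into a bound on the
        coarse increments themselves.\<close>
      have w1: "mostly M h (\<lambda>\<omega>. \<forall>i<N*k. (W (grid T (N*k) (Suc i)) \<omega> - W (grid T (N*k) i) \<omega>)\<^sup>2 \<le> e)"
        using d4(2)[of 1 "N*k"] n k by simp
      have km: "mostly M h (\<lambda>\<omega>. \<forall>B\<le>N. \<bar>(\<Sum>j<B*(k*m). strat_term T W Z (N*(k*m)) j \<omega>) - S (grid T N B) \<omega>\<bar> \<le> e / (6 * real N))"
        using m k by (intro d5(2)) (auto simp: mult.assoc)
      note E = mostly_conj[OF CC(2)[of "N*k"] mostly_conj[OF CC(2)[of "N*k*m"] mostly_conj[OF CC(3)[of "N*k"]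
        mostly_conj[OF CC(3)[of "N*k*m"] mostly_conj[OF CC(1)[of "N*k"] mostly_conj[OF d1(2)[OF m(1) n k(2) order_refl]
        mostly_conj[OF d3(2)[OF m(1) n k(4)] mostly_conj[OF pre mostly_conj[OF d4(2)[OF m(1) n k(5)]
        mostly_conj[OF w1 mostly_conj[OF dU(2) mostly_conj[OF km mostly_conj[OF d5(2)[OF k(1,6)] d6(2)[OF m(1,2)]]]]]]]]]]]]]]
      show ?case
      proof (rule mostly_mono[OF E], simp add: h_def, elim conjE)
        fix \<omega>
        assume *: "sq_var T Z (N*k) \<omega> \<le> C" "sq_var T Z (N*k*m) \<omega> \<le> C" "sq_var T W (N*k) \<omega> \<le> C"
            "sq_var T W (N*k*m) \<omega> \<le> C" "sq_var T U (N*k) \<omega> \<le> C"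
            "\<bar>\<Sum>i<N*k. U (grid T (N*k) i) \<omega> * ito_defect T W Z (N*k) m i \<omega>\<bar> \<le> e"
            "(\<Sum>i<N*k. (ito_defect T W Z (N*k) m i \<omega>)\<^sup>2) \<le> e"
            "\<forall>B\<in>{..N}. \<bar>\<Sum>i<B*k. ito_defect T W Z (N*k) m i \<omega>\<bar> \<le> e / (6 * real N)"
            "\<forall>i<N*k. (\<Sum>j=i*m..<i*m+m. (W (grid T (N*k*m) (Suc j)) \<omega> - W (grid T (N*k*m) j) \<omega>)\<^sup>2) \<le> e"
            "\<forall>i<N*k. (W (grid T (N*k) (Suc i)) \<omega> - W (grid T (N*k) i) \<omega>)\<^sup>2 \<le> e"
            "\<forall>s\<in>rat_times T. \<forall>t\<in>rat_times T. \<bar>s - t\<bar> \<le> dU \<longrightarrow> \<bar>U s \<omega> - U t \<omega>\<bar> \<le> e"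
            "\<forall>B\<le>N. \<bar>(\<Sum>j<B*(k*m). strat_term T W Z (N*(k*m)) j \<omega>) - S (grid T N B) \<omega>\<bar> \<le> e / (6 * real N)"
            "\<forall>B\<le>N. \<bar>(\<Sum>j<B*k. strat_term T W Z (N*k) j \<omega>) - S (grid T N B) \<omega>\<bar> \<le> e / (6 * real N)"
          and fine: "\<forall>B\<le>N*k. \<bar>(\<Sum>j<B*m. strat_term T W Z (N*k*m) j \<omega>) - S (grid T (N*k) B) \<omega>\<bar> \<le> \<epsilon> / (4 * real (N*k))"
        define v where "v i = (U (grid T (N*k) i) \<omega> + U (grid T (N*k) (Suc i)) \<omega>) / 2" for i
        define f where "f i = (\<Sum>j=i*m..<i*m+m. strat_term T W Z (N*k*m) j \<omega>)" for i
        define g where "g i = S (grid T (N*k) (Suc i)) \<omega> - S (grid T (N*k) i) \<omega>" for i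
        have "\<bar>\<Sum>i<N*k. v i * (f i - strat_term T W Z (N*k) i \<omega>)\<bar> \<le> (2 + C) * e + sqrt (C * (2 + 2 * C) * e) / 2"
          unfolding v_def f_def
          by (rule strat_defect_bound[where S=S]) (use * m k N e C0 \<open>T > 0\<close> U(3) in auto)
        then have 1: "\<bar>\<Sum>i<N*k. v i * (f i - strat_term T W Z (N*k) i \<omega>)\<bar> \<le> \<epsilon> / 2"
          using e by linarith
        have "\<bar>\<Sum>i<N*k. v i * (g i - f i)\<bar> \<le> (\<Sum>i<N*k. \<epsilon> / (2 * real (N*k)))"
        proof (intro order_trans[OF sum_abs] sum_mono)
          fix i assume i: "i \<in> {..<N*k}"
          have v: "\<bar>v i\<bar> \<le> 1"
            using U(3)[of "grid T (N*k) i" \<omega>] U(3)[of "grid T (N*k) (Suc i)" \<omega>] unfolding v_def by (auto simp: abs_le_iff)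
          have "f i = (\<Sum>j<Suc i*m. strat_term T W Z (N*k*m) j \<omega>) - (\<Sum>j<i*m. strat_term T W Z (N*k*m) j \<omega>)"
            unfolding f_def sum_block_eq by (simp add: add.commute)
          then have "\<bar>g i - f i\<bar> \<le> \<epsilon> / (4 * real (N*k)) + \<epsilon> / (4 * real (N*k))"
            using fine[rule_format, of i] fine[rule_format, of "Suc i"] i unfolding g_def by auto
          also have "\<dots> = \<epsilon> / (2 * real (N*k))" by (simp add: field_simps)
          finally have "\<bar>g i - f i\<bar> \<le> \<epsilon> / (2 * real (N*k))" .
          then show "\<bar>v i * (g i - f i)\<bar> \<le> \<epsilon> / (2 * real (N*k))"
            using mult_mono[OF v, of "\<bar>g i - f i\<bar>"] by (simp add: abs_mult)
        qed
        also have "\<dots> = \<epsilon> / 2" using N(1) k(1) by simp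
        finally have 2: "\<bar>\<Sum>i<N*k. v i * (g i - f i)\<bar> \<le> \<epsilon> / 2" .
        have "(\<Sum>i<N*k. v i * (g i - strat_term T W Z (N*k) i \<omega>))
           = (\<Sum>i<N*k. v i * (g i - f i)) + (\<Sum>i<N*k. v i * (f i - strat_term T W Z (N*k) i \<omega>))"
          unfolding sum.distrib[symmetric] by (intro sum.cong refl) (simp add: algebra_simps)
        then show "\<bar>\<Sum>i<N*k. (U (grid T (N*k) i) \<omega> + U (grid T (N*k) (Suc i)) \<omega>) / 2 *
          (S (grid T (N*k) (Suc i)) \<omega> - S (grid T (N*k) i) \<omega> - strat_term T W Z (N*k) i \<omega>)\<bar> \<le> \<epsilon>"
          using 1 2 unfolding v_def g_def by linarith
      qed
    qed
  qed
qed

end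

section \<open>Trapezoidal product rule for a rotation\<close>

lemma abs_average_le: "\<bar>a\<bar> \<le> K \<Longrightarrow> \<bar>b\<bar> \<le> K \<Longrightarrow> \<bar>(a + b) / 2\<bar> \<le> K" for a b K :: real
  by (simp add: abs_le_iff)

text \<open>The linear terms of the two summands cancel and both functions are odd, so the error is
  cubic; with y = x/2 it is controlled by the bounds on y - sin y and 1 - cos y.\<close>

lemma trapezoid_trig_error: "\<bar>x * cos (x / 2) - 2 * sin (x / 2)\<bar> \<le> \<bar>x\<bar> ^ 3" for x :: real
proof -
  define y where "y = x / 2"
  have "\<bar>sin y - y\<bar> \<le> inverse (fact 3) * \<bar>y\<bar> ^ 3"
    using Maclaurin_sin_bound[of y 3] by (simp add: sin_coeff_def numeral_eq_Suc)
  also have "\<dots> \<le> \<bar>y\<bar> ^ 3" by (simp add: fact_numeral mult_left_le_one_le)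
  finally have s: "\<bar>sin y - y\<bar> \<le> \<bar>y\<bar> ^ 3" .
  have c: "\<bar>1 - cos y\<bar> \<le> 2 * (\<bar>y\<bar> / 2)\<^sup>2"
  proof -
    have "1 - cos y = 2 * (sin (y / 2))\<^sup>2"
      using cos_double_sin[of "y / 2"] by simp
    moreover have "\<bar>sin (y / 2)\<bar>\<^sup>2 \<le> (\<bar>y\<bar> / 2)\<^sup>2"
      using abs_sin_x_le_abs_x[of "y / 2"] by (intro power_mono) auto
    ultimately show ?thesis by simp
  qed
  have "x * cos (x / 2) - 2 * sin (x / 2) = - (2 * y * (1 - cos y)) - 2 * (sin y - y)"
    by (simp add: y_def algebra_simps)
  also have "\<bar>\<dots>\<bar> \<le> \<bar>2 * y * (1 - cos y)\<bar> + \<bar>2 * (sin y - y)\<bar>"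
    using abs_triangle_ineq4[of "- (2 * y * (1 - cos y))" "2 * (sin y - y)"] unfolding abs_minus_cancel .
  also have "\<dots> = 2 * \<bar>y\<bar> * \<bar>1 - cos y\<bar> + 2 * \<bar>sin y - y\<bar>"
    unfolding abs_mult by simp
  also have "\<dots> \<le> 2 * \<bar>y\<bar> * (2 * (\<bar>y\<bar> / 2)\<^sup>2) + 2 * \<bar>y\<bar> ^ 3"
    using s c by (intro add_mono mult_left_mono) auto
  also have "\<dots> \<le> \<bar>x\<bar> ^ 3"
    using mult_nonneg_nonneg[OF zero_le_square[of x] abs_ge_zero[of x]]
    by (simp add: y_def power2_eq_square power3_eq_cube field_simps)
  finally show ?thesis .
qed

text \<open>By the sum-to-product formulas the error is a sine times
  \<open>trapezoid_trig_error\<close>. The third order is essential: cubes of phase increments sum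
  to something small when the squares stay bounded, whereas second-order errors would not vanish
  along Wiener paths.\<close>

lemma trapezoid_cos: "\<bar>cos b - cos a + (sin a + sin b) / 2 * (b - a)\<bar> \<le> \<bar>b - a\<bar> ^ 3" for a b :: real
proof -
  have "cos b - cos a = - (2 * sin ((a + b) / 2) * sin ((b - a) / 2))"
    using cos_diff_cos[of a b] by simp
  moreover have "sin a + sin b = 2 * sin ((a + b) / 2) * cos ((b - a) / 2)"
    using sin_plus_sin[of b a] by (simp add: add.commute)
  ultimately have "cos b - cos a + (sin a + sin b) / 2 * (b - a)
      = sin ((a + b) / 2) * ((b - a) * cos ((b - a) / 2) - 2 * sin ((b - a) / 2))"
    by (simp add: algebra_simps)
  moreover have "\<bar>\<dots>\<bar> \<le> 1 * \<bar>b - a\<bar> ^ 3"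
    unfolding abs_mult by (intro mult_mono trapezoid_trig_error) auto
  ultimately show ?thesis by simp
qed

lemma trapezoid_sin: "\<bar>sin b - sin a - (cos a + cos b) / 2 * (b - a)\<bar> \<le> \<bar>b - a\<bar> ^ 3" for a b :: real
proof -
  have "cos (t - pi/2) = sin t" "sin (t - pi/2) = - cos t" for t :: real
    by (simp_all add: cos_diff sin_diff)
  then have "sin b - sin a - (cos a + cos b) / 2 * (b - a) = cos (b - pi/2) - cos (a - pi/2)
      + (sin (a - pi/2) + sin (b - pi/2)) / 2 * ((b - pi/2) - (a - pi/2))"
    by (simp add: field_simps)
  moreover have "b - a = (b - pi/2) - (a - pi/2)" by simp
  ultimately show ?thesis using trapezoid_cos[of "b - pi/2" "a - pi/2"] by metis
qed

lemma abs_cos_diff_le: "\<bar>cos b - cos a\<bar> \<le> \<bar>b - a\<bar>" for a b :: real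
proof -
  have "\<bar>cos b - cos a\<bar> = 2 * (\<bar>sin ((b + a) / 2)\<bar> * \<bar>sin ((a - b) / 2)\<bar>)"
    unfolding cos_diff_cos by (simp add: abs_mult)
  also have "\<dots> \<le> 2 * (1 * \<bar>(a - b) / 2\<bar>)"
    by (intro mult_left_mono mult_mono abs_sin_x_le_abs_x) auto
  finally show ?thesis by simp
qed

lemma abs_sin_diff_le: "\<bar>sin b - sin a\<bar> \<le> \<bar>b - a\<bar>" for a b :: real
  using abs_cos_diff_le[of "b - pi/2" "a - pi/2"] by (simp add: cos_diff)

lemma rat_times_dense:
  assumes "T > 0" "s \<in> {0..T}"
  shows "\<exists>x. (\<forall>n. x n \<in> rat_times T) \<and> x \<longlonglongrightarrow> s"
proof (intro exI conjI allI)
  define i where "i n = nat \<lfloor>s / T * real (Suc n)\<rfloor>" for n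
  have i: "real (i n) \<le> s / T * real (Suc n)" "s / T * real (Suc n) \<le> real (i n) + 1" for n
    unfolding i_def using assms by (auto simp: of_nat_floor intro!: less_imp_le)
  show "grid T (Suc n) (i n) \<in> rat_times T" for n
  proof (rule grid_in_times)
    have "s / T * real (Suc n) \<le> 1 * real (Suc n)"
      using assms by (intro mult_right_mono) auto
    from order_trans[OF i(1)[of n] this] show "i n \<le> Suc n" by (simp del: of_nat_Suc)
  qed
  have "\<bar>grid T (Suc n) (i n) - s\<bar> \<le> T * inverse (real (Suc n))" for n
  proof -
    have "real (i n) / real (Suc n) \<le> s / T" "s / T \<le> (real (i n) + 1) / real (Suc n)"
      using i[of n] by (auto simp: pos_divide_le_eq pos_le_divide_eq simp del: of_nat_Suc)
    then have "T * (real (i n) / real (Suc n)) \<le> T * (s / T)" "T * (s / T) \<le> T * ((real (i n) + 1) / real (Suc n))"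
      using assms by (intro mult_left_mono; simp)+
    then show ?thesis using assms by (simp add: grid_def add_divide_distrib distrib_left inverse_eq_divide)
  qed
  then have "(\<lambda>n. grid T (Suc n) (i n) - s) \<longlonglongrightarrow> 0"
    by (intro Lim_null_comparison[OF _ tendsto_mult_right_zero[OF LIMSEQ_inverse_real_of_nat, of T]]) auto
  then show "(\<lambda>n. grid T (Suc n) (i n)) \<longlonglongrightarrow> s"
    by (rule LIM_zero_cancel)
qed

text \<open>The oscillation bound is given at times of \<open>rat_times T\<close> only. Density and
  continuity extend it to the whole cell; the strict inequality \<open>T / real n < \<delta>\<close>
  leaves room for the approximating times.\<close>

lemma trapezoid_integral_error:
  fixes f :: "real \<Rightarrow> real"
  assumes f: "continuous_on {0..T} f" and "T > 0" "n > 0" "i < n" "T / real n < \<delta>"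
    and osc: "\<And>s t. s \<in> rat_times T \<Longrightarrow> t \<in> rat_times T \<Longrightarrow> \<bar>s - t\<bar> \<le> \<delta> \<Longrightarrow> \<bar>f s - f t\<bar> \<le> e"
  shows "\<bar>integral {0..grid T n (Suc i)} f - integral {0..grid T n i} f
      - T / n * ((f (grid T n i) + f (grid T n (Suc i))) / 2)\<bar> \<le> e * (T / n)"
proof -
  let ?a = "grid T n i" and ?b = "grid T n (Suc i)"
  have ab: "0 \<le> ?a" "?a \<le> ?b" "?b \<le> T" "?b - ?a = T / n"
    using grid_nonneg[of T n i] grid_mono[of T i "Suc i" n] grid_mono[of T "Suc i" n n] grid_top[of n T]
      assms by (auto simp: grid_Suc_diff)
  have osc': "\<bar>f s - f t\<bar> \<le> e" if s: "s \<in> {?a..?b}" and t: "t \<in> {?a, ?b}" for s t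
  proof -
    have sT: "s \<in> {0..T}" using s ab by auto
    obtain x where x: "\<And>n. x n \<in> rat_times T" "x \<longlonglongrightarrow> s" using rat_times_dense[OF \<open>T > 0\<close> sT] by blast
    have tr: "t \<in> rat_times T" using t \<open>i < n\<close> by (auto intro: grid_in_times)
    have lim: "(\<lambda>n. \<bar>f (x n) - f t\<bar>) \<longlonglongrightarrow> \<bar>f s - f t\<bar>"
    proof (intro tendsto_intros continuous_on_tendsto_compose[OF f x(2) sT] always_eventually allI)
      show "x n \<in> {0..T}" for n
        using x(1)[of n] rat_times_subset[of T] \<open>T > 0\<close> by (meson less_imp_le subsetD)
    qed
    have "(\<lambda>n. \<bar>x n - t\<bar>) \<longlonglongrightarrow> \<bar>s - t\<bar>" by (intro tendsto_intros x)
    then have "\<forall>\<^sub>F n in sequentially. \<bar>x n - t\<bar> < \<delta>"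
      by (rule order_tendstoD(2)) (use s t ab \<open>T / real n < \<delta>\<close> in auto)
    then have "\<forall>\<^sub>F n in sequentially. \<bar>f (x n) - f t\<bar> \<le> e"
      by eventually_elim (use osc x(1) tr in auto)
    then show ?thesis
      using tendsto_upperbound[OF lim] by simp
  qed
  have fi: "f integrable_on {0..?b}" "f integrable_on {?a..?b}"
    using ab by (auto intro!: integrable_continuous_interval continuous_on_subset[OF f])
  define m where "m = (f ?a + f ?b) / 2"
  have "integral {0..?b} f - integral {0..?a} f - T / n * m = integral {?a..?b} f - integral {?a..?b} (\<lambda>_. m)"
    using Henstock_Kurzweil_Integration.integral_combine[OF ab(1,2) fi(1)] ab(2,4) by simp
  also have "\<dots> = integral {?a..?b} (\<lambda>s. f s - m)"
    by (rule Henstock_Kurzweil_Integration.integral_diff[symmetric, OF fi(2)]) auto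
  also have "\<bar>\<dots>\<bar> \<le> e * (?b - ?a)"
    unfolding real_norm_def[symmetric]
  proof (rule integral_bound[OF ab(2)])
    show "continuous_on {?a..?b} (\<lambda>s. f s - m)"
      using ab by (auto intro!: continuous_intros continuous_on_subset[OF f])
    fix s assume "s \<in> {?a..?b}"
    then have "\<bar>((f s - f ?a) + (f s - f ?b)) / 2\<bar> \<le> e"
      using osc'[of s ?a] osc'[of s ?b] by (intro abs_average_le) auto
    then show "norm (f s - m) \<le> e" by (simp add: m_def field_simps)
  qed
  finally show ?thesis unfolding m_def ab(4) .
qed

text \<open>The trapezoidal product rule is exact, so the rotated coordinate \<open>x cos \<theta> + y sin \<theta>\<close> only moves
  through the quadrature errors collected on the right-hand side.\<close>

lemma rotation_defect_bound:
  fixes x y th w dSx dSy IX IY :: "nat \<Rightarrow> real"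
  assumes x: "\<And>i. i < n \<Longrightarrow> x (Suc i) - x i = - dSx i - g * IY i"
    and y: "\<And>i. i < n \<Longrightarrow> y (Suc i) - y i = - dSy i + g * IX i"
    and th: "\<And>i. i < n \<Longrightarrow> th (Suc i) - th i = sg * (w (Suc i) - w i) + g * h"
    and S1: "\<bar>\<Sum>i<n. (cos (th i) + cos (th (Suc i))) / 2 * (dSx i - (w (Suc i) - w i) * ((sg * y i + sg * y (Suc i)) / 2))\<bar> \<le> a"
    and S2: "\<bar>\<Sum>i<n. (sin (th i) + sin (th (Suc i))) / 2 * (dSy i - (w (Suc i) - w i) * ((- sg * x i + - sg * x (Suc i)) / 2))\<bar> \<le> a"
    and I: "\<And>i. i < n \<Longrightarrow> \<bar>IX i - h * ((x i + x (Suc i)) / 2)\<bar> \<le> e * h"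
      "\<And>i. i < n \<Longrightarrow> \<bar>IY i - h * ((y i + y (Suc i)) / 2)\<bar> \<le> e * h"
    and K: "\<And>i. i \<le> n \<Longrightarrow> \<bar>x i\<bar> \<le> K" "\<And>i. i \<le> n \<Longrightarrow> \<bar>y i\<bar> \<le> K" "\<bar>g\<bar> \<le> K"
    and small: "\<And>i. i < n \<Longrightarrow> \<bar>th (Suc i) - th i\<bar> \<le> e" "(\<Sum>i<n. (th (Suc i) - th i)\<^sup>2) \<le> C"
    and h: "real n * h = T" and "e \<ge> 0"
  shows "\<bar>(x n * cos (th n) + y n * sin (th n)) - (x 0 * cos (th 0) + y 0 * sin (th 0))\<bar>
    \<le> 2 * a + 2 * K * e * (T + C)"
proof -
  have K0: "K \<ge> 0" using K(3) by linarith
  define ac where "ac i = (cos (th i) + cos (th (Suc i))) / 2" for i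
  define as where "as i = (sin (th i) + sin (th (Suc i))) / 2" for i
  define ax where "ax i = (x i + x (Suc i)) / 2" for i
  define ay where "ay i = (y i + y (Suc i)) / 2" for i
  define e1 where "e1 i = cos (th (Suc i)) - cos (th i) + as i * (th (Suc i) - th i)" for i
  define e2 where "e2 i = sin (th (Suc i)) - sin (th i) - ac i * (th (Suc i) - th i)" for i
  define q1 where "q1 i = ac i * (dSx i - (w (Suc i) - w i) * ((sg * y i + sg * y (Suc i)) / 2))" for i
  define q2 where "q2 i = as i * (dSy i - (w (Suc i) - w i) * ((- sg * x i + - sg * x (Suc i)) / 2))" for i
  define R where "R i = g * as i * (IX i - h * ax i) - g * ac i * (IY i - h * ay i) + ax i * e1 i + ay i * e2 i" for i
  define Y where "Y i = x i * cos (th i) + y i * sin (th i)" for i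
  have step: "Y (Suc i) - Y i = R i - q1 i - q2 i" if "i < n" for i
  proof -
    \<comment> \<open>The exact discrete product rule: an increment of a product is mean times
      increment plus increment times mean.\<close>
    have "Y (Suc i) - Y i = ac i * (x (Suc i) - x i) + ax i * (cos (th (Suc i)) - cos (th i))
       + as i * (y (Suc i) - y i) + ay i * (sin (th (Suc i)) - sin (th i))"
      by (simp add: Y_def ac_def as_def ax_def ay_def field_simps)
    also have "cos (th (Suc i)) - cos (th i) = e1 i - as i * (sg * (w (Suc i) - w i) + g * h)"
      using th[OF that] by (simp add: e1_def)
    also have "sin (th (Suc i)) - sin (th i) = e2 i + ac i * (sg * (w (Suc i) - w i) + g * h)"
      using th[OF that] by (simp add: e2_def)
    also have "x (Suc i) - x i = - dSx i - g * IY i" by (rule x[OF that])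
    also have "y (Suc i) - y i = - dSy i + g * IX i" by (rule y[OF that])
    \<comment> \<open>The terms with \<open>sg * (w (Suc i) - w i)\<close> cancel between the
      increments of the coordinates and of the phase, and so do the \<open>g * h\<close> terms up to
      the quadrature errors kept in \<open>R\<close>.\<close>
    finally show ?thesis
      by (simp add: R_def q1_def q2_def ax_def ay_def field_simps)
  qed
  have "Y n - Y 0 = (\<Sum>i<n. R i - q1 i - q2 i)"
    unfolding sum_lessThan_telescope[symmetric] by (intro sum.cong refl step) auto
  then have Yn: "Y n - Y 0 = (\<Sum>i<n. R i) - (\<Sum>i<n. q1 i) - (\<Sum>i<n. q2 i)"
    by (simp add: sum_subtractf)
  have Rb: "\<bar>R i\<bar> \<le> 2 * K * e * h + 2 * K * e * (th (Suc i) - th i)\<^sup>2" if "i < n" for i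
  proof -
    have a1: "\<bar>ac i\<bar> \<le> 1" "\<bar>as i\<bar> \<le> 1"
      unfolding ac_def as_def by (intro abs_average_le; simp)+
    have aK: "\<bar>ax i\<bar> \<le> K" "\<bar>ay i\<bar> \<le> K"
      unfolding ax_def ay_def using K that by (intro abs_average_le; simp)+
    \<comment> \<open>One factor is spent on the maximal phase increment \<open>e\<close>; the
      remaining square is summable with total at most \<open>C\<close>.\<close>
    have "\<bar>th (Suc i) - th i\<bar> ^ 3 = \<bar>th (Suc i) - th i\<bar> * (th (Suc i) - th i)\<^sup>2"
      by (simp add: power3_eq_cube power2_eq_square abs_mult_self_eq mult.assoc)
    also have "\<dots> \<le> e * (th (Suc i) - th i)\<^sup>2"
      by (intro mult_right_mono small that) auto
    finally have cube: "\<bar>th (Suc i) - th i\<bar> ^ 3 \<le> e * (th (Suc i) - th i)\<^sup>2" .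
    have es: "\<bar>e1 i\<bar> \<le> e * (th (Suc i) - th i)\<^sup>2" "\<bar>e2 i\<bar> \<le> e * (th (Suc i) - th i)\<^sup>2"
      using trapezoid_cos[of "th (Suc i)" "th i"] trapezoid_sin[of "th (Suc i)" "th i"] cube
      unfolding e1_def e2_def as_def ac_def by linarith+
    have "\<bar>g * as i * (IX i - h * ax i)\<bar> \<le> K * 1 * (e * h)"
      unfolding abs_mult using K(3) K0 a1 I(1)[OF that] by (intro mult_mono) (auto simp: ax_def)
    moreover have "\<bar>g * ac i * (IY i - h * ay i)\<bar> \<le> K * 1 * (e * h)"
      unfolding abs_mult using K(3) K0 a1 I(2)[OF that] by (intro mult_mono) (auto simp: ay_def)
    moreover have "\<bar>ax i * e1 i\<bar> \<le> K * (e * (th (Suc i) - th i)\<^sup>2)"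
      unfolding abs_mult using aK es K0 by (intro mult_mono) auto
    moreover have "\<bar>ay i * e2 i\<bar> \<le> K * (e * (th (Suc i) - th i)\<^sup>2)"
      unfolding abs_mult using aK es K0 by (intro mult_mono) auto
    ultimately show ?thesis unfolding R_def by linarith
  qed
  have "\<bar>\<Sum>i<n. R i\<bar> \<le> (\<Sum>i<n. 2 * K * e * h + 2 * K * e * (th (Suc i) - th i)\<^sup>2)"
    using Rb by (intro order_trans[OF sum_abs] sum_mono) auto
  also have "\<dots> = 2 * K * e * (T + (\<Sum>i<n. (th (Suc i) - th i)\<^sup>2))"
    unfolding h[symmetric] by (simp add: sum.distrib sum_distrib_left algebra_simps)
  also have "\<dots> \<le> 2 * K * e * (T + C)"
    using small(2) K0 \<open>e \<ge> 0\<close> by (intro mult_left_mono) auto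
  finally have "\<bar>\<Sum>i<n. R i\<bar> \<le> 2 * K * e * (T + C)" .
  moreover have "\<bar>\<Sum>i<n. q1 i\<bar> \<le> a" "\<bar>\<Sum>i<n. q2 i\<bar> \<le> a"
    using S1 S2 unfolding q1_def q2_def ac_def as_def by auto
  ultimately have "\<bar>Y n - Y 0\<bar> \<le> 2 * a + 2 * K * e * (T + C)"
    unfolding Yn by linarith
  then show ?thesis unfolding Y_def .
qed

section \<open>Conservation of the rotated coordinate\<close>

lemma adapted_compose:
  assumes "adapted F X" "f \<in> borel_measurable borel"
  shows "adapted F (\<lambda>t \<omega>. f (X t \<omega>))"
  using assms unfolding adapted_def by (auto intro: measurable_compose)

lemma continuous_paths_compose:
  assumes "continuous_paths M X" "continuous_on UNIV f"
  shows "continuous_paths M (\<lambda>t \<omega>. f (X t \<omega>))"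
  using assms(1) unfolding continuous_paths_def
proof eventually_elim
  case (elim \<omega>)
  then show ?case by (rule continuous_on_compose2[OF assms(2)]) auto
qed

lemma continuous_eq_if_eq_on_Rats:
  fixes f g :: "real \<Rightarrow> real"
  assumes f: "continuous_on {0..} f" and g: "continuous_on {0..} g"
    and eq: "\<And>q. q \<in> \<rat> \<Longrightarrow> q \<ge> 0 \<Longrightarrow> f q = g q" and "t \<ge> 0"
  shows "f t = g t"
proof -
  \<comment> \<open>A natural number as end point makes every element of \<open>rat_times T\<close>
    a rational number.\<close>
  obtain m :: nat where "t < real m" using reals_Archimedean2 by blast
  then obtain T where T: "T > 0" "t \<in> {0..T}" "T \<in> \<rat>" using \<open>t \<ge> 0\<close> that[of "real m"] by auto
  then obtain x where x: "\<And>n. x n \<in> rat_times T" "x \<longlonglongrightarrow> t" using rat_times_dense by blast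
  have xr: "x n \<in> \<rat>" "x n \<ge> 0" for n
    using x(1)[of n] T by (auto simp: rat_times_def)
  have "(\<lambda>n. f (x n)) \<longlonglongrightarrow> f t" "(\<lambda>n. g (x n)) \<longlonglongrightarrow> g t"
    using xr \<open>t \<ge> 0\<close>
    by (auto intro!: continuous_on_tendsto_compose[OF f x(2)] continuous_on_tendsto_compose[OF g x(2)])
  moreover have "(\<lambda>n. f (x n)) = (\<lambda>n. g (x n))" using eq xr by auto
  ultimately show ?thesis using LIMSEQ_unique by metis
qed

context filtered_wiener
begin

text \<open>Projection commutes with the symmetric sums and does not enlarge deviations when
  \<open>norm v \<le> 1\<close>, so the same mesh works. Both signs of the coordinate vectors are
  used later.\<close>

lemma has_stratonovich_integral_inner:
  fixes Y :: "real \<Rightarrow> 'a \<Rightarrow> 'b::euclidean_space"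
  assumes J: "has_stratonovich_integral M W t Y J" and Y: "adapted F Y" and v: "norm v \<le> 1"
  shows "has_stratonovich_integral M W t (\<lambda>s \<omega>. v \<bullet> Y s \<omega>) (\<lambda>\<omega>. v \<bullet> J \<omega>)"
  unfolding has_stratonovich_integral_def
proof (intro conjI allI impI)
  have Jm [measurable]: "J \<in> borel_measurable M" using J by (simp add: has_stratonovich_integral_def)
  show "(\<lambda>\<omega>. v \<bullet> J \<omega>) \<in> borel_measurable M" by measurable
  fix \<epsilon> \<eta> :: real assume "\<epsilon> > 0" "\<eta> > 0"
  then have "\<exists>\<delta>>0. \<forall>n p. is_partition t n p \<and> (\<forall>i<n. p (Suc i) - p i < \<delta>) \<longrightarrow>
      measure M {\<omega> \<in> space M. norm (stratonovich_sum W Y n p \<omega> - J \<omega>) \<ge> \<epsilon>} < \<eta>"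
    using J by (simp add: has_stratonovich_integral_def)
  then obtain \<delta> where \<delta>: "\<delta> > 0" "\<And>n p. is_partition t n p \<Longrightarrow> (\<forall>i<n. p (Suc i) - p i < \<delta>) \<Longrightarrow>
      measure M {\<omega> \<in> space M. norm (stratonovich_sum W Y n p \<omega> - J \<omega>) \<ge> \<epsilon>} < \<eta>"
    by auto
  show "\<exists>\<delta>>0. \<forall>n p. is_partition t n p \<and> (\<forall>i<n. p (Suc i) - p i < \<delta>) \<longrightarrow>
      measure M {\<omega> \<in> space M. norm (stratonovich_sum W (\<lambda>s \<omega>. v \<bullet> Y s \<omega>) n p \<omega> - v \<bullet> J \<omega>) \<ge> \<epsilon>} < \<eta>"
  proof (intro exI[of _ \<delta>] conjI \<delta>(1) allI impI)
    fix n p assume p: "is_partition t n p \<and> (\<forall>i<n. p (Suc i) - p i < \<delta>)"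
    have [measurable]: "stratonovich_sum W Y n p \<in> borel_measurable M"
      using stratonovich_sum_measurable[OF Y] p by blast
    have "stratonovich_sum W (\<lambda>s \<omega>. v \<bullet> Y s \<omega>) n p \<omega> = v \<bullet> stratonovich_sum W Y n p \<omega>" for \<omega>
      by (simp add: stratonovich_sum_def inner_sum_right inner_add_right)
    then have "norm (stratonovich_sum W (\<lambda>s \<omega>. v \<bullet> Y s \<omega>) n p \<omega> - v \<bullet> J \<omega>)
        \<le> norm (stratonovich_sum W Y n p \<omega> - J \<omega>)" for \<omega>
      using order_trans[OF Cauchy_Schwarz_ineq2 mult_right_mono[OF v norm_ge_zero], of "stratonovich_sum W Y n p \<omega> - J \<omega>"]
      by (simp add: inner_diff_right)
    then have "measure M {\<omega> \<in> space M. norm (stratonovich_sum W (\<lambda>s \<omega>. v \<bullet> Y s \<omega>) n p \<omega> - v \<bullet> J \<omega>) \<ge> \<epsilon>}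
        \<le> measure M {\<omega> \<in> space M. norm (stratonovich_sum W Y n p \<omega> - J \<omega>) \<ge> \<epsilon>}"
      by (intro finite_measure_mono) (auto intro: order_trans)
    also have "\<dots> < \<eta>" using \<delta>(2) p by blast
    finally show "measure M {\<omega> \<in> space M. norm (stratonovich_sum W (\<lambda>s \<omega>. v \<bullet> Y s \<omega>) n p \<omega> - v \<bullet> J \<omega>) \<ge> \<epsilon>} < \<eta>" .
  qed
qed

text \<open>Every symmetric sum is 0, and a limit in probability is almost surely unique.\<close>

lemma stratonovich_integral_of_zero:
  assumes J: "has_stratonovich_integral M W t (\<lambda>s \<omega>. 0 :: real) J" and "t \<ge> 0"
  shows "AE \<omega> in M. J \<omega> = 0"
proof (rule AE_eq_0_if_mostly_small)
  fix \<epsilon> \<eta> :: real assume "\<epsilon> > 0" "\<eta> > 0"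
  moreover have "adapted F (\<lambda>s \<omega>. 0 :: real)" by (simp add: adapted_def)
  ultimately obtain \<delta> where \<delta>: "\<delta> > 0" "\<And>n p. is_partition t n p \<Longrightarrow> (\<forall>i<n. p (Suc i) - p i < \<delta>) \<Longrightarrow>
      mostly M \<eta> (\<lambda>\<omega>. \<bar>stratonovich_sum W (\<lambda>s \<omega>. 0) n p \<omega> - J \<omega>\<bar> \<le> \<epsilon>)"
    using stratonovich_integral_mostly[OF J] by blast
  have "\<forall>\<^sub>F n in sequentially. t / real n < \<delta>"
    by (rule order_tendstoD(2)[OF lim_const_over_n \<delta>(1)])
  from eventually_conj[OF this eventually_gt_at_top[of 0]]
  obtain n where n: "t / real n < \<delta>" "n > 0" unfolding eventually_sequentially by auto
  have "mostly M \<eta> (\<lambda>\<omega>. \<bar>stratonovich_sum W (\<lambda>s \<omega>. 0) n (grid t n) \<omega> - J \<omega>\<bar> \<le> \<epsilon>)"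
    using n \<open>t \<ge> 0\<close> by (intro \<delta>(2)) (auto simp: is_partition_def grid_top grid_Suc_diff intro: grid_mono)
  then show "mostly M \<eta> (\<lambda>\<omega>. \<bar>J \<omega>\<bar> \<le> \<epsilon>)"
    by (simp add: stratonovich_sum_def)
qed

lemma bounded_in_prob_sq_var_dominated:
  assumes X: "bounded_in_prob M (sq_var T X)" and Y: "\<And>s t \<omega>. \<bar>Y s \<omega> - Y t \<omega>\<bar> \<le> \<bar>c\<bar> * \<bar>X s \<omega> - X t \<omega>\<bar>"
  shows "bounded_in_prob M (sq_var T Y)"
proof (rule bounded_in_prob_dominated[OF X X, of "c\<^sup>2"])
  have "sq_var T Y n \<omega> \<le> c\<^sup>2 * sq_var T X n \<omega>" for n \<omega>
    unfolding sq_var_def sum_distrib_left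
  proof (intro sum_mono)
    fix i
    have "\<bar>Y (grid T n (Suc i)) \<omega> - Y (grid T n i) \<omega>\<bar>\<^sup>2 \<le> (\<bar>c\<bar> * \<bar>X (grid T n (Suc i)) \<omega> - X (grid T n i) \<omega>\<bar>)\<^sup>2"
      by (intro power_mono Y) auto
    then show "(Y (grid T n (Suc i)) \<omega> - Y (grid T n i) \<omega>)\<^sup>2 \<le> c\<^sup>2 * (X (grid T n (Suc i)) \<omega> - X (grid T n i) \<omega>)\<^sup>2"
      by (simp add: power_mult_distrib)
  qed
  moreover have "0 \<le> c\<^sup>2 * sq_var T X n \<omega>" for n \<omega> by (simp add: sq_var_nonneg)
  ultimately show "AE \<omega> in M. \<forall>n. \<bar>sq_var T Y n \<omega>\<bar> \<le> c\<^sup>2 * (\<bar>sq_var T X n \<omega>\<bar> + \<bar>sq_var T X n \<omega>\<bar>)"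
    by (intro AE_I2 allI) (smt (verit) sq_var_nonneg distrib_left)
qed simp

lemma bounded_in_prob_sq_var_phase:
  assumes g: "g \<in> borel_measurable (F 0)" and "T > 0"
  shows "bounded_in_prob M (sq_var T (\<lambda>t \<omega>. sg * W t \<omega> + g \<omega> * t))"
proof -
  \<comment> \<open>The random speed is viewed as a constant process so that
    \<open>mostly_bounded\<close> gives its tightness.\<close>
  have ag: "adapted F (\<lambda>t. g)" using g by (auto simp: adapted_def intro: measurable_F_mono)
  have "continuous_paths M (\<lambda>t. g)" by (simp add: continuous_paths_def)
  note bd = mostly_bounded[OF ag this, of T]
  have G: "bounded_in_prob M (\<lambda>n \<omega>. (g \<omega>)\<^sup>2)"
    unfolding bounded_in_prob_def
  proof (intro allI impI)
    fix \<eta> :: real assume "\<eta> > 0"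
    then obtain C where C: "mostly M \<eta> (\<lambda>\<omega>. \<forall>s\<in>rat_times T. \<bar>g \<omega>\<bar> \<le> C)" using bd \<open>T > 0\<close> by auto
    have "mostly M \<eta> (\<lambda>\<omega>. \<bar>(g \<omega>)\<^sup>2\<bar> \<le> C\<^sup>2)"
    proof (rule mostly_mono[OF C order_refl])
      fix \<omega> assume "\<forall>s\<in>rat_times T. \<bar>g \<omega>\<bar> \<le> C"
      \<comment> \<open>The quantifier over times does not touch \<open>g\<close>; it is discharged
        because \<open>rat_times T\<close> contains 0.\<close>
      then have "\<bar>g \<omega>\<bar> \<le> C" using grid_in_times[of 0 0 T] by blast
      then have "\<bar>g \<omega>\<bar>\<^sup>2 \<le> C\<^sup>2" by (intro power_mono) auto
      then show "\<bar>(g \<omega>)\<^sup>2\<bar> \<le> C\<^sup>2" by simp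
    qed
    then show "\<exists>C. \<forall>n. mostly M \<eta> (\<lambda>\<omega>. \<bar>(g \<omega>)\<^sup>2\<bar> \<le> C)" by blast
  qed
  show ?thesis
  proof (rule bounded_in_prob_dominated[OF bounded_in_prob_sq_var_W[OF \<open>T > 0\<close>] G, of "2 * (sg\<^sup>2 + T\<^sup>2)"])
    have "sq_var T (\<lambda>t \<omega>. sg * W t \<omega> + g \<omega> * t) n \<omega> \<le> 2 * (sg\<^sup>2 + T\<^sup>2) * (sq_var T W n \<omega> + (g \<omega>)\<^sup>2)" for n \<omega>
    proof -
      have "sq_var T (\<lambda>t \<omega>. sg * W t \<omega> + g \<omega> * t) n \<omega>
        \<le> (\<Sum>i<n. 2 * sg\<^sup>2 * (W (grid T n (Suc i)) \<omega> - W (grid T n i) \<omega>)\<^sup>2 + 2 * (g \<omega>)\<^sup>2 * (T / n)\<^sup>2)"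
        unfolding sq_var_def
      proof (intro sum_mono)
        fix i
        have "sg * W (grid T n (Suc i)) \<omega> + g \<omega> * grid T n (Suc i) - (sg * W (grid T n i) \<omega> + g \<omega> * grid T n i)
          = sg * (W (grid T n (Suc i)) \<omega> - W (grid T n i) \<omega>) + g \<omega> * (T / n)" (is "?l = ?a + ?b")
          unfolding grid_Suc_diff[of T n i, symmetric] by (simp add: algebra_simps)
        moreover have "(?a + ?b)\<^sup>2 \<le> 2 * ?a\<^sup>2 + 2 * ?b\<^sup>2"
          using zero_le_power2[of "?a - ?b"] by (simp add: power2_sum power2_diff)
        ultimately show "?l\<^sup>2 \<le> 2 * sg\<^sup>2 * (W (grid T n (Suc i)) \<omega> - W (grid T n i) \<omega>)\<^sup>2 + 2 * (g \<omega>)\<^sup>2 * (T / n)\<^sup>2"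
          by (simp add: power_mult_distrib power_divide mult.assoc)
      qed
      also have "\<dots> = 2 * sg\<^sup>2 * sq_var T W n \<omega> + 2 * (g \<omega>)\<^sup>2 * (real n * (T / n)\<^sup>2)"
        by (simp add: sq_var_def sum.distrib sum_distrib_left)
      finally have "sq_var T (\<lambda>t \<omega>. sg * W t \<omega> + g \<omega> * t) n \<omega>
        \<le> 2 * sg\<^sup>2 * sq_var T W n \<omega> + 2 * (g \<omega>)\<^sup>2 * (real n * (T / n)\<^sup>2)" .
      moreover have "real n * (T / n)\<^sup>2 \<le> T\<^sup>2"
      proof (cases "n = 0")
        case False
        then have "T\<^sup>2 * 1 \<le> T\<^sup>2 * real n" by (intro mult_left_mono) auto
        then show ?thesis using False by (simp add: power2_eq_square field_simps)
      qed simp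
      then have "2 * (g \<omega>)\<^sup>2 * (real n * (T / n)\<^sup>2) \<le> 2 * (g \<omega>)\<^sup>2 * T\<^sup>2"
        by (intro mult_left_mono) auto
      ultimately have "sq_var T (\<lambda>t \<omega>. sg * W t \<omega> + g \<omega> * t) n \<omega> \<le> 2 * sg\<^sup>2 * sq_var T W n \<omega> + 2 * (g \<omega>)\<^sup>2 * T\<^sup>2"
        by linarith
      also have "\<dots> \<le> 2 * (sg\<^sup>2 + T\<^sup>2) * (sq_var T W n \<omega> + (g \<omega>)\<^sup>2)"
        using sq_var_nonneg[of T W n \<omega>] by (simp add: algebra_simps)
      finally show ?thesis .
    qed
    then show "AE \<omega> in M. \<forall>n. \<bar>sq_var T (\<lambda>t \<omega>. sg * W t \<omega> + g \<omega> * t) n \<omega>\<bar>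
        \<le> 2 * (sg\<^sup>2 + T\<^sup>2) * (\<bar>sq_var T W n \<omega>\<bar> + \<bar>(g \<omega>)\<^sup>2\<bar>)"
      by (simp add: sq_var_nonneg)
  qed simp
qed

text \<open>Stated for abstract \<open>X\<close>, \<open>Y\<close> so that it applies to the two
  coordinates and again after a quarter turn. The drift is already linear with a speed
  \<open>g\<close> frozen at time 0, which makes \<open>th\<close> adapted although it is
  random.\<close>

lemma rotated_coordinate_conserved:
  assumes X: "adapted F X" "continuous_paths M X" "bounded_in_prob M (sq_var T X)"
    and Y: "adapted F Y" "continuous_paths M Y" "bounded_in_prob M (sq_var T Y)"
    and g: "g \<in> borel_measurable (F 0)" and "T > 0"
    and S1: "\<And>t. t \<in> {0..T} \<Longrightarrow> has_stratonovich_integral M W t (\<lambda>s \<omega>. sg * Y s \<omega>) (S1 t)"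
    and S2: "\<And>t. t \<in> {0..T} \<Longrightarrow> has_stratonovich_integral M W t (\<lambda>s \<omega>. - sg * X s \<omega>) (S2 t)"
    and eqX: "\<And>t. t \<in> {0..T} \<Longrightarrow> AE \<omega> in M. X t \<omega> - X 0 \<omega> + g \<omega> * integral {0..t} (\<lambda>s. Y s \<omega>) + S1 t \<omega> = 0"
    and eqY: "\<And>t. t \<in> {0..T} \<Longrightarrow> AE \<omega> in M. Y t \<omega> - Y 0 \<omega> - g \<omega> * integral {0..t} (\<lambda>s. X s \<omega>) + S2 t \<omega> = 0"
  defines "th \<equiv> \<lambda>t \<omega>. sg * W t \<omega> + g \<omega> * t"
  shows "AE \<omega> in M. X T \<omega> * cos (th T \<omega>) + Y T \<omega> * sin (th T \<omega>) = X 0 \<omega> * cos (th 0 \<omega>) + Y 0 \<omega> * sin (th 0 \<omega>)"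
proof -
  have tha: "adapted F th"
    unfolding adapted_def th_def
  proof (intro allI impI)
    fix t :: real assume "0 \<le> t"
    then have [measurable]: "W t \<in> borel_measurable (F t)" "g \<in> borel_measurable (F t)"
      using adapted_F[OF adapted_W] measurable_F_mono[OF g] by auto
    show "(\<lambda>\<omega>. sg * W t \<omega> + g \<omega> * t) \<in> borel_measurable (F t)" by measurable
  qed
  have thc: "continuous_paths M th"
    using continuous_W unfolding continuous_paths_def th_def
    by eventually_elim (intro continuous_intros)
  have thb: "bounded_in_prob M (sq_var T th)"
    unfolding th_def by (rule bounded_in_prob_sq_var_phase[OF g \<open>T > 0\<close>])
  have cos: "adapted F (\<lambda>t \<omega>. cos (th t \<omega>))" "continuous_paths M (\<lambda>t \<omega>. cos (th t \<omega>))"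
      "bounded_in_prob M (sq_var T (\<lambda>t \<omega>. cos (th t \<omega>)))"
    using abs_cos_diff_le
    by (auto intro!: adapted_compose[OF tha] continuous_paths_compose[OF thc] continuous_intros
      bounded_in_prob_sq_var_dominated[OF thb, of _ 1])
  have sin: "adapted F (\<lambda>t \<omega>. sin (th t \<omega>))" "continuous_paths M (\<lambda>t \<omega>. sin (th t \<omega>))"
      "bounded_in_prob M (sq_var T (\<lambda>t \<omega>. sin (th t \<omega>)))"
    using abs_sin_diff_le
    by (auto intro!: adapted_compose[OF tha] continuous_paths_compose[OF thc] continuous_intros
      bounded_in_prob_sq_var_dominated[OF thb, of _ 1])
  have Z1: "adapted F (\<lambda>t \<omega>. sg * Y t \<omega>)" "continuous_paths M (\<lambda>t \<omega>. sg * Y t \<omega>)"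
      "bounded_in_prob M (sq_var T (\<lambda>t \<omega>. sg * Y t \<omega>))"
    by (auto intro!: adapted_compose[OF Y(1)] continuous_paths_compose[OF Y(2)] continuous_intros
      bounded_in_prob_sq_var_dominated[OF Y(3), of _ sg] simp: abs_mult[symmetric] right_diff_distrib)
  have Z2: "adapted F (\<lambda>t \<omega>. - sg * X t \<omega>)" "continuous_paths M (\<lambda>t \<omega>. - sg * X t \<omega>)"
      "bounded_in_prob M (sq_var T (\<lambda>t \<omega>. - sg * X t \<omega>))"
    by (auto intro!: adapted_compose[OF X(1)] continuous_paths_compose[OF X(2)] continuous_intros
      bounded_in_prob_sq_var_dominated[OF X(3), of _ sg] simp: abs_mult[symmetric] right_diff_distrib)
  \<comment> \<open>Countability gives one null set outside which both equations hold at every grid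
    point of every grid.\<close>
  have eqs: "AE \<omega> in M. \<forall>t\<in>rat_times T. X t \<omega> - X 0 \<omega> + g \<omega> * integral {0..t} (\<lambda>s. Y s \<omega>) + S1 t \<omega> = 0
      \<and> Y t \<omega> - Y 0 \<omega> - g \<omega> * integral {0..t} (\<lambda>s. X s \<omega>) + S2 t \<omega> = 0"
  proof (rule AE_ball_countable'[OF _ countable_rat_times])
    fix t assume "t \<in> rat_times T"
    then have t: "t \<in> {0..T}" using rat_times_subset[of T] \<open>T > 0\<close> by (meson less_imp_le subsetD)
    show "AE \<omega> in M. X t \<omega> - X 0 \<omega> + g \<omega> * integral {0..t} (\<lambda>s. Y s \<omega>) + S1 t \<omega> = 0
      \<and> Y t \<omega> - Y 0 \<omega> - g \<omega> * integral {0..t} (\<lambda>s. X s \<omega>) + S2 t \<omega> = 0"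
      using eqX[OF t] eqY[OF t] by eventually_elim simp
  qed
  define D where "D \<omega> = X T \<omega> * cos (th T \<omega>) + Y T \<omega> * sin (th T \<omega>) - (X 0 \<omega> * cos (th 0 \<omega>) + Y 0 \<omega> * sin (th 0 \<omega>))" for \<omega>
  have "AE \<omega> in M. D \<omega> = 0"
  proof (rule AE_eq_0_if_mostly_small)
    fix \<epsilon> \<eta> :: real assume "\<epsilon> > 0" "\<eta> > 0"
    \<comment> \<open>Nine events are paid for; the almost sure path properties enter at cost
      0.\<close>
    define h where "h = \<eta> / 9"
    have h: "h > 0" and T0: "T \<ge> 0" using \<open>\<eta> > 0\<close> \<open>T > 0\<close> by (auto simp: h_def)
    obtain K1 where K1: "mostly M h (\<lambda>\<omega>. \<forall>s\<in>rat_times T. \<bar>X s \<omega>\<bar> \<le> K1)" using mostly_bounded[OF X(1,2) T0 h] by blast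
    obtain K2 where K2: "mostly M h (\<lambda>\<omega>. \<forall>s\<in>rat_times T. \<bar>Y s \<omega>\<bar> \<le> K2)" using mostly_bounded[OF Y(1,2) T0 h] by blast
    have "adapted F (\<lambda>t. g)" "continuous_paths M (\<lambda>t. g)"
      using g by (auto simp: adapted_def continuous_paths_def intro: measurable_F_mono)
    from mostly_bounded[OF this T0 h]
    obtain K3 where K3: "mostly M h (\<lambda>\<omega>. \<forall>s\<in>rat_times T. \<bar>g \<omega>\<bar> \<le> K3)" by blast
    define K where "K = max 0 (max K1 (max K2 K3))"
    obtain C where C: "\<And>n. mostly M h (\<lambda>\<omega>. \<bar>sq_var T th n \<omega>\<bar> \<le> C)"
      using thb h unfolding bounded_in_prob_def by blast
    \<comment> \<open>The added 1 avoids a zero denominator when \<open>K = 0\<close>. The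
      quadrature errors then cost \<open>\<epsilon> / 2\<close>, and the two uses of associativity
      \<open>\<epsilon> / 4\<close> each.\<close>
    define e where "e = \<epsilon> / 2 / (2 * K * (T + max 0 C) + 1)"
    have den: "2 * K * (T + max 0 C) \<ge> 0" unfolding K_def using \<open>T > 0\<close> by auto
    have e: "e > 0" "2 * K * e * (T + max 0 C) \<le> \<epsilon> / 2"
    proof -
      show "e > 0" unfolding e_def using den \<open>\<epsilon> > 0\<close> by (intro divide_pos_pos) linarith+
      have "2 * K * (\<epsilon> / 2 / d) * t = \<epsilon> / 2 * (2 * K * t / d)" for d t :: real
        by (cases "d = 0") (auto simp: field_simps)
      then have "2 * K * e * (T + max 0 C) = (\<epsilon> / 2) * (2 * K * (T + max 0 C) / (2 * K * (T + max 0 C) + 1))"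
        unfolding e_def .
      also have "\<dots> \<le> (\<epsilon> / 2) * 1"
        using den \<open>\<epsilon> > 0\<close> by (intro mult_left_mono) (auto simp: divide_le_eq_1)
      finally show "2 * K * e * (T + max 0 C) \<le> \<epsilon> / 2" by simp
    qed
    obtain dX where dX: "dX > 0" "mostly M h (\<lambda>\<omega>. \<forall>s\<in>rat_times T. \<forall>t\<in>rat_times T. \<bar>s - t\<bar> \<le> dX \<longrightarrow> \<bar>X s \<omega> - X t \<omega>\<bar> \<le> e)"
      using mostly_equicontinuous[OF X(1,2) T0 e(1) h] by blast
    obtain dY where dY: "dY > 0" "mostly M h (\<lambda>\<omega>. \<forall>s\<in>rat_times T. \<forall>t\<in>rat_times T. \<bar>s - t\<bar> \<le> dY \<longrightarrow> \<bar>Y s \<omega> - Y t \<omega>\<bar> \<le> e)"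
      using mostly_equicontinuous[OF Y(1,2) T0 e(1) h] by blast
    obtain dt where dt: "dt > 0" "mostly M h (\<lambda>\<omega>. \<forall>s\<in>rat_times T. \<forall>t\<in>rat_times T. \<bar>s - t\<bar> \<le> dt \<longrightarrow> \<bar>th s \<omega> - th t \<omega>\<bar> \<le> e)"
      using mostly_equicontinuous[OF tha thc T0 e(1) h] by blast
    define \<delta> where "\<delta> = Min {dX, dY, dt}"
    have \<delta>: "\<delta> > 0" using dX dY dt by (simp add: \<delta>_def)
    have e4: "\<epsilon> / 4 > 0" using \<open>\<epsilon> > 0\<close> by simp
    note A1 = stratonovich_associative[OF cos(1,2) abs_cos_le_one cos(3) Z1 S1 \<open>T > 0\<close> e4 h]
    note A2 = stratonovich_associative[OF sin(1,2) abs_sin_le_one sin(3) Z2 S2 \<open>T > 0\<close> e4 h]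
    obtain N where N: "N > 0" "\<forall>\<^sub>F k in sequentially. mostly M h (\<lambda>\<omega>.
        \<bar>\<Sum>i<N*k. (cos (th (grid T (N*k) i) \<omega>) + cos (th (grid T (N*k) (Suc i)) \<omega>)) / 2 *
          (S1 (grid T (N*k) (Suc i)) \<omega> - S1 (grid T (N*k) i) \<omega> - strat_term T W (\<lambda>t \<omega>. sg * Y t \<omega>) (N*k) i \<omega>)\<bar> \<le> \<epsilon> / 4)"
      "\<forall>\<^sub>F k in sequentially. mostly M h (\<lambda>\<omega>.
        \<bar>\<Sum>i<N*k. (sin (th (grid T (N*k) i) \<omega>) + sin (th (grid T (N*k) (Suc i)) \<omega>)) / 2 *
          (S2 (grid T (N*k) (Suc i)) \<omega> - S2 (grid T (N*k) i) \<omega> - strat_term T W (\<lambda>t \<omega>. - sg * X t \<omega>) (N*k) i \<omega>)\<bar> \<le> \<epsilon> / 4)"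
      using eventually_happens'[OF sequentially_bot eventually_conj[OF eventually_gt_at_top[of 0] eventually_conj[OF A1 A2]]]
      by blast
    have "\<forall>\<^sub>F k in sequentially. T / real N / real k < \<delta>"
      by (rule order_tendstoD(2)[OF lim_const_over_n \<delta>])
    then obtain k where k: "k > 0" "T / real N / real k < \<delta>" and E1: "mostly M h (\<lambda>\<omega>.
        \<bar>\<Sum>i<N*k. (cos (th (grid T (N*k) i) \<omega>) + cos (th (grid T (N*k) (Suc i)) \<omega>)) / 2 *
          (S1 (grid T (N*k) (Suc i)) \<omega> - S1 (grid T (N*k) i) \<omega> - strat_term T W (\<lambda>t \<omega>. sg * Y t \<omega>) (N*k) i \<omega>)\<bar> \<le> \<epsilon> / 4)"
      and E2: "mostly M h (\<lambda>\<omega>.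
        \<bar>\<Sum>i<N*k. (sin (th (grid T (N*k) i) \<omega>) + sin (th (grid T (N*k) (Suc i)) \<omega>)) / 2 *
          (S2 (grid T (N*k) (Suc i)) \<omega> - S2 (grid T (N*k) i) \<omega> - strat_term T W (\<lambda>t \<omega>. - sg * X t \<omega>) (N*k) i \<omega>)\<bar> \<le> \<epsilon> / 4)"
      using eventually_happens'[OF sequentially_bot eventually_conj[OF eventually_gt_at_top[of 0] eventually_conj[OF _ eventually_conj[OF N(2,3)]]]]
      by blast
    define n where "n = N * k"
    have n: "n > 0" "T / real n < \<delta>" using N k by (auto simp: n_def)
    then have nd: "T / real n < dX" "T / real n < dY" "T / real n < dt" by (auto simp: \<delta>_def)
    have paths: "AE \<omega> in M. continuous_on {0..} (\<lambda>t. X t \<omega>) \<and> continuous_on {0..} (\<lambda>t. Y t \<omega>)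
        \<and> (\<forall>t\<in>rat_times T. X t \<omega> - X 0 \<omega> + g \<omega> * integral {0..t} (\<lambda>s. Y s \<omega>) + S1 t \<omega> = 0
          \<and> Y t \<omega> - Y 0 \<omega> - g \<omega> * integral {0..t} (\<lambda>s. X s \<omega>) + S2 t \<omega> = 0)"
      using X(2) Y(2) eqs unfolding continuous_paths_def by eventually_elim blast
    note E = mostly_conj[OF E1[folded n_def] mostly_conj[OF E2[folded n_def] mostly_conj[OF K1 mostly_conj[OF K2 mostly_conj[OF K3
      mostly_conj[OF C[of n] mostly_conj[OF dX(2) mostly_conj[OF dY(2) mostly_conj[OF dt(2) mostly_AE[OF paths order_refl]]]]]]]]]]
    show "mostly M \<eta> (\<lambda>\<omega>. \<bar>D \<omega>\<bar> \<le> \<epsilon>)"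
    proof (rule mostly_mono[OF E], simp add: h_def, elim conjE)
      fix \<omega>
      assume a1: "\<bar>\<Sum>i<n. (cos (th (grid T n i) \<omega>) + cos (th (grid T n (Suc i)) \<omega>)) / 2 *
          (S1 (grid T n (Suc i)) \<omega> - S1 (grid T n i) \<omega> - strat_term T W (\<lambda>t \<omega>. sg * Y t \<omega>) n i \<omega>)\<bar> \<le> \<epsilon> / 4"
        and a2: "\<bar>\<Sum>i<n. (sin (th (grid T n i) \<omega>) + sin (th (grid T n (Suc i)) \<omega>)) / 2 *
          (S2 (grid T n (Suc i)) \<omega> - S2 (grid T n i) \<omega> - strat_term T W (\<lambda>t \<omega>. - sg * X t \<omega>) n i \<omega>)\<bar> \<le> \<epsilon> / 4"
        and b: "\<forall>s\<in>rat_times T. \<bar>X s \<omega>\<bar> \<le> K1" "\<forall>s\<in>rat_times T. \<bar>Y s \<omega>\<bar> \<le> K2" "\<forall>s\<in>rat_times T. \<bar>g \<omega>\<bar> \<le> K3"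
        and v: "\<bar>sq_var T th n \<omega>\<bar> \<le> C"
        and o: "\<forall>s\<in>rat_times T. \<forall>t\<in>rat_times T. \<bar>s - t\<bar> \<le> dX \<longrightarrow> \<bar>X s \<omega> - X t \<omega>\<bar> \<le> e"
          "\<forall>s\<in>rat_times T. \<forall>t\<in>rat_times T. \<bar>s - t\<bar> \<le> dY \<longrightarrow> \<bar>Y s \<omega> - Y t \<omega>\<bar> \<le> e"
          "\<forall>s\<in>rat_times T. \<forall>t\<in>rat_times T. \<bar>s - t\<bar> \<le> dt \<longrightarrow> \<bar>th s \<omega> - th t \<omega>\<bar> \<le> e"
        and c: "continuous_on {0..} (\<lambda>t. X t \<omega>)" "continuous_on {0..} (\<lambda>t. Y t \<omega>)"
        and q: "\<forall>t\<in>rat_times T. X t \<omega> - X 0 \<omega> + g \<omega> * integral {0..t} (\<lambda>s. Y s \<omega>) + S1 t \<omega> = 0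
          \<and> Y t \<omega> - Y 0 \<omega> - g \<omega> * integral {0..t} (\<lambda>s. X s \<omega>) + S2 t \<omega> = 0"
      have gr: "grid T n i \<in> rat_times T" if "i \<le> n" for i using that by (rule grid_in_times)
      have cT: "continuous_on {0..T} (\<lambda>t. X t \<omega>)" "continuous_on {0..T} (\<lambda>t. Y t \<omega>)"
        using c by (auto intro: continuous_on_subset)
      have "\<bar>(X (grid T n n) \<omega> * cos (th (grid T n n) \<omega>) + Y (grid T n n) \<omega> * sin (th (grid T n n) \<omega>))
          - (X (grid T n 0) \<omega> * cos (th (grid T n 0) \<omega>) + Y (grid T n 0) \<omega> * sin (th (grid T n 0) \<omega>))\<bar>
        \<le> 2 * (\<epsilon> / 4) + 2 * K * e * (T + max 0 C)"
      proof (rule rotation_defect_bound[where g="g \<omega>" and sg=sg and h="T / n" and w="\<lambda>i. W (grid T n i) \<omega>"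
            and dSx="\<lambda>i. S1 (grid T n (Suc i)) \<omega> - S1 (grid T n i) \<omega>"
            and dSy="\<lambda>i. S2 (grid T n (Suc i)) \<omega> - S2 (grid T n i) \<omega>"
            and IX="\<lambda>i. integral {0..grid T n (Suc i)} (\<lambda>s. X s \<omega>) - integral {0..grid T n i} (\<lambda>s. X s \<omega>)"
            and IY="\<lambda>i. integral {0..grid T n (Suc i)} (\<lambda>s. Y s \<omega>) - integral {0..grid T n i} (\<lambda>s. Y s \<omega>)"])
        fix i assume i: "i < n"
        have q1: "X (grid T n i) \<omega> - X 0 \<omega> + g \<omega> * integral {0..grid T n i} (\<lambda>s. Y s \<omega>) + S1 (grid T n i) \<omega> = 0"
          "X (grid T n (Suc i)) \<omega> - X 0 \<omega> + g \<omega> * integral {0..grid T n (Suc i)} (\<lambda>s. Y s \<omega>) + S1 (grid T n (Suc i)) \<omega> = 0"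
          "Y (grid T n i) \<omega> - Y 0 \<omega> - g \<omega> * integral {0..grid T n i} (\<lambda>s. X s \<omega>) + S2 (grid T n i) \<omega> = 0"
          "Y (grid T n (Suc i)) \<omega> - Y 0 \<omega> - g \<omega> * integral {0..grid T n (Suc i)} (\<lambda>s. X s \<omega>) + S2 (grid T n (Suc i)) \<omega> = 0"
          using q gr[of i] gr[of "Suc i"] i by auto
        show "X (grid T n (Suc i)) \<omega> - X (grid T n i) \<omega> = - (S1 (grid T n (Suc i)) \<omega> - S1 (grid T n i) \<omega>)
          - g \<omega> * (integral {0..grid T n (Suc i)} (\<lambda>s. Y s \<omega>) - integral {0..grid T n i} (\<lambda>s. Y s \<omega>))"
          unfolding right_diff_distrib using q1(1,2) by linarith
        show "Y (grid T n (Suc i)) \<omega> - Y (grid T n i) \<omega> = - (S2 (grid T n (Suc i)) \<omega> - S2 (grid T n i) \<omega>)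
          + g \<omega> * (integral {0..grid T n (Suc i)} (\<lambda>s. X s \<omega>) - integral {0..grid T n i} (\<lambda>s. X s \<omega>))"
          unfolding right_diff_distrib using q1(3,4) by linarith
        show "th (grid T n (Suc i)) \<omega> - th (grid T n i) \<omega>
            = sg * (W (grid T n (Suc i)) \<omega> - W (grid T n i) \<omega>) + g \<omega> * (T / n)"
          unfolding grid_Suc_diff[of T n i, symmetric] th_def by (simp add: algebra_simps)
        show "\<bar>integral {0..grid T n (Suc i)} (\<lambda>s. X s \<omega>) - integral {0..grid T n i} (\<lambda>s. X s \<omega>)
            - T / n * ((X (grid T n i) \<omega> + X (grid T n (Suc i)) \<omega>) / 2)\<bar> \<le> e * (T / n)"
          by (rule trapezoid_integral_error[OF cT(1) \<open>T > 0\<close> n(1) i nd(1)]) (use o in blast)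
        show "\<bar>integral {0..grid T n (Suc i)} (\<lambda>s. Y s \<omega>) - integral {0..grid T n i} (\<lambda>s. Y s \<omega>)
            - T / n * ((Y (grid T n i) \<omega> + Y (grid T n (Suc i)) \<omega>) / 2)\<bar> \<le> e * (T / n)"
          by (rule trapezoid_integral_error[OF cT(2) \<open>T > 0\<close> n(1) i nd(2)]) (use o in blast)
        show "\<bar>th (grid T n (Suc i)) \<omega> - th (grid T n i) \<omega>\<bar> \<le> e"
          using o(3) gr[of i] gr[of "Suc i"] i nd(3) grid_Suc_diff[of T n i] \<open>T > 0\<close> by simp
      next
        fix i assume i: "i \<le> n"
        show "\<bar>X (grid T n i) \<omega>\<bar> \<le> K" "\<bar>Y (grid T n i) \<omega>\<bar> \<le> K"
          using b(1,2) gr[OF i] unfolding K_def by (auto simp: le_max_iff_disj)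
      next
        show "\<bar>g \<omega>\<bar> \<le> K" using b(3) gr[of 0] unfolding K_def by (auto simp: le_max_iff_disj)
        show "(\<Sum>i<n. (th (grid T n (Suc i)) \<omega> - th (grid T n i) \<omega>)\<^sup>2) \<le> max 0 C"
          using v unfolding sq_var_def by (simp add: le_max_iff_disj)
        show "\<bar>\<Sum>i<n. (cos (th (grid T n i) \<omega>) + cos (th (grid T n (Suc i)) \<omega>)) / 2 *
          (S1 (grid T n (Suc i)) \<omega> - S1 (grid T n i) \<omega> - (W (grid T n (Suc i)) \<omega> - W (grid T n i) \<omega>) *
            ((sg * Y (grid T n i) \<omega> + sg * Y (grid T n (Suc i)) \<omega>) / 2))\<bar> \<le> \<epsilon> / 4"
          using a1 unfolding strat_term_def .
        show "\<bar>\<Sum>i<n. (sin (th (grid T n i) \<omega>) + sin (th (grid T n (Suc i)) \<omega>)) / 2 *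
          (S2 (grid T n (Suc i)) \<omega> - S2 (grid T n i) \<omega> - (W (grid T n (Suc i)) \<omega> - W (grid T n i) \<omega>) *
            ((- sg * X (grid T n i) \<omega> + - sg * X (grid T n (Suc i)) \<omega>) / 2))\<bar> \<le> \<epsilon> / 4"
          using a2 unfolding strat_term_def .
        show "real n * (T / n) = T" using n by simp
        show "e \<ge> 0" using e by simp
      qed
      then show "\<bar>D \<omega>\<bar> \<le> \<epsilon>"
        using e(2) unfolding D_def grid_top[OF n(1)] grid_0 by linarith
    qed
  qed
  then show ?thesis unfolding D_def by eventually_elim simp
qed

end

section \<open>The inverse inertia matrix\<close>

lemma matrix_inv_inertia:
  assumes "I1 \<noteq> 0" "I2 \<noteq> 0" "I3 \<noteq> 0"
  shows "matrix_inv (inertia I1 I2 I3) *v p = vector [p $ 1 / I1, p $ 2 / I2, p $ 3 / I3]"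
proof -
  let ?A = "inertia I1 I2 I3" and ?B = "inertia (1 / I1) (1 / I2) (1 / I3)"
  have AB: "?A ** ?B = mat 1" "?B ** ?A = mat 1"
    using assms by (auto simp: inertia_def matrix_matrix_mult_def mat_def vec_eq_iff forall_3 sum_3)
  \<comment> \<open>\<open>matrix_inv\<close> is a choice among two-sided inverses; the explicit
    inverse shows that one exists, and uniqueness then identifies the chosen one.\<close>
  then have "matrix_inv ?A ** ?A = mat 1"
    unfolding matrix_inv_def by (rule someI2[of _ ?B, OF conjI]) blast
  then have "matrix_inv ?A = ?B"
    using AB by (metis matrix_mul_assoc matrix_mul_lid matrix_mul_rid)
  then show ?thesis
    by (simp add: inertia_def matrix_vector_mult_def vec_eq_iff forall_3 sum_3)
qed

theorem mainTheorem9: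
  fixes M :: "'a measure" and F :: "real \<Rightarrow> 'a measure"
    and W :: "real \<Rightarrow> 'a \<Rightarrow> real" and P :: "real \<Rightarrow> 'a \<Rightarrow> real^3"
    and I1 I3 \<sigma>3 a :: real
  assumes "filtered_prob_space M F"
    and "wiener_process M F W"
    and "I1 > 0" and "I3 > 0"
    and "rigid_body_solution M F W (inertia I1 I1 I3) (vector [0, 0, \<sigma>3]) P"
    and "a = (I1 - I3) / (I1 * I3)"
  shows "AE \<omega> in M. \<forall>t\<ge>0.
      energy (inertia I1 I1 I3) (P t \<omega>) = energy (inertia I1 I1 I3) (P 0 \<omega>) \<and>
      P t \<omega> $ 3 = P 0 \<omega> $ 3 \<and>
      (let \<gamma> = a * P 0 \<omega> $ 3 in
         P t \<omega> $ 1 = P 0 \<omega> $ 1 * cos (\<gamma> * t + \<sigma>3 * W t \<omega>)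
                    - P 0 \<omega> $ 2 * sin (\<gamma> * t + \<sigma>3 * W t \<omega>) \<and>
         P t \<omega> $ 2 = P 0 \<omega> $ 2 * cos (\<gamma> * t + \<sigma>3 * W t \<omega>)
                    + P 0 \<omega> $ 1 * sin (\<gamma> * t + \<sigma>3 * W t \<omega>))"
proof -
  interpret prob_space M using assms(1) by (simp add: filtered_prob_space_def)
  interpret filtered_wiener M F W by unfold_locales (use assms in auto)
  define p where "p k t \<omega> = P t \<omega> $ k" for k t \<omega>
  have semi: "continuous_semimartingale M F (p k)" for k
    using assms(5) unfolding rigid_body_solution_def p_def by blast
  have pa: "adapted F (p k)" and pc: "continuous_paths M (p k)" for k
    using semi[of k] by (auto simp: continuous_semimartingale_def)
  have pb: "bounded_in_prob M (sq_var T (p k))" if "T > 0" for k T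
    by (rule semimartingale_sq_var[OF semi that])
  have inv: "matrix_inv (inertia I1 I1 I3) *v q = vector [q $ 1 / I1, q $ 2 / I1, q $ 3 / I3]" for q
    using assms(3,4) by (intro matrix_inv_inertia) auto

  \<comment> \<open>The equation in components\<close>
  have noise: "cross3 (P s \<omega>) (vector [0, 0, \<sigma>3])
      = (\<sigma>3 * p 2 s \<omega>) *\<^sub>R axis 1 1 + (- \<sigma>3 * p 1 s \<omega>) *\<^sub>R axis 2 1" for s \<omega>
    by (simp add: cross3_def p_def vec_eq_iff forall_3 axis_def)
  \<comment> \<open>Here 1/I3 - 1/I1 = a, and equality of the first two moments of inertia removes
    the third component.\<close>
  have drift: "cross3 (P s \<omega>) (angular_velocity (inertia I1 I1 I3) (P s \<omega>))
      = (a * p 3 s \<omega> * p 2 s \<omega>) *\<^sub>R axis 1 1 + (- (a * p 3 s \<omega> * p 1 s \<omega>)) *\<^sub>R axis 2 1" for s \<omega>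
    unfolding angular_velocity_def inv assms(6)
    using assms(3,4) by (simp add: cross3_def p_def vec_eq_iff forall_3 axis_def field_simps)
  obtain S where S: "\<And>t. t \<ge> 0 \<Longrightarrow> has_stratonovich_integral M W t (\<lambda>s \<omega>. cross3 (P s \<omega>) (vector [0, 0, \<sigma>3])) (S t)"
    and eq: "\<And>t. t \<ge> 0 \<Longrightarrow> AE \<omega> in M. P t \<omega> - P 0 \<omega>
           + integral {0..t} (\<lambda>s. cross3 (P s \<omega>) (angular_velocity (inertia I1 I1 I3) (P s \<omega>))) + S t \<omega> = 0"
    using assms(5) unfolding rigid_body_solution_def by blast
  have na: "adapted F (\<lambda>s \<omega>. cross3 (P s \<omega>) (vector [0, 0, \<sigma>3]))"
    unfolding noise adapted_def
  proof (intro allI impI)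
    fix t :: real assume "t \<ge> 0"
    then have [measurable]: "p 1 t \<in> borel_measurable (F t)" "p 2 t \<in> borel_measurable (F t)"
      using pa[of 1] pa[of 2] by (auto simp: adapted_def)
    show "(\<lambda>\<omega>. (\<sigma>3 * p 2 t \<omega>) *\<^sub>R axis 1 1 + (- \<sigma>3 * p 1 t \<omega>) *\<^sub>R axis 2 1 :: real^3) \<in> borel_measurable (F t)"
      by measurable
  qed
  \<comment> \<open>The negated integrals serve the second application of
    \<open>rotated_coordinate_conserved\<close>, where the second coordinate is
    \<open>- p 1\<close>.\<close>
  have Sk: "has_stratonovich_integral M W t (\<lambda>s \<omega>. cross3 (P s \<omega>) (vector [0, 0, \<sigma>3]) $ k) (\<lambda>\<omega>. S t \<omega> $ k)"
    "has_stratonovich_integral M W t (\<lambda>s \<omega>. - cross3 (P s \<omega>) (vector [0, 0, \<sigma>3]) $ k) (\<lambda>\<omega>. - S t \<omega> $ k)"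
    if "t \<ge> 0" for t k
    using has_stratonovich_integral_inner[OF S[OF that] na, of "axis k 1"]
      has_stratonovich_integral_inner[OF S[OF that] na, of "- axis k 1"]
    by (simp_all add: inner_axis')
  have S1: "has_stratonovich_integral M W t (\<lambda>s \<omega>. \<sigma>3 * p 2 s \<omega>) (\<lambda>\<omega>. S t \<omega> $ 1)"
    and S2: "has_stratonovich_integral M W t (\<lambda>s \<omega>. - \<sigma>3 * p 1 s \<omega>) (\<lambda>\<omega>. S t \<omega> $ 2)"
    and S3: "has_stratonovich_integral M W t (\<lambda>s \<omega>. 0) (\<lambda>\<omega>. S t \<omega> $ 3)" if "t \<ge> 0" for t
    using Sk(1)[OF that, of 1] Sk(1)[OF that, of 2] Sk(1)[OF that, of 3] unfolding noise
    by (simp_all add: axis_def)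
  have paths: "AE \<omega> in M. \<forall>k. continuous_on {0..} (\<lambda>t. p k t \<omega>)"
    using pc unfolding continuous_paths_def forall_3 by auto
  have comp: "AE \<omega> in M.
      p 1 t \<omega> - p 1 0 \<omega> + integral {0..t} (\<lambda>s. a * p 3 s \<omega> * p 2 s \<omega>) + S t \<omega> $ 1 = 0 \<and>
      p 2 t \<omega> - p 2 0 \<omega> - integral {0..t} (\<lambda>s. a * p 3 s \<omega> * p 1 s \<omega>) + S t \<omega> $ 2 = 0 \<and>
      p 3 t \<omega> - p 3 0 \<omega> + S t \<omega> $ 3 = 0" if "t \<ge> 0" for t
    using eq[OF that] paths
  proof eventually_elim
    case (elim \<omega>)
    have c: "continuous_on {0..t} (\<lambda>s. p k s \<omega>)" for k
      using elim(2) by (auto intro: continuous_on_subset)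
    \<comment> \<open>Taking components inside \<open>integral\<close> requires integrability of the
      vector-valued drift, which continuity of the path provides.\<close>
    have "(\<lambda>s. cross3 (P s \<omega>) (angular_velocity (inertia I1 I1 I3) (P s \<omega>))) integrable_on {0..t}"
      unfolding drift by (intro integrable_continuous_interval continuous_intros c)
    then have i: "integral {0..t} (\<lambda>s. cross3 (P s \<omega>) (angular_velocity (inertia I1 I1 I3) (P s \<omega>))) $ k
        = integral {0..t} (\<lambda>s. cross3 (P s \<omega>) (angular_velocity (inertia I1 I1 I3) (P s \<omega>)) $ k)" for k
      by (rule integral_component_eq_cart[symmetric])
    show ?case
      using elim(1)[unfolded vec_eq_iff forall_3 vector_add_component vector_minus_component i, unfolded drift]
      by (simp add: p_def[symmetric] axis_def)
  qed

  \<comment> \<open>Constancy of the third component\<close>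
  have p3: "AE \<omega> in M. \<forall>t\<ge>0. p 3 t \<omega> = p 3 0 \<omega>"
  proof -
    have "AE \<omega> in M. \<forall>q\<in>\<rat> \<inter> {0..}. p 3 q \<omega> = p 3 0 \<omega>"
    proof (rule AE_ball_countable')
      fix q :: real assume "q \<in> \<rat> \<inter> {0..}"
      then have q: "q \<ge> 0" by simp
      \<comment> \<open>Neither drift nor noise has a third component, so the increment is minus the
        integral of the zero process.\<close>
      show "AE \<omega> in M. p 3 q \<omega> = p 3 0 \<omega>"
        using comp[OF q] stratonovich_integral_of_zero[OF S3[OF q] q] by eventually_elim simp
    qed (simp add: countable_rat)
    then show ?thesis
      using paths
    proof eventually_elim
      case (elim \<omega>)
      show ?case
      proof (intro allI impI)
        fix t :: real assume "t \<ge> 0"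
        show "p 3 t \<omega> = p 3 0 \<omega>"
        proof (rule continuous_eq_if_eq_on_Rats[OF _ continuous_on_const _ \<open>t \<ge> 0\<close>])
          show "continuous_on {0..} (\<lambda>t. p 3 t \<omega>)" using elim(2) by blast
          show "p 3 q \<omega> = p 3 0 \<omega>" if "q \<in> \<rat>" "q \<ge> 0" for q
            using bspec[OF elim(1), of q] that by blast
        qed
      qed
    qed
  qed

  \<comment> \<open>Conservation of the two coordinates rotated with the random angular
    speed\<close>
  define g where "g \<omega> = a * p 3 0 \<omega>" for \<omega>
  have gm: "g \<in> borel_measurable (F 0)"
    unfolding g_def using pa[of 3] by (auto simp: adapted_def)
  \<comment> \<open>Constancy of the third component makes the quadratic drift linear, and the speed
    leaves the time integral.\<close>
  have eqs: "AE \<omega> in M. p 1 t \<omega> - p 1 0 \<omega> + g \<omega> * integral {0..t} (\<lambda>s. p 2 s \<omega>) + S t \<omega> $ 1 = 0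
      \<and> p 2 t \<omega> - p 2 0 \<omega> - g \<omega> * integral {0..t} (\<lambda>s. p 1 s \<omega>) + S t \<omega> $ 2 = 0" if "t \<ge> 0" for t
    using comp[OF that] p3
  proof eventually_elim
    case (elim \<omega>)
    have "integral {0..t} (\<lambda>s. a * p 3 s \<omega> * p k s \<omega>) = integral {0..t} (\<lambda>s. g \<omega> * p k s \<omega>)" for k
    proof (rule Henstock_Kurzweil_Integration.integral_cong)
      fix s assume "s \<in> {0..t}"
      then have "p 3 s \<omega> = p 3 0 \<omega>" using elim(2) by (meson atLeastAtMost_iff)
      then show "a * p 3 s \<omega> * p k s \<omega> = g \<omega> * p k s \<omega>" by (simp only: g_def)
    qed
    then show ?case using elim(1) by simp
  qed
  define th where "th t \<omega> = \<sigma>3 * W t \<omega> + g \<omega> * t" for t \<omega>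
  have rot1: "AE \<omega> in M. p 1 T \<omega> * cos (th T \<omega>) + p 2 T \<omega> * sin (th T \<omega>)
      = p 1 0 \<omega> * cos (th 0 \<omega>) + p 2 0 \<omega> * sin (th 0 \<omega>)" if "T > 0" for T
    unfolding th_def
  proof (rule rotated_coordinate_conserved[OF pa pc pb[OF that] pa pc pb[OF that] gm that])
    fix t assume "t \<in> {0..T}"
    then have t: "t \<ge> 0" by simp
    show "has_stratonovich_integral M W t (\<lambda>s \<omega>. \<sigma>3 * p 2 s \<omega>) (\<lambda>\<omega>. S t \<omega> $ 1)" by (rule S1[OF t])
    show "has_stratonovich_integral M W t (\<lambda>s \<omega>. - \<sigma>3 * p 1 s \<omega>) (\<lambda>\<omega>. S t \<omega> $ 2)" by (rule S2[OF t])
    show "AE \<omega> in M. p 1 t \<omega> - p 1 0 \<omega> + g \<omega> * integral {0..t} (\<lambda>s. p 2 s \<omega>) + S t \<omega> $ 1 = 0"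
      using eqs[OF t] by eventually_elim blast
    show "AE \<omega> in M. p 2 t \<omega> - p 2 0 \<omega> - g \<omega> * integral {0..t} (\<lambda>s. p 1 s \<omega>) + S t \<omega> $ 2 = 0"
      using eqs[OF t] by eventually_elim blast
  qed
  \<comment> \<open>The system is invariant under the quarter turn \<open>(p\<^sub>1, p\<^sub>2) \<mapsto> (p\<^sub>2, -p\<^sub>1)\<close>.\<close>
  have m: "adapted F (\<lambda>t \<omega>. - p 1 t \<omega>)" "continuous_paths M (\<lambda>t \<omega>. - p 1 t \<omega>)"
    by (auto intro!: adapted_compose[OF pa] continuous_paths_compose[OF pc] continuous_intros)
  have mb: "bounded_in_prob M (sq_var T (\<lambda>t \<omega>. - p 1 t \<omega>))" if "T > 0" for T
    by (rule bounded_in_prob_sq_var_dominated[OF pb[OF that, of 1], of _ 1]) auto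
  have rot2: "AE \<omega> in M. p 2 T \<omega> * cos (th T \<omega>) + - p 1 T \<omega> * sin (th T \<omega>)
      = p 2 0 \<omega> * cos (th 0 \<omega>) + - p 1 0 \<omega> * sin (th 0 \<omega>)" if "T > 0" for T
    unfolding th_def
  proof (rule rotated_coordinate_conserved[OF pa pc pb[OF that] m mb[OF that] gm that])
    fix t assume "t \<in> {0..T}"
    then have t: "t \<ge> 0" by simp
    show "has_stratonovich_integral M W t (\<lambda>s \<omega>. \<sigma>3 * - p 1 s \<omega>) (\<lambda>\<omega>. S t \<omega> $ 2)"
      using S2[OF t] by simp
    show "has_stratonovich_integral M W t (\<lambda>s \<omega>. - \<sigma>3 * p 2 s \<omega>) (\<lambda>\<omega>. - S t \<omega> $ 1)"
      using Sk(2)[OF t, of 1] unfolding noise by (simp add: axis_def)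
    show "AE \<omega> in M. p 2 t \<omega> - p 2 0 \<omega> + g \<omega> * integral {0..t} (\<lambda>s. - p 1 s \<omega>) + S t \<omega> $ 2 = 0"
      using eqs[OF t] by eventually_elim simp
    show "AE \<omega> in M. - p 1 t \<omega> - - p 1 0 \<omega> - g \<omega> * integral {0..t} (\<lambda>s. p 2 s \<omega>) + - S t \<omega> $ 1 = 0"
      using eqs[OF t] by eventually_elim linarith
  qed

  \<comment> \<open>Passage from rational times to all times, and the explicit solution\<close>
  have "AE \<omega> in M. \<forall>q\<in>\<rat> \<inter> {0..}. p 1 q \<omega> * cos (th q \<omega>) + p 2 q \<omega> * sin (th q \<omega>)
      = p 1 0 \<omega> * cos (th 0 \<omega>) + p 2 0 \<omega> * sin (th 0 \<omega>)
    \<and> p 2 q \<omega> * cos (th q \<omega>) - p 1 q \<omega> * sin (th q \<omega>) = p 2 0 \<omega> * cos (th 0 \<omega>) - p 1 0 \<omega> * sin (th 0 \<omega>)"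
  proof (rule AE_ball_countable')
    fix q :: real assume "q \<in> \<rat> \<inter> {0..}"
    \<comment> \<open>The conservation lemma needs a positive time horizon; at time 0 both
      identities are trivial.\<close>
    then consider "q = 0" | "q > 0" by force
    then show "AE \<omega> in M. p 1 q \<omega> * cos (th q \<omega>) + p 2 q \<omega> * sin (th q \<omega>)
        = p 1 0 \<omega> * cos (th 0 \<omega>) + p 2 0 \<omega> * sin (th 0 \<omega>)
      \<and> p 2 q \<omega> * cos (th q \<omega>) - p 1 q \<omega> * sin (th q \<omega>) = p 2 0 \<omega> * cos (th 0 \<omega>) - p 1 0 \<omega> * sin (th 0 \<omega>)"
    proof cases
      case 2
      show ?thesis using rot1[OF 2] rot2[OF 2] by eventually_elim simp
    qed simp
  qed (simp add: countable_rat)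
  moreover have "AE \<omega> in M. W 0 \<omega> = 0" "AE \<omega> in M. continuous_on {0..} (\<lambda>t. W t \<omega>)"
    using assms(2) by (auto simp: wiener_process_def continuous_paths_def)
  ultimately show ?thesis
    using paths p3
  proof eventually_elim
    case (elim \<omega>)
    have th0: "th 0 \<omega> = 0" using elim(2) by (simp add: th_def)
    have thc: "continuous_on {0..} (\<lambda>t. th t \<omega>)"
      unfolding th_def using elim(3) by (intro continuous_intros)
    have pk: "continuous_on {0..} (\<lambda>t. p k t \<omega>)" for k using elim(4) by blast
    show ?case
    proof (intro allI impI)
      fix t :: real assume t: "t \<ge> 0"
      have rat: "p 1 q \<omega> * cos (th q \<omega>) + p 2 q \<omega> * sin (th q \<omega>) = p 1 0 \<omega>"
          "p 2 q \<omega> * cos (th q \<omega>) - p 1 q \<omega> * sin (th q \<omega>) = p 2 0 \<omega>" if "q \<in> \<rat>" "q \<ge> 0" for q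
        using bspec[OF elim(1), of q] that by (simp_all add: th0)
      have r: "p 1 t \<omega> * cos (th t \<omega>) + p 2 t \<omega> * sin (th t \<omega>) = p 1 0 \<omega>"
        by (rule continuous_eq_if_eq_on_Rats[OF _ continuous_on_const rat(1) t])
           (intro continuous_intros pk thc)
      have s: "p 2 t \<omega> * cos (th t \<omega>) - p 1 t \<omega> * sin (th t \<omega>) = p 2 0 \<omega>"
        by (rule continuous_eq_if_eq_on_Rats[OF _ continuous_on_const rat(2) t])
           (intro continuous_intros pk thc)
      have cs: "(cos (th t \<omega>))\<^sup>2 + (sin (th t \<omega>))\<^sup>2 = 1" by simp
      \<comment> \<open>The conserved pair is the current pair rotated back, so rotating forward by
        the same angle recovers the solution.\<close>
      have P1: "p 1 t \<omega> = p 1 0 \<omega> * cos (th t \<omega>) - p 2 0 \<omega> * sin (th t \<omega>)"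
        unfolding r[symmetric] s[symmetric] using cs by algebra
      have P2: "p 2 t \<omega> = p 2 0 \<omega> * cos (th t \<omega>) + p 1 0 \<omega> * sin (th t \<omega>)"
        unfolding r[symmetric] s[symmetric] using cs by algebra
      have P3: "p 3 t \<omega> = p 3 0 \<omega>" using elim(5) t by blast
      have en: "energy (inertia I1 I1 I3) (P s \<omega>) = (((p 1 s \<omega>)\<^sup>2 + (p 2 s \<omega>)\<^sup>2) / I1 + (p 3 s \<omega>)\<^sup>2 / I3) / 2" for s
        unfolding energy_def inv p_def
        by (simp add: inner_vec_def sum_3 power2_eq_square add_divide_distrib)
      have "(p 1 t \<omega>)\<^sup>2 + (p 2 t \<omega>)\<^sup>2 = (p 1 0 \<omega>)\<^sup>2 + (p 2 0 \<omega>)\<^sup>2"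
        unfolding P1 P2 using cs by algebra
      then have "energy (inertia I1 I1 I3) (P t \<omega>) = energy (inertia I1 I1 I3) (P 0 \<omega>)"
        unfolding en P3 by simp
      then show "energy (inertia I1 I1 I3) (P t \<omega>) = energy (inertia I1 I1 I3) (P 0 \<omega>) \<and>
        P t \<omega> $ 3 = P 0 \<omega> $ 3 \<and>
        (let \<gamma> = a * P 0 \<omega> $ 3 in
         P t \<omega> $ 1 = P 0 \<omega> $ 1 * cos (\<gamma> * t + \<sigma>3 * W t \<omega>)
                    - P 0 \<omega> $ 2 * sin (\<gamma> * t + \<sigma>3 * W t \<omega>) \<and>
         P t \<omega> $ 2 = P 0 \<omega> $ 2 * cos (\<gamma> * t + \<sigma>3 * W t \<omega>)
                    + P 0 \<omega> $ 1 * sin (\<gamma> * t + \<sigma>3 * W t \<omega>))"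
        using P1 P2 P3 by (simp add: th_def g_def p_def Let_def add.commute)
    qed
  qed
qed

end
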